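(* Let $p\in P^{Log}(\mathbb{R})$, $r\in\mathbb{N}$, $\delta>0$ and $f\in L_{p(\cdot)}$. Then the K-functional $K_r(f,\delta,p(\cdot))_{p(\cdot)}$ and the modulus $\Omega_r(f,\delta)_{p(\cdot)}$ are equivalent, namely $$\frac{1}{48\,c_7\,2^r\,c_5}\le\frac{K_r(f,\delta,p(\cdot))_{p(\cdot)}}{\Omega_r(f,\delta)_{p(\cdot)}}\le 48\,c_7\left\{(2r)^r+2^r(34)^r\right\}c_5 .$$
   Context: For a measurable function $p:\mathbb{R}\to[1,\infty)$ let $p^-=\operatorname{ess\,inf}_{\mathbb{R}}p$ and $p^+=\operatorname{ess\,sup}_{\mathbb{R}}p$. The class $P^{Log}(\mathbb{R})$ consists of all measurable $p:\mathbb{R}\to[1,\infty)$ with $1\le p^-$, $p^+<\infty$ for which there are positive constants $c_1(p),c_2(p)$ and a number $p_\infty>1$ such that, for all $x,y\in\mathbb{R}$, $|\frac1{p(x)}-\frac1{p(y)}|\log(e+1/|x-y|)\le c_1(p)$ (for $x\neq y$) and $|\frac1{p(x)}-\frac1{p_\infty}|\log(e+|x|)\le c_2(p)$. Put $c_3(p)=\max\{c_1(p),c_2(p)\}$. $L_{p(\cdot)}$ is the set of measurable $f:\mathbb{R}\to\mathbb{R}$ with $\int_{\mathbb{R}}|f(y)/\lambda|^{p(y)}dy<\infty$ for some $\lambda>0$, with norm $\|f\|_{p(\cdot)}=\inf\{\eta>0:\int_{\mathbb{R}}|f(y)/\eta|^{p(y)}dy<1\}$. $W^r_{p(\cdot)}$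 is the class of $f\in L_{p(\cdot)}$ such that $f^{(k)}$ exists for $k=1,\dots,r-1$, $f^{(r-1)}$ is absolutely continuous and $f^{(r)}\in L_{p(\cdot)}$. The K-functional is $K_r(f,\delta,p(\cdot))_{p(\cdot)}=\inf_{g\in W^r_{p(\cdot)}}\{\|f-g\|_{p(\cdot)}+\delta^r\|g^{(r)}\|_{p(\cdot)}\}$. $T_\delta f(x)=\frac1\delta\int_0^\delta f(x+t)\,dt$, $I$ is the identity operator, and $\Omega_r(f,\delta)_{p(\cdot)}=\|(I-T_\delta)^rf\|_{p(\cdot)}$. Constants: $c_5=2^{p^++1}3^{p^+}\big(1+2\cdot3^{p^+}\big[\sum_{k=2}^\infty2^{-k}+2\big]\big)\exp(8c_3(p))$ and $c_7=2\exp(8c_3(p))$. *)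

theory Defs
  imports "HOL-Analysis.Analysis" "HOL-Probability.Essential_Supremum"
begin

section \<open>Exponents\<close>

text \<open>The library defines \<open>esssup\<close> as the \<open>Limsup\<close> along the almost-everywhere filter and has no
  essential infimum; \<open>p_minus\<close> is the dual expression.\<close>

definition p_plus :: "(real \<Rightarrow> real) \<Rightarrow> ereal" where
  "p_plus p = esssup lebesgue (\<lambda>x. ereal (p x))"

definition p_minus :: "(real \<Rightarrow> real) \<Rightarrow> ereal" where
  "p_minus p = Liminf (ae_filter lebesgue) (\<lambda>x. ereal (p x))"

text \<open>\<open>c\<^sub>1\<close>, \<open>c\<^sub>2\<close> are admissible constants for the local log-Hoelder condition and for the decay
  condition at infinity. They are not determined by \<open>p\<close>.\<close>

definition log_Hoelder_constants :: "(real \<Rightarrow> real) \<Rightarrow> real \<Rightarrow> real \<Rightarrow> bool" where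
  "log_Hoelder_constants p c\<^sub>1 c\<^sub>2 \<longleftrightarrow>
     0 < c\<^sub>1 \<and> 0 < c\<^sub>2 \<and>
     (\<forall>x y. x \<noteq> y \<longrightarrow> \<bar>1 / p x - 1 / p y\<bar> * ln (exp 1 + 1 / \<bar>x - y\<bar>) \<le> c\<^sub>1) \<and>
     (\<exists>p_inf > 1. \<forall>x. \<bar>1 / p x - 1 / p_inf\<bar> * ln (exp 1 + \<bar>x\<bar>) \<le> c\<^sub>2)"

definition P_Log :: "(real \<Rightarrow> real) set" where
  "P_Log = {p \<in> borel_measurable lebesgue.
     (\<forall>x. 1 \<le> p x) \<and> 1 \<le> p_minus p \<and> p_plus p < \<infinity> \<and>
     (\<exists>c\<^sub>1 c\<^sub>2. log_Hoelder_constants p c\<^sub>1 c\<^sub>2)}"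

section \<open>Variable exponent Lebesgue and Sobolev spaces\<close>

definition modular :: "(real \<Rightarrow> real) \<Rightarrow> (real \<Rightarrow> real) \<Rightarrow> ennreal" where
  "modular p f = (\<integral>\<^sup>+ y. ennreal (\<bar>f y\<bar> powr p y) \<partial>lebesgue)"

definition Lp_space :: "(real \<Rightarrow> real) \<Rightarrow> (real \<Rightarrow> real) set" where
  "Lp_space p = {f \<in> borel_measurable lebesgue. \<exists>l > 0. modular p (\<lambda>y. f y / l) < \<infinity>}"

text \<open>This is a real infimum, so it is meaningful only for \<open>f\<close> in \<open>Lp_space p\<close>; the set
  below is then nonempty, since \<open>p \<ge> 1\<close>.\<close>

definition Lp_norm :: "(real \<Rightarrow> real) \<Rightarrow> (real \<Rightarrow> real) \<Rightarrow> real" where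
  "Lp_norm p f = Inf {\<eta>. 0 < \<eta> \<and> modular p (\<lambda>y. f y / \<eta>) < 1}"

text \<open>Absolute continuity of a function on the line; a pair \<open>(a, b)\<close> stands for the interval from
  \<open>a\<close> to \<open>b\<close>.\<close>

definition abs_continuous :: "(real \<Rightarrow> real) \<Rightarrow> bool" where
  "abs_continuous f \<longleftrightarrow>
     (\<forall>\<epsilon> > 0. \<exists>\<eta> > 0. \<forall>D.
        finite D \<and> (\<forall>(a, b) \<in> D. a < b) \<and>
        pairwise (\<lambda>(a, b) (c, d). disjnt {a<..<b} {c<..<d}) D \<and>
        (\<Sum>(a, b) \<in> D. b - a) < \<eta>
        \<longrightarrow> (\<Sum>(a, b) \<in> D. \<bar>f b - f a\<bar>) < \<epsilon>)"

text \<open>Intended for \<open>r \<ge> 1\<close>. The derivative of order \<open>r\<close> exists only almost everywhere; on the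
  exceptional null set \<open>deriv\<close> has an unspecified value, which affects neither measurability nor
  the norm.\<close>

definition Sobolev :: "nat \<Rightarrow> (real \<Rightarrow> real) \<Rightarrow> (real \<Rightarrow> real) set" where
  "Sobolev r p = {f \<in> Lp_space p.
     (\<forall>k < r - 1. \<forall>x. (deriv ^^ k) f differentiable at x) \<and>
     abs_continuous ((deriv ^^ (r - 1)) f) \<and>
     (deriv ^^ r) f \<in> Lp_space p}"

section \<open>K-functional and modulus of smoothness\<close>

definition K_functional :: "nat \<Rightarrow> (real \<Rightarrow> real) \<Rightarrow> real \<Rightarrow> (real \<Rightarrow> real) \<Rightarrow> real" where
  "K_functional r f \<delta> p =
     (INF g \<in> Sobolev r p. Lp_norm p (\<lambda>x. f x - g x) + \<delta> ^ r * Lp_norm p ((deriv ^^ r) g))"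

definition Steklov :: "real \<Rightarrow> (real \<Rightarrow> real) \<Rightarrow> real \<Rightarrow> real" where
  "Steklov \<delta> f x = 1 / \<delta> * (LINT t:{0..\<delta>}|lebesgue. f (x + t))"

definition modulus :: "nat \<Rightarrow> (real \<Rightarrow> real) \<Rightarrow> real \<Rightarrow> (real \<Rightarrow> real) \<Rightarrow> real" where
  "modulus r f \<delta> p = Lp_norm p (((\<lambda>g x. g x - Steklov \<delta> g x) ^^ r) f)"

section \<open>Constants\<close>

definition c5 :: "(real \<Rightarrow> real) \<Rightarrow> real \<Rightarrow> real" where
  "c5 p c\<^sub>3 = (let q = real_of_ereal (p_plus p) in
     2 powr (q + 1) * 3 powr q * (1 + 2 * 3 powr q * ((\<Sum>k. 1 / 2 ^ (k + 2)) + 2)) * exp (8 * c\<^sub>3))"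

definition c7 :: "real \<Rightarrow> real" where
  "c7 c\<^sub>3 = 2 * exp (8 * c\<^sub>3)"

end

theory Submission
  imports Defs "HOL-Real_Asymp.Real_Asymp"
begin

text \<open>Let \<open>T\<close> be the Steklov average and let \<open>k\<close> be an integrable kernel on the half-line. After rescaling
  by \<open>\<delta>\<close>, all operators below are polynomials in averages \<open>f \<mapsto> (\<lambda>x. \<integral> k(t) f(x + \<delta> t) dt)\<close>; the kernel
  of \<open>T\<close> is the indicator of \<open>[0, 1]\<close>. The estimates may lose factors such as \<open>2^r\<close>, but the dependence on the
  exponent must not be raised to the power \<open>r\<close>. Since the norm of \<open>T\<close> on a variable exponent space may
  exceed 1, norms cannot be multiplied along a product of \<open>r\<close> operators.

  Instead, only one operator is estimated on the space, namely
  \<open>N f(x) = \<integral> e^(-t/2) |f(x + \<delta> t)| dt\<close> over \<open>t \<ge> 0\<close>, whose norm is at most \<open>72 exp (4 c\<^sub>3)\<close> whatever \<open>\<delta>\<close> is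
  (\<open>Lp_decay_mean\<close>). All other estimates are pointwise: translating by \<open>s \<ge> 0\<close> costs the weight a
  factor \<open>e^(s/2)\<close>, so the average \<open>A\<close> with kernel \<open>k\<close> satisfies \<open>N (A f) \<le> m N f\<close> with the exponential moment
  \<open>m = \<integral> |k(t)| e^(t/2) dt\<close>. These moments do multiply, and the bound for \<open>N\<close> is spent once, at the end
  (\<open>dominated_trans\<close>, \<open>Lp_dominated\<close>).

  Modulus by K-functional: the kernel of \<open>(I - T)\<^sup>2\<close> has moment below 4 because two of its parts
  cancel partially, so \<open>(I - T)^r\<close> is bounded by a constant times \<open>2^r\<close> (\<open>dominated_box_residual_power\<close>).
  For \<open>g\<close> in the Sobolev class, \<open>(I - T) g = - \<delta> V g'\<close>, where \<open>V\<close> averages with the kernel \<open>1 - t\<close> on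
  \<open>[0, 1]\<close>, of moment at most 1; hence \<open>(I - T)^r g = (- \<delta>)^r V^r g^(r)\<close>. The last step needs that an absolutely
  continuous function is the integral of its derivative (\<open>abs_continuous_FTC\<close>), which is proved here
  from the Radon-Nikodym theorem.

  K-functional by modulus: let \<open>E\<close> average with the kernel \<open>e^(-t)\<close>, so that \<open>\<delta> (E f)' = E f - f\<close>, and let
  \<open>K\<close> average with the kernel \<open>t\<close> on \<open>[0, 1]\<close>. Then \<open>I - T = (I - K) (I - E)\<close>, and \<open>K\<close> has moment at most
  \<open>3/4\<close>, so \<open>I - K\<close> can be inverted and \<open>(I - E)^r f\<close> is controlled by \<open>(I - T)^r f\<close>
  (\<open>exp_residual_dominated\<close>). Expanding powers of \<open>E + (I - E) = I\<close> splits every function into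
  \<open>E^(r+1) G f + (I - E)^r H f\<close> with operators \<open>G\<close>, \<open>H\<close> of exponentially growing moment (\<open>exp_splitting\<close>). The
  competitor in the K-functional is \<open>g = E^(r+1) G f\<close>: the error \<open>f - g\<close> is \<open>H (I - E)^r f\<close>, and
  \<open>\<delta>^r g^(r)\<close> is \<open>E G (I - E)^r f\<close> up to sign.\<close>

section \<open>Absolutely continuous functions are integrals of their derivatives\<close>

text \<open>A sorted list of non-overlapping closed intervals, possibly degenerate. Sorted lists are easier to
  cut at a point and to concatenate than disjoint families.\<close>

definition intervals_in :: "real \<Rightarrow> real \<Rightarrow> (real \<times> real) list \<Rightarrow> bool" where
  "intervals_in u v xs \<longleftrightarrow>
     (\<forall>(a, b) \<in> set xs. u \<le> a \<and> a \<le> b \<and> b \<le> v) \<and> sorted_wrt (\<lambda>(a, b) (c, d). b \<le> c) xs"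

definition total_length :: "(real \<times> real) list \<Rightarrow> real" where
  "total_length xs = (\<Sum>(a, b)\<leftarrow>xs. b - a)"

definition increments :: "(real \<Rightarrow> real) \<Rightarrow> (real \<times> real) list \<Rightarrow> real" where
  "increments G xs = (\<Sum>(a, b)\<leftarrow>xs. \<bar>G b - G a\<bar>)"

definition variation :: "(real \<Rightarrow> real) \<Rightarrow> real \<Rightarrow> real \<Rightarrow> ennreal" where
  "variation G u v = (SUP xs \<in> {xs. intervals_in u v xs}. ennreal (increments G xs))"

lemma intervals_in_Nil [simp]: "intervals_in u v []"
  by (simp add: intervals_in_def)

lemma intervals_in_append:
  assumes "intervals_in u v xs" "intervals_in v w ys" "u \<le> v" "v \<le> w"
  shows "intervals_in u w (xs @ ys)"
  using assms unfolding intervals_in_def by (fastforce simp: sorted_wrt_append)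

lemma increments_simps [simp]:
  "increments G [] = 0"
  "increments G (x # xs) = \<bar>G (snd x) - G (fst x)\<bar> + increments G xs"
  "increments G (xs @ ys) = increments G xs + increments G ys"
  by (simp_all add: increments_def case_prod_beta)

lemma total_length_simps [simp]:
  "total_length [] = 0"
  "total_length (x # xs) = snd x - fst x + total_length xs"
  "total_length (xs @ ys) = total_length xs + total_length ys"
  by (simp_all add: total_length_def case_prod_beta)

lemma increments_nonneg [simp]: "0 \<le> increments G xs"
  by (induction xs) auto

lemma intervals_in_Cons:
  "intervals_in u v ((a, b) # xs) \<longleftrightarrow> u \<le> a \<and> a \<le> b \<and> b \<le> v \<and> intervals_in b v xs"
proof
  assume "intervals_in u v ((a, b) # xs)"
  then show "u \<le> a \<and> a \<le> b \<and> b \<le> v \<and> intervals_in b v xs"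
    by (auto simp: intervals_in_def)
next
  assume r: "u \<le> a \<and> a \<le> b \<and> b \<le> v \<and> intervals_in b v xs"
  then show "intervals_in u v ((a, b) # xs)" 
    by (fastforce simp: intervals_in_def)
qed

lemma total_length_le:
  "intervals_in u v xs \<Longrightarrow> u \<le> v \<Longrightarrow> total_length xs \<le> v - u"
proof (induction xs arbitrary: u)
  case (Cons x xs)
  obtain a b where x: "x = (a, b)" by fastforce
  show ?case using Cons.IH[of b] Cons.prems by (auto simp: x intervals_in_Cons)
qed simp

lemma abs_continuous_lists:
  assumes "abs_continuous G" "0 < \<epsilon>"
  obtains \<eta> where "0 < \<eta>"
    "\<And>u v xs. intervals_in u v xs \<Longrightarrow> total_length xs < \<eta> \<Longrightarrow> increments G xs < \<epsilon>"
proof -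
  obtain \<eta> where \<eta>: "0 < \<eta>"
    and *: "\<And>D. finite D \<Longrightarrow> \<forall>(a, b) \<in> D. a < b \<Longrightarrow>
        pairwise (\<lambda>(a, b) (c, d). disjnt {a<..<b} {c<..<d}) D \<Longrightarrow>
        (\<Sum>(a, b) \<in> D. b - a) < \<eta> \<Longrightarrow> (\<Sum>(a, b) \<in> D. \<bar>G b - G a\<bar>) < \<epsilon>"
    using assms unfolding abs_continuous_def by meson
  show thesis
  proof (rule that[OF \<eta>])
    fix u v xs assume xs: "intervals_in u v xs" "total_length xs < \<eta>"
    define ys where "ys = filter (\<lambda>(a, b). a < b) xs"
    have sums: "increments G (filter (\<lambda>(a, b). a < b) zs) = increments G zs
        \<and> total_length (filter (\<lambda>(a, b). a < b) zs) = total_length zs"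
      if "\<forall>(a, b) \<in> set zs. a \<le> b" for zs
      using that by (induction zs) auto
    have le: "\<forall>(a, b) \<in> set xs. a \<le> b" using xs by (auto simp: intervals_in_def)
    have "sorted_wrt (\<lambda>(a, b) (c, d). b \<le> c) ys"
      using xs unfolding ys_def intervals_in_def by (intro sorted_wrt_filter) auto
    moreover have lt: "\<forall>(a, b) \<in> set ys. a < b" by (auto simp: ys_def)
    ultimately have "distinct ys \<and> pairwise (\<lambda>(a, b) (c, d). disjnt {a<..<b} {c<..<d}) (set ys)"
      by (induction ys) (fastforce simp: pairwise_insert disjnt_def)+
    then have d: "distinct ys" "pairwise (\<lambda>(a, b) (c, d). disjnt {a<..<b} {c<..<d}) (set ys)"
      by blast+
    have "(\<Sum>(a, b) \<in> set ys. b - a) = total_length ys"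
      "(\<Sum>(a, b) \<in> set ys. \<bar>G b - G a\<bar>) = increments G ys"
      unfolding increments_def total_length_def using d(1)
      by (simp_all only: sum_list_distinct_conv_sum_set)
    moreover have "increments G ys = increments G xs" "total_length ys = total_length xs"
      unfolding ys_def using sums[OF le] by blast+
    ultimately show "increments G xs < \<epsilon>"
      using *[OF finite_set lt d(2)] xs(2) by metis
  qed
qed


lemma variation_upper: "intervals_in u v xs \<Longrightarrow> ennreal (increments G xs) \<le> variation G u v"
  unfolding variation_def by (rule SUP_upper) auto

lemma increment_le_variation: "u \<le> v \<Longrightarrow> ennreal \<bar>G v - G u\<bar> \<le> variation G u v"
  using variation_upper[of u v "[(u, v)]" G] by (simp add: intervals_in_Cons)

text \<open>Cutting all intervals at \<open>v\<close>, with \<open>min\<close> and \<open>max\<close>, gives one inequality, because degenerate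
  intervals are allowed; concatenation gives the other.\<close>

lemma variation_add:
  assumes "u \<le> v" "v \<le> w"
  shows "variation G u w = variation G u v + variation G v w"
proof (rule antisym)
  show "variation G u w \<le> variation G u v + variation G v w"
    unfolding variation_def[of G u w]
  proof (rule SUP_least, clarify)
    fix xs assume xs: "intervals_in u w xs"
    define ys where "ys = map (\<lambda>(a, b). (min a v, min b v)) xs"
    define zs where "zs = map (\<lambda>(a, b). (max a v, max b v)) xs"
    have "intervals_in u v ys" using xs assms unfolding ys_def intervals_in_def
      by (auto simp: sorted_wrt_map elim!: sorted_wrt_mono_rel[rotated])
    moreover have "intervals_in v w zs" using xs assms unfolding zs_def intervals_in_def
      by (auto simp: sorted_wrt_map elim!: sorted_wrt_mono_rel[rotated])
    moreover have le: "increments G xs \<le> increments G ys + increments G zs"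
    proof -
      have "\<forall>(a, b) \<in> set xs. a \<le> b" using xs by (auto simp: intervals_in_def)
      then show ?thesis unfolding ys_def zs_def
        by (induction xs) (auto simp: min_def max_def)
    qed
    ultimately have "ennreal (increments G ys) + ennreal (increments G zs)
        \<le> variation G u v + variation G v w"
      by (intro add_mono variation_upper)
    then show "ennreal (increments G xs) \<le> variation G u v + variation G v w"
      using ennreal_leI[OF le] by (simp add: ennreal_plus)
  qed
  show "variation G u v + variation G v w \<le> variation G u w"
  proof -
    have sum: "ennreal (increments G xs) + ennreal (increments G ys) \<le> variation G u w"
      if "intervals_in u v xs" "intervals_in v w ys" for xs ys
      using variation_upper[OF intervals_in_append[OF that assms], of G]
      by (simp flip: ennreal_plus)
    have right: "ennreal (increments G xs) + variation G v w \<le> variation G u w"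
      if "intervals_in u v xs" for xs
    proof -
      have ne: "{xs. intervals_in v w xs} \<noteq> {}" by (auto intro: exI[of _ "[]"])
      show ?thesis
        unfolding variation_def[of G v w] ennreal_SUP_add_right[OF ne]
        by (rule SUP_least) (use that sum in blast)
    qed
    have ne: "{xs. intervals_in u v xs} \<noteq> {}" by (auto intro: exI[of _ "[]"])
    show ?thesis
      unfolding variation_def[of G u v] ennreal_SUP_add_left[OF ne, symmetric]
      by (rule SUP_least) (use right in blast)
  qed
qed

text \<open>Intervals shorter than the modulus of absolute continuity for \<open>1\<close> have variation at most \<open>1\<close>, and
  finitely many of them cover a bounded interval.\<close>

lemma variation_finite:
  assumes "abs_continuous G" "u \<le> v"
  shows "variation G u v < \<infinity>"
proof -
  obtain \<eta> where \<eta>: "0 < \<eta>"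
    "\<And>u v xs. intervals_in u v xs \<Longrightarrow> total_length xs < \<eta> \<Longrightarrow> increments G xs < 1"
    using abs_continuous_lists[OF assms(1), of 1] by auto
  have short: "variation G a b \<le> 1" if "a \<le> b" "b - a < \<eta>" for a b
    unfolding variation_def
  proof (rule SUP_least, clarify)
    fix xs assume xs: "intervals_in a b xs"
    then have "increments G xs < 1" using \<eta>(2)[OF xs] total_length_le[OF xs] that by linarith
    then show "ennreal (increments G xs) \<le> 1" by (simp add: ennreal_le_1)
  qed
  have "variation G u (u + real n * (\<eta> / 2)) < \<infinity>" for n
  proof (induction n)
    case 0
    then show ?case using short[of u u] \<eta>(1) by (auto intro: order.strict_trans1)
  next
    case (Suc n)
    let ?m = "u + real n * (\<eta> / 2)" and ?m' = "u + real (Suc n) * (\<eta> / 2)"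
    have "variation G u ?m' = variation G u ?m + variation G ?m ?m'"
      using \<eta>(1) by (intro variation_add) (auto simp: algebra_simps)
    moreover have "variation G ?m ?m' \<le> 1"
      using \<eta>(1) by (intro short) (auto simp: algebra_simps)
    then have "variation G ?m ?m' < \<infinity>" by (auto intro: order.strict_trans1)
    ultimately show ?case using Suc by simp
  qed
  moreover obtain n where "(v - u) / (\<eta> / 2) < real n" using reals_Archimedean2 by blast
  then have n: "v \<le> u + real n * (\<eta> / 2)" using \<eta>(1) by (simp add: field_simps)
  moreover have "variation G u (u + real n * (\<eta> / 2))
      = variation G u v + variation G v (u + real n * (\<eta> / 2))"
    using assms(2) n by (rule variation_add)
  ultimately show ?thesis by (metis ennreal_add_less_top infinity_ennreal_def)
qed

text \<open>Replaces every interval of a list by a nearly optimal list for its variation, without increasing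
  the total length; the smallness of increments on short lists then passes to the variation.\<close>

lemma near_optimal_refinement:
  assumes "abs_continuous G" "0 < e" "intervals_in u v xs"
  obtains ys where "intervals_in u v ys" "total_length ys \<le> total_length xs"
    "(\<Sum>(a, b)\<leftarrow>xs. enn2real (variation G a b)) \<le> increments G ys + real (length xs) * e"
proof -
  have "\<exists>ys. intervals_in u v ys \<and> total_length ys \<le> total_length xs \<and>
    (\<Sum>(a, b)\<leftarrow>xs. enn2real (variation G a b)) \<le> increments G ys + real (length xs) * e"
    using assms(3)
  proof (induction xs arbitrary: u)
    case Nil
    then show ?case by (intro exI[of _ "[]"]) auto
  next
    case (Cons x xs)
    obtain a b where x: "x = (a, b)" by fastforce
    have ab: "u \<le> a" "a \<le> b" "b \<le> v" "intervals_in b v xs"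
      using Cons.prems by (auto simp: x intervals_in_Cons)
    obtain ys where ys: "intervals_in b v ys" "total_length ys \<le> total_length xs"
      "(\<Sum>(a, b)\<leftarrow>xs. enn2real (variation G a b)) \<le> increments G ys + real (length xs) * e"
      using Cons.IH[OF ab(4)] by blast
    obtain zs where zs: "intervals_in a b zs" "enn2real (variation G a b) \<le> increments G zs + e"
    proof (cases "enn2real (variation G a b) \<le> e")
      case True
      then show ?thesis using that[of "[]"] by simp
    next
      case False
      have "ennreal (enn2real (variation G a b) - e) < ennreal (enn2real (variation G a b))"
        using False assms(2) by (intro ennreal_lessI) auto
      also have "\<dots> = variation G a b"
        using variation_finite[OF assms(1) ab(2)] by simp
      finally obtain zs where "intervals_in a b zs"
        "ennreal (enn2real (variation G a b) - e) < ennreal (increments G zs)"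
        unfolding variation_def[of G a b] less_SUP_iff by blast
      then show ?thesis using that[of zs] False by (simp add: ennreal_less_iff)
    qed
    have "intervals_in u v (zs @ ys)"
    proof (rule intervals_in_append[OF _ ys(1)])
      show "intervals_in u b zs" using zs(1) ab by (fastforce simp: intervals_in_def)
    qed (use ab in auto)
    then show ?case
      using zs ys total_length_le[OF zs(1)] ab
      by (intro exI[of _ "zs @ ys"]) (auto simp: x algebra_simps)
  qed
  then show thesis using that by blast
qed

lemma variation_small:
  assumes "abs_continuous G" "0 < \<epsilon>"
  obtains \<eta> where "0 < \<eta>" "\<And>u v xs. intervals_in u v xs \<Longrightarrow> total_length xs < \<eta> \<Longrightarrow>
    (\<Sum>(a, b)\<leftarrow>xs. enn2real (variation G a b)) \<le> \<epsilon>"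
proof -
  obtain \<eta> where \<eta>: "0 < \<eta>"
    "\<And>u v xs. intervals_in u v xs \<Longrightarrow> total_length xs < \<eta> \<Longrightarrow> increments G xs < \<epsilon> / 2"
    using abs_continuous_lists[OF assms(1), of "\<epsilon> / 2"] assms(2) by auto
  show thesis
  proof (rule that[OF \<eta>(1)])
    fix u v xs assume xs: "intervals_in u v xs" "total_length xs < \<eta>"
    define e where "e = \<epsilon> / (2 * (real (length xs) + 1))"
    have e: "0 < e" "real (length xs) * e \<le> \<epsilon> / 2" using assms(2) by (auto simp: e_def field_simps)
    obtain ys where "intervals_in u v ys" "total_length ys \<le> total_length xs"
      "(\<Sum>(a, b)\<leftarrow>xs. enn2real (variation G a b)) \<le> increments G ys + real (length xs) * e"
      using near_optimal_refinement[OF assms(1) e(1) xs(1)] by blast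
    then show "(\<Sum>(a, b)\<leftarrow>xs. enn2real (variation G a b)) \<le> \<epsilon>"
      using \<eta>(2)[of u v ys] xs e(2) by linarith
  qed
qed

text \<open>Grid points. Compact sets inside an open set are covered by grid intervals inside it, and these are
  disjoint and sorted by their index.\<close>

definition dyadic :: "nat \<Rightarrow> int \<Rightarrow> real" where
  "dyadic n k = real_of_int k / 2 ^ n"

lemma dyadic_mono: "k \<le> l \<Longrightarrow> dyadic n k \<le> dyadic n l"
  by (simp add: dyadic_def divide_right_mono)

lemma dyadic_cover:
  assumes "compact K" "open T" "K \<subseteq> T"
  obtains n S where "finite S" "K \<subseteq> (\<Union>k\<in>S. {dyadic n k<..dyadic n (k + 1)})"
    "(\<Union>k\<in>S. {dyadic n k<..dyadic n (k + 1)}) \<subseteq> T"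
proof (cases "K = {}")
  case True
  then show thesis using that[of "{}"] by simp
next
  case False
  obtain e where e: "0 < e" "(\<Union>x\<in>K. ball x e) \<subseteq> T"
    using compact_subset_open_imp_ball_epsilon_subset[OF assms] by blast
  obtain n where "1 / e < real n" using reals_Archimedean2 by blast
  also have "real n \<le> 2 ^ n" using of_nat_less_two_power[of n, where ?'a = real] by linarith
  finally have n: "1 / 2 ^ n < e" using e(1) by (simp add: field_simps)
  define idx where "idx x = \<lceil>x * 2 ^ n\<rceil> - 1" for x :: real
  have mem: "dyadic n (idx x) < x" "x \<le> dyadic n (idx x + 1)" for x
    unfolding dyadic_def idx_def by (auto simp: field_simps) linarith+
  have len: "dyadic n (k + 1) = dyadic n k + 1 / 2 ^ n" for k
    by (simp add: dyadic_def add_divide_distrib)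
  obtain B where B: "\<And>x. x \<in> K \<Longrightarrow> \<bar>x\<bar> \<le> B"
    using compact_imp_bounded[OF assms(1)] by (auto simp: bounded_iff)
  have "idx ` K \<subseteq> {\<lceil>- B * 2 ^ n\<rceil> - 1 .. \<lceil>B * 2 ^ n\<rceil> - 1}"
  proof (rule image_subsetI)
    fix x assume "x \<in> K"
    then have x: "- B \<le> x" "x \<le> B" using B[of x] by auto
    have "(- B) * 2 ^ n \<le> x * 2 ^ n" "x * 2 ^ n \<le> B * 2 ^ n"
      using x by (simp_all only: mult_right_mono zero_le_power zero_le_numeral)
    then show "idx x \<in> {\<lceil>- B * 2 ^ n\<rceil> - 1 .. \<lceil>B * 2 ^ n\<rceil> - 1}"
      using ceiling_mono[of "- (B * 2 ^ n)" "x * 2 ^ n"] ceiling_mono[of "x * 2 ^ n" "B * 2 ^ n"]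
      by (simp add: idx_def)
  qed
  then have "finite (idx ` K)" using finite_subset by blast
  moreover have "K \<subseteq> (\<Union>k\<in>idx ` K. {dyadic n k<..dyadic n (k + 1)})"
    using mem by auto
  moreover have "{dyadic n (idx x)<..dyadic n (idx x + 1)} \<subseteq> ball x e" for x
    using mem[of x] n unfolding len by (auto simp: dist_real_def)
  then have "(\<Union>k\<in>idx ` K. {dyadic n k<..dyadic n (k + 1)}) \<subseteq> T" using e(2) by blast
  ultimately show thesis using that by blast
qed

lemma dyadic_intervals:
  assumes "finite S"
  obtains xs u v where "intervals_in u v xs"
    "\<And>\<phi> :: real \<Rightarrow> real \<Rightarrow> real. (\<Sum>(a, b)\<leftarrow>xs. \<phi> a b) = (\<Sum>k\<in>S. \<phi> (dyadic n k) (dyadic n (k + 1)))"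
proof -
  define ks where "ks = sorted_list_of_set S"
  have ks: "sorted_wrt (<) ks" "set ks = S" "distinct ks"
    using assms by (auto simp: ks_def)
  define xs where "xs = map (\<lambda>k. (dyadic n k, dyadic n (k + 1))) ks"
  have "sorted_wrt (\<lambda>(a, b) (c, d). b \<le> c) xs"
    unfolding xs_def sorted_wrt_map using ks(1)
    by (rule sorted_wrt_mono_rel[rotated]) (auto intro!: dyadic_mono)
  moreover obtain m M where "\<And>k. k \<in> S \<Longrightarrow> m \<le> k \<and> k \<le> M"
    using assms by (meson Max_ge Min_le)
  ultimately have "intervals_in (dyadic n m) (dyadic n (M + 1)) xs"
    unfolding intervals_in_def using ks(2) by (auto simp: xs_def intro!: dyadic_mono)
  moreover have "(\<Sum>(a, b)\<leftarrow>xs. \<phi> a b) = (\<Sum>k\<in>S. \<phi> (dyadic n k) (dyadic n (k + 1)))"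
    for \<phi> :: "real \<Rightarrow> real \<Rightarrow> real"
    using ks by (simp add: xs_def o_def sum_list_distinct_conv_sum_set)
  ultimately show thesis using that by blast
qed

text \<open>The Lebesgue-Stieltjes measure of \<open>F\<close> is absolutely continuous with respect to Lebesgue measure: a
  null set lies in an open set of small Lebesgue measure, every compact part of which is covered by a
  list of grid intervals of small total length, where \<open>F\<close> increases little. The density is then given
  by the Radon-Nikodym theorem.\<close>

lemma monotone_density:
  fixes F :: "real \<Rightarrow> real"
  assumes "mono F" and cont: "\<And>x. isCont F x"
    and bdd: "\<And>x. \<bar>F x\<bar> \<le> B"
    and small: "\<And>\<epsilon>. 0 < \<epsilon> \<Longrightarrow> \<exists>\<eta>>0. \<forall>u v xs. intervals_in u v xs \<longrightarrow> total_length xs < \<eta> \<longrightarrow>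
      (\<Sum>(a, b)\<leftarrow>xs. F b - F a) \<le> \<epsilon>"
  obtains h :: "real \<Rightarrow> real" where "integrable lborel h"
    "\<And>x y. x \<le> y \<Longrightarrow> F y - F x = (LINT t:{x..y}|lborel. h t)"
proof -
  define \<mu> where "\<mu> = interval_measure F"
  have [measurable_cong]: "sets \<mu> = sets borel" by (simp add: \<mu>_def)
  have Ioc: "emeasure \<mu> {x<..y} = ennreal (F y - F x)" if "x \<le> y" for x y
    unfolding \<mu>_def using assms(1) that cont
    by (intro emeasure_interval_measure_Ioc) (auto simp: mono_def continuous_at_imp_continuous_within)
  have Bound: "emeasure \<mu> UNIV \<le> ennreal (2 * B)"
  proof -
    have "emeasure \<mu> (\<Union>n. {- real n<..real n}) = (SUP n. emeasure \<mu> {- real n<..real n})"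
      by (intro SUP_emeasure_incseq[symmetric]) (auto simp: incseq_def)
    also have "\<dots> \<le> ennreal (2 * B)"
    proof (rule SUP_least)
      fix n
      have "F (real n) - F (- real n) \<le> 2 * B"
        using bdd[of "real n"] bdd[of "- real n"] by linarith
      then show "emeasure \<mu> {- real n<..real n} \<le> ennreal (2 * B)"
        by (simp add: Ioc ennreal_leI)
    qed
    also have "(\<Union>n. {- real n<..real n}) = UNIV"
    proof (intro set_eqI iffI UNIV_I)
      fix x :: real
      obtain n where "\<bar>x\<bar> < real n" using reals_Archimedean2 by blast
      then show "x \<in> (\<Union>n. {- real n<..real n})" by (intro UN_I[of n]) auto
    qed
    finally show ?thesis .
  qed
  have space: "space \<mu> = UNIV" by (simp add: \<mu>_def)
  have fin: "emeasure \<mu> (space \<mu>) \<noteq> \<infinity>" using Bound by (auto simp: space top_unique)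
  have ac: "absolutely_continuous lborel \<mu>"
    unfolding absolutely_continuous_def
  proof (rule subsetI)
    fix N assume N: "N \<in> null_sets (lborel :: real measure)"
    have "emeasure \<mu> N \<le> 0 + ennreal \<epsilon>" if \<epsilon>: "0 < \<epsilon>" for \<epsilon>
    proof -
      obtain \<eta> where \<eta>: "0 < \<eta>" "\<And>u v xs. intervals_in u v xs \<Longrightarrow> total_length xs < \<eta> \<Longrightarrow>
          (\<Sum>(a, b)\<leftarrow>xs. F b - F a) \<le> \<epsilon>" using small[OF \<epsilon>] by blast
      have N': "N \<in> null_sets lebesgue" using N by (simp add: null_sets_completionI)
      then obtain T where T: "open T" "N \<subseteq> T" "emeasure lebesgue (T - N) < ennreal \<eta>"
        using sets_lebesgue_outer_open[of N \<eta>] \<eta>(1) by (metis null_setsD2)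
      have "emeasure lebesgue T = emeasure lebesgue (T - N)"
        using N' T(1) by (intro emeasure_Diff_null_set[symmetric]) auto
      then have T\<eta>: "emeasure lborel T < ennreal \<eta>" using T by simp
      have "emeasure \<mu> K \<le> ennreal \<epsilon>" if K: "K \<subseteq> T" "compact K" for K
      proof -
        obtain n S where S: "finite S" "K \<subseteq> (\<Union>k\<in>S. {dyadic n k<..dyadic n (k + 1)})"
          "(\<Union>k\<in>S. {dyadic n k<..dyadic n (k + 1)}) \<subseteq> T"
          by (rule dyadic_cover[OF K(2) T(1) K(1)]) (rule that)
        obtain xs u v where xs: "intervals_in u v xs"
          "\<And>\<phi> :: real \<Rightarrow> real \<Rightarrow> real. (\<Sum>(a, b)\<leftarrow>xs. \<phi> a b)
             = (\<Sum>k\<in>S. \<phi> (dyadic n k) (dyadic n (k + 1)))"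
          using dyadic_intervals[OF S(1), of n] by metis
        have disj: "disjoint_family_on (\<lambda>k. {dyadic n k<..dyadic n (k + 1)}) S"
          unfolding disjoint_family_on_def
        proof (intro ballI impI)
          fix k l :: int assume "k \<noteq> l"
          then have "k + 1 \<le> l \<or> l + 1 \<le> k" by linarith
          then show "{dyadic n k<..dyadic n (k + 1)} \<inter> {dyadic n l<..dyadic n (l + 1)} = {}"
            using dyadic_mono[of "k + 1" l n] dyadic_mono[of "l + 1" k n] by auto
        qed
        have "ennreal (total_length xs) = (\<Sum>k\<in>S. emeasure lborel {dyadic n k<..dyadic n (k + 1)})"
          unfolding total_length_def xs(2)
          by (subst sum_ennreal[symmetric]) (auto simp: dyadic_mono)
        also have "\<dots> = emeasure lborel (\<Union>k\<in>S. {dyadic n k<..dyadic n (k + 1)})"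
          using S(1) disj by (intro sum_emeasure) auto
        also have "\<dots> \<le> emeasure lborel T" using S(3) T(1) by (intro emeasure_mono) auto
        also note T\<eta>
        finally have "total_length xs < \<eta>"
          using ennreal_leI[of \<eta> "total_length xs"] by (auto simp: not_le[symmetric])
        then have le: "(\<Sum>(a, b)\<leftarrow>xs. F b - F a) \<le> \<epsilon>" using \<eta>(2)[OF xs(1)] by blast
        have "emeasure \<mu> K \<le> emeasure \<mu> (\<Union>k\<in>S. {dyadic n k<..dyadic n (k + 1)})"
          using S(1,2) by (intro emeasure_mono) auto
        also have "\<dots> \<le> (\<Sum>k\<in>S. emeasure \<mu> {dyadic n k<..dyadic n (k + 1)})"
          using S(1) by (intro emeasure_subadditive_finite) auto
        also have "\<dots> = ennreal (\<Sum>(a, b)\<leftarrow>xs. F b - F a)"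
          unfolding xs(2) using assms(1)
          by (subst sum_ennreal[symmetric]) (auto simp: Ioc dyadic_mono mono_def)
        also have "\<dots> \<le> ennreal \<epsilon>" using le by (rule ennreal_leI)
        finally show ?thesis .
      qed
      then have "emeasure \<mu> T \<le> ennreal \<epsilon>"
        using T(1) fin by (subst inner_regular) (auto intro!: SUP_least simp: \<mu>_def)
      moreover have "emeasure \<mu> N \<le> emeasure \<mu> T"
        using T by (intro emeasure_mono) auto
      ultimately show ?thesis by simp
    qed
    then have "emeasure \<mu> N \<le> 0" by (rule ennreal_le_epsilon)
    moreover have "N \<in> sets \<mu>" using null_setsD2[OF N] by (simp add: \<mu>_def)
    ultimately show "N \<in> null_sets \<mu>" by (intro null_setsI) auto
  qed
  obtain h where h [measurable]: "h \<in> borel_measurable lborel" "density lborel h = \<mu>"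
    using sigma_finite_measure.Radon_Nikodym[OF sigma_finite_lborel ac] by (auto simp: \<mu>_def)
  have hfin: "(\<integral>\<^sup>+t. h t \<partial>lborel) < \<infinity>"
  proof -
    have "(\<integral>\<^sup>+t. h t \<partial>lborel) = emeasure \<mu> UNIV"
      unfolding h(2)[symmetric] by (subst emeasure_density) auto
    also have "\<dots> \<le> ennreal (2 * B)" by (rule Bound)
    finally show ?thesis by (simp add: order.strict_trans1)
  qed
  then have AEfin: "AE t in lborel. h t \<noteq> \<infinity>"
    by (intro nn_integral_PInf_AE) auto
  then have AEeq: "AE t in lborel. ennreal (enn2real (h t)) = h t"
    by eventually_elim (auto simp: less_top)
  have int: "integrable lborel (\<lambda>t. enn2real (h t))"
  proof (rule integrableI_nonneg)
    have "(\<integral>\<^sup>+t. ennreal (enn2real (h t)) \<partial>lborel) = (\<integral>\<^sup>+t. h t \<partial>lborel)"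
      using AEeq by (rule nn_integral_cong_AE)
    then show "(\<integral>\<^sup>+t. ennreal (enn2real (h t)) \<partial>lborel) < \<infinity>" using hfin by simp
  qed auto
  show thesis
  proof (rule that[OF int])
    fix x y :: real assume xy: "x \<le> y"
    have "ennreal (LINT t:{x..y}|lborel. enn2real (h t))
        = (\<integral>\<^sup>+t. ennreal (indicator {x..y} t * enn2real (h t)) \<partial>lborel)"
      unfolding set_lebesgue_integral_def using int
      by (subst nn_integral_eq_integral) (auto intro!: integrable_real_mult_indicator simp: mult.commute)
    also have "\<dots> = (\<integral>\<^sup>+t\<in>{x<..y}. h t \<partial>lborel)"
    proof (rule nn_integral_cong_AE)
      show "AE t in lborel. ennreal (indicator {x..y} t * enn2real (h t)) = h t * indicator {x<..y} t"
        using AEeq AE_lborel_singleton[of x]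
        by eventually_elim (auto simp: indicator_def)
    qed
    also have "\<dots> = emeasure \<mu> {x<..y}"
      unfolding h(2)[symmetric] by (subst emeasure_density) auto
    also have "\<dots> = ennreal (F y - F x)" using xy by (rule Ioc)
    finally show "F y - F x = (LINT t:{x..y}|lborel. enn2real (h t))"
      using xy assms(1)
      by (subst (asm) ennreal_inj) (auto simp: set_lebesgue_integral_def mono_def intro!: integral_nonneg_AE)
  qed
qed


lemma abs_continuous_isCont:
  assumes "abs_continuous G"
  shows "isCont G x"
  unfolding continuous_at_eps_delta
proof (intro allI impI)
  fix e :: real assume "0 < e"
  then obtain d where d: "0 < d"
    "\<And>u v xs. intervals_in u v xs \<Longrightarrow> total_length xs < d \<Longrightarrow> increments G xs < e"
    using abs_continuous_lists[OF assms] by blast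
  show "\<exists>d>0. \<forall>x'. dist x' x < d \<longrightarrow> dist (G x') (G x) < e"
  proof (intro exI[of _ d] conjI d(1) allI impI)
    fix y assume "dist y x < d"
    then show "dist (G y) (G x) < e"
      using d(2)[of "min x y" "max x y" "[(min x y, max x y)]"]
      by (cases "x \<le> y") (auto simp: intervals_in_Cons dist_real_def abs_minus_commute)
  qed
qed

text \<open>Jordan decomposition: on \<open>[a, b]\<close> the variation \<open>V\<close> and \<open>V - G\<close> are increasing, and they inherit the
  smallness on short lists from \<open>G\<close>. Both are extended by constants outside \<open>[a, b]\<close>.\<close>

lemma abs_continuous_density:
  assumes G: "abs_continuous G" and ab: "a \<le> b"
  obtains h where "integrable lborel h"
    "\<And>x y. a \<le> x \<Longrightarrow> x \<le> y \<Longrightarrow> y \<le> b \<Longrightarrow> G y - G x = (LINT t:{x..y}|lborel. h t)"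
proof -
  \<comment> \<open>The projection onto \<open>[a, b]\<close>; composing with it extends functions by constants.\<close>
  define c where "c x = max a (min b x)" for x
  have c: "a \<le> c x" "c x \<le> b" for x using ab by (auto simp: c_def)
  have c_mono: "c x \<le> c y" if "x \<le> y" for x y using that by (auto simp: c_def)
  have c_short: "c y - c x \<le> y - x" if "x \<le> y" for x y using that ab by (auto simp: c_def)
  define V where "V x = enn2real (variation G a (c x))" for x
  define F where "F x = V x - G (c x)" for x
  have V_diff: "V y - V x = enn2real (variation G (c x) (c y))" if "x \<le> y" for x y
  proof -
    have "variation G a (c y) = variation G a (c x) + variation G (c x) (c y)"
      by (rule variation_add[OF c(1) c_mono[OF that]])
    then show ?thesis
      using variation_finite[OF G c(1), of x] variation_finite[OF G c_mono[OF that]]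
      unfolding V_def by (simp add: enn2real_plus)
  qed
  have inc: "\<bar>G (c y) - G (c x)\<bar> \<le> V y - V x" if "x \<le> y" for x y
    using increment_le_variation[OF c_mono[OF that], of G]
      variation_finite[OF G c_mono[OF that]] unfolding V_diff[OF that]
    by (metis enn2real_ennreal enn2real_mono abs_ge_zero infinity_ennreal_def)
  have V_mono: "V x \<le> V y" if "x \<le> y" for x y using inc[OF that] by linarith
  have V_small: "\<exists>\<eta>>0. \<forall>u v xs. intervals_in u v xs \<longrightarrow> total_length xs < \<eta> \<longrightarrow>
      (\<Sum>(a, b)\<leftarrow>xs. V b - V a) \<le> \<epsilon>" if \<epsilon>: "0 < \<epsilon>" for \<epsilon>
  proof -
    obtain \<eta> where \<eta>: "0 < \<eta>" "\<And>u v xs. intervals_in u v xs \<Longrightarrow> total_length xs < \<eta> \<Longrightarrow>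
        (\<Sum>(a, b)\<leftarrow>xs. enn2real (variation G a b)) \<le> \<epsilon>"
      using variation_small[OF G \<epsilon>] by blast
    show ?thesis
    proof (intro exI[of _ \<eta>] conjI \<eta>(1) allI impI)
      fix u v xs assume xs: "intervals_in u v xs" "total_length xs < \<eta>"
      define ys where "ys = map (\<lambda>(a, b). (c a, c b)) xs"
      have ys: "intervals_in a b ys" using xs(1) c c_mono unfolding ys_def intervals_in_def
        by (auto simp: sorted_wrt_map elim!: sorted_wrt_mono_rel[rotated])
      have le: "\<forall>(a, b)\<in>set xs. a \<le> b" using xs(1) by (auto simp: intervals_in_def)
      then have "total_length ys \<le> total_length xs
        \<and> (\<Sum>(a, b)\<leftarrow>xs. V b - V a) = (\<Sum>(a, b)\<leftarrow>ys. enn2real (variation G a b))"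
        unfolding ys_def by (induction xs) (auto simp: V_diff add_mono c_short)
      then show "(\<Sum>(a, b)\<leftarrow>xs. V b - V a) \<le> \<epsilon>" using \<eta>(2)[OF ys] xs(2) by auto
    qed
  qed
  have F_diff: "0 \<le> F y - F x" "F y - F x \<le> 2 * (V y - V x)" if "x \<le> y" for x y
    using inc[OF that] unfolding F_def abs_le_iff by (auto simp: algebra_simps)
  have F_small: "\<exists>\<eta>>0. \<forall>u v xs. intervals_in u v xs \<longrightarrow> total_length xs < \<eta> \<longrightarrow>
      (\<Sum>(a, b)\<leftarrow>xs. F b - F a) \<le> \<epsilon>" if \<epsilon>: "0 < \<epsilon>" for \<epsilon>
  proof -
    obtain \<eta> where \<eta>: "0 < \<eta>" "\<And>u v xs. intervals_in u v xs \<Longrightarrow> total_length xs < \<eta> \<Longrightarrow>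
        (\<Sum>(a, b)\<leftarrow>xs. V b - V a) \<le> \<epsilon> / 2" using V_small[of "\<epsilon> / 2"] \<epsilon> by auto
    show ?thesis
    proof (intro exI[of _ \<eta>] conjI \<eta>(1) allI impI)
      fix u v xs assume xs: "intervals_in u v xs" "total_length xs < \<eta>"
      have "\<forall>(a, b)\<in>set xs. a \<le> b" using xs(1) by (auto simp: intervals_in_def)
      then have "(\<Sum>(a, b)\<leftarrow>xs. F b - F a) \<le> 2 * (\<Sum>(a, b)\<leftarrow>xs. V b - V a)"
        by (induction xs) (use F_diff in \<open>auto simp: algebra_simps intro!: add_mono\<close>)
      then show "(\<Sum>(a, b)\<leftarrow>xs. F b - F a) \<le> \<epsilon>" using \<eta>(2)[OF xs] by linarith
    qed
  qed
  have cont: "isCont W x"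
    if small: "\<And>\<epsilon>. 0 < \<epsilon> \<Longrightarrow> \<exists>\<eta>>0. \<forall>u v xs. intervals_in u v xs \<longrightarrow> total_length xs < \<eta> \<longrightarrow>
      (\<Sum>(a, b)\<leftarrow>xs. W b - W a) \<le> \<epsilon>" and mono: "\<And>x y. x \<le> y \<Longrightarrow> W x \<le> W y"
    for W :: "real \<Rightarrow> real" and x
    unfolding continuous_at_eps_delta
  proof (intro allI impI)
    fix e :: real assume "0 < e"
    then obtain d where d: "0 < d" "\<And>u v xs. intervals_in u v xs \<Longrightarrow> total_length xs < d \<Longrightarrow>
      (\<Sum>(a, b)\<leftarrow>xs. W b - W a) \<le> e / 2" using small[of "e / 2"] by auto
    show "\<exists>d>0. \<forall>x'. dist x' x < d \<longrightarrow> dist (W x') (W x) < e"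
    proof (intro exI[of _ d] conjI d(1) allI impI)
      fix y assume y: "dist y x < d"
      have "W (max x y) - W (min x y) \<le> e / 2"
        using d(2)[of "min x y" "max x y" "[(min x y, max x y)]"] y
        by (cases "x \<le> y") (auto simp: intervals_in_Cons dist_real_def)
      then show "dist (W y) (W x) < e" using \<open>0 < e\<close> mono[of x y] mono[of y x]
        by (cases "x \<le> y") (auto simp: dist_real_def)
    qed
  qed
  have const: "c x = c a" if "x \<le> a" for x using that ab by (auto simp: c_def)
  have const': "c x = c b" if "b \<le> x" for x using that ab by (auto simp: c_def)
  have bdd: "\<bar>W x\<bar> \<le> \<bar>W a\<bar> + \<bar>W b\<bar>"
    if mono: "\<And>x y. x \<le> y \<Longrightarrow> W x \<le> W y" and "\<And>x y. c x = c y \<Longrightarrow> W x = W y"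
    for W :: "real \<Rightarrow> real" and x
  proof -
    have "W a \<le> W x" using mono[of a x] that(2)[OF const, of x] by (cases "a \<le> x") auto
    moreover have "W x \<le> W b" using mono[of x b] that(2)[OF const', of x] by (cases "x \<le> b") auto
    ultimately show ?thesis by linarith
  qed
  have V_c: "V x = V y" and F_c: "F x = F y" if "c x = c y" for x y
    using that by (auto simp: V_def F_def)
  have F_mono: "F x \<le> F y" if "x \<le> y" for x y using F_diff(1)[OF that] by simp
  obtain h1 where h1: "integrable lborel h1"
    "\<And>x y. x \<le> y \<Longrightarrow> V y - V x = (LINT t:{x..y}|lborel. h1 t)"
    using monotone_density[of V "\<bar>V a\<bar> + \<bar>V b\<bar>"] V_mono cont[of V, OF V_small V_mono] V_small
      bdd[of V, OF V_mono V_c] by (metis monoI)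
  obtain h2 where h2: "integrable lborel h2"
    "\<And>x y. x \<le> y \<Longrightarrow> F y - F x = (LINT t:{x..y}|lborel. h2 t)"
    using monotone_density[of F "\<bar>F a\<bar> + \<bar>F b\<bar>"] F_mono cont[of F, OF F_small F_mono] F_small
      bdd[of F, OF F_mono F_c] by (metis monoI)
  show thesis
  proof (rule that[of "\<lambda>t. h1 t - h2 t"])
    fix x y assume xy: "a \<le> x" "x \<le> y" "y \<le> b"
    have si: "set_integrable lborel {x..y} h1" "set_integrable lborel {x..y} h2"
      unfolding set_integrable_def using h1(1) h2(1)
      by (simp_all only: integrable_mult_indicator sets_lborel atLeastAtMost_borel)
    have "c x = x" "c y = y" using xy by (auto simp: c_def)
    then have "G y - G x = (V y - V x) - (F y - F x)" by (simp add: F_def)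
    also have "\<dots> = (LINT t:{x..y}|lborel. h1 t - h2 t)"
      using h1(2) h2(2) xy si by (simp add: set_integral_diff)
    finally show "G y - G x = (LINT t:{x..y}|lborel. h1 t - h2 t)" .
  qed (use h1 h2 in auto)
qed

lemma right_averages_converge:
  fixes h :: "real \<Rightarrow> real"
  assumes "integrable lborel h"
  shows "AE x in lebesgue. \<forall>e>0. \<exists>d>0. \<forall>t. 0 < t \<and> t < d \<longrightarrow>
    \<bar>(LINT s:{x..x+t}|lborel. h s) / t - h x\<bar> < e"
proof -
  have si: "set_integrable lborel A h" if "A \<in> sets borel" for A
    unfolding set_integrable_def using assms that by (intro integrable_mult_indicator) auto
  obtain N where N: "negligible N"
    "\<And>x e. x \<notin> N \<Longrightarrow> 0 < e \<Longrightarrow> \<exists>d>0. \<forall>t. 0 < t \<and> t < d \<longrightarrow>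
      norm (integral (cbox x (x + t *\<^sub>R One)) h /\<^sub>R t ^ DIM(real) - h x) < e"
    using integrable_ccontinuous_explicit[of h] set_borel_integral_eq_integral(1)[OF si]
    by (metis box_borel cbox_borel)
  have eq: "integral (cbox x (x + t *\<^sub>R One)) h /\<^sub>R t ^ DIM(real)
      = (LINT s:{x..x+t}|lborel. h s) / t" for x t :: real
    using set_borel_integral_eq_integral(2)[OF si, of "{x..x+t}"] by (simp add: divide_inverse_commute)
  note N2 = N(2)[unfolded eq real_norm_def]
  have "N \<in> null_sets lebesgue" using N(1) negligible_iff_null_sets by blast
  then show ?thesis
    by (rule AE_I') (use N2 in blast)
qed


text \<open>Right-hand averages converge almost everywhere; reflecting the line gives the left-hand
  ones.\<close>

lemma primitive_has_derivative_AE: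
  fixes G h :: "real \<Rightarrow> real"
  assumes h: "integrable lborel h"
    and G: "\<And>x y. a \<le> x \<Longrightarrow> x \<le> y \<Longrightarrow> y \<le> b \<Longrightarrow> G y - G x = (LINT t:{x..y}|lborel. h t)"
  shows "AE x in lebesgue. a < x \<and> x < b \<longrightarrow> (G has_real_derivative h x) (at x)"
proof -
  have refl: "integrable lborel (\<lambda>x. h (- x))"
    using lborel_integrable_real_affine[OF h, of "-1" 0] by simp
  have "AE x in lebesgue. \<forall>e>0. \<exists>d>0. \<forall>t. 0 < t \<and> t < d \<longrightarrow>
      \<bar>(LINT s:{x..x+t}|lborel. h (- s)) / t - h (- x)\<bar> < e" (is "AE x in _. ?P x")
    using right_averages_converge[OF refl] .
  then obtain N where N: "N \<in> null_sets lebesgue" "{x. \<not> ?P x} \<subseteq> N"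
    unfolding eventually_ae_filter by auto
  have "uminus ` N \<in> null_sets lebesgue"
    using N(1) negligible_differentiable_image_negligible[of N uminus]
    by (simp add: negligible_iff_null_sets)
  then have left: "AE x in lebesgue. ?P (- x)"
  proof (rule AE_I')
    show "{x \<in> space lebesgue. \<not> ?P (- x)} \<subseteq> uminus ` N"
    proof
      fix x assume "x \<in> {x \<in> space lebesgue. \<not> ?P (- x)}"
      then have "- x \<in> N" using N(2) by blast
      then show "x \<in> uminus ` N" by (rule image_eqI[rotated]) simp
    qed
  qed
  show ?thesis
    using left right_averages_converge[OF h]
  proof eventually_elim
    case (elim x)
    show ?case
    proof
      assume x: "a < x \<and> x < b"
      show "(G has_real_derivative h x) (at x)"
        unfolding DERIV_def LIM_eq
      proof (intro allI impI)
        fix e :: real assume "0 < e"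
        then obtain d1 d2 where d: "0 < d1" "0 < d2"
          "\<And>t. 0 < t \<Longrightarrow> t < d1 \<Longrightarrow> \<bar>(LINT s:{- x..- x+t}|lborel. h (- s)) / t - h x\<bar> < e"
          "\<And>t. 0 < t \<Longrightarrow> t < d2 \<Longrightarrow> \<bar>(LINT s:{x..x+t}|lborel. h s) / t - h x\<bar> < e"
          using elim by (metis minus_minus)
        have flip: "(LINT s:{- x..- x+t}|lborel. h (- s)) = (LINT s:{x-t..x}|lborel. h s)" for t
        proof -
          have "(LINT s:{x-t..x}|lborel. h s)
              = (LINT s|lborel. indicator {x-t..x} (- s) *\<^sub>R h (- s))"
            unfolding set_lebesgue_integral_def
            by (subst lborel_integral_real_affine[of "-1" _ 0]) auto
          also have "\<dots> = (LINT s:{- x..- x+t}|lborel. h (- s))"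
            unfolding set_lebesgue_integral_def
            by (intro Bochner_Integration.integral_cong) (auto simp: indicator_def)
          finally show ?thesis by simp
        qed
        show "\<exists>s>0. \<forall>t. t \<noteq> 0 \<and> norm (t - 0) < s \<longrightarrow> norm ((G (x + t) - G x) / t - h x) < e"
        proof (intro exI[of _ "min (min d1 d2) (min (x - a) (b - x))"] conjI allI impI)
          fix t :: real assume t: "t \<noteq> 0 \<and> norm (t - 0) < min (min d1 d2) (min (x - a) (b - x))"
          show "norm ((G (x + t) - G x) / t - h x) < e"
          proof (cases "0 < t")
            case True
            then have "G (x + t) - G x = (LINT s:{x..x+t}|lborel. h s)"
              using t x by (intro G) auto
            then show ?thesis using d(4)[of t] t True by simp
          next
            case False
            then have "G x - G (x + t) = (LINT s:{x+t..x}|lborel. h s)"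
              using t x by (intro G) auto
            then have "(G (x + t) - G x) / t = (LINT s:{- x..- x+(-t)}|lborel. h (- s)) / (- t)"
              unfolding flip by (simp add: field_simps)
            then show ?thesis using d(3)[of "- t"] t False by simp
          qed
        qed (use d x in auto)
      qed
    qed
  qed
qed

theorem abs_continuous_FTC:
  assumes G: "abs_continuous G"
  shows "AE x in lebesgue. (G has_real_derivative deriv G x) (at x)"
    and "x \<le> y \<Longrightarrow> set_integrable lebesgue {x..y} (deriv G)"
    and "x \<le> y \<Longrightarrow> G y - G x = (LINT t:{x..y}|lebesgue. deriv G t)"
proof -
  have ex: "\<exists>h. integrable lborel h \<and> (\<forall>x y. a \<le> x \<longrightarrow> x \<le> y \<longrightarrow> y \<le> b \<longrightarrow>
      G y - G x = (LINT t:{x..y}|lborel. h t)) \<and>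
      (AE x in lebesgue. a < x \<and> x < b \<longrightarrow> (G has_real_derivative h x) (at x))" if ab: "a \<le> b" for a b
  proof -
    obtain h where h: "integrable lborel h"
      "\<And>x y. a \<le> x \<Longrightarrow> x \<le> y \<Longrightarrow> y \<le> b \<Longrightarrow> G y - G x = (LINT t:{x..y}|lborel. h t)"
      using abs_continuous_density[OF G ab] by metis
    then show ?thesis using primitive_has_derivative_AE[OF h] by blast
  qed
  have "AE x in lebesgue. \<forall>n. - real n < x \<and> x < real n \<longrightarrow>
      (G has_real_derivative deriv G x) (at x)"
    unfolding AE_all_countable
  proof
    fix n
    obtain h where "AE x in lebesgue. - real n < x \<and> x < real n \<longrightarrow>
        (G has_real_derivative h x) (at x)" using ex[of "- real n" "real n"] by auto
    then show "AE x in lebesgue. - real n < x \<and> x < real n \<longrightarrow>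
      (G has_real_derivative deriv G x) (at x)"
      by eventually_elim (auto simp: DERIV_imp_deriv)
  qed
  then show deriv: "AE x in lebesgue. (G has_real_derivative deriv G x) (at x)"
  proof eventually_elim
    case (elim x)
    obtain n where "\<bar>x\<bar> < real n" using reals_Archimedean2 by blast
    then show ?case using elim by (auto simp: abs_less_iff)
  qed
  assume xy: "x \<le> y"
  obtain h where h: "integrable lborel h"
    "\<forall>x' y'. x \<le> x' \<longrightarrow> x' \<le> y' \<longrightarrow> y' \<le> y \<longrightarrow> G y' - G x' = (LINT t:{x'..y'}|lborel. h t)"
    "AE t in lebesgue. x < t \<and> t < y \<longrightarrow> (G has_real_derivative h t) (at t)"
    using ex[OF xy] by blast
  have hx: "integrable lborel (\<lambda>t. indicator {x..y} t *\<^sub>R h t)"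
    using h(1) by (intro integrable_mult_indicator) auto
  then have hl: "integrable lebesgue (\<lambda>t. indicator {x..y} t *\<^sub>R h t)"
    by (subst integrable_completion) auto
  have ne: "AE t in lebesgue. t \<noteq> x \<and> t \<noteq> y"
    using AE_completion[OF AE_lborel_singleton[of x]] AE_completion[OF AE_lborel_singleton[of y]]
    by eventually_elim auto
  have eq: "AE t in lebesgue. indicator {x..y} t *\<^sub>R h t = indicator {x..y} t *\<^sub>R deriv G t"
    using h(3) ne by eventually_elim (auto simp: indicator_def dest: DERIV_imp_deriv)
  have meas: "(\<lambda>t. indicator {x..y} t *\<^sub>R deriv G t) \<in> borel_measurable lebesgue"
    using borel_measurable_integrable[OF hl] eq by (rule borel_measurable_AE)
  show "set_integrable lebesgue {x..y} (deriv G)"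
    unfolding set_integrable_def
    using integrable_cong_AE[OF _ meas eq] hl by auto
  have "G y - G x = (LINT t:{x..y}|lborel. h t)" using h(2) xy by auto
  also have "\<dots> = (LINT t|lebesgue. indicator {x..y} t *\<^sub>R h t)"
    unfolding set_lebesgue_integral_def using hx by (subst integral_completion) auto
  also have "\<dots> = (LINT t|lebesgue. indicator {x..y} t *\<^sub>R deriv G t)"
    using hl meas eq by (intro integral_cong_AE) auto
  finally show "G y - G x = (LINT t:{x..y}|lebesgue. deriv G t)"
    unfolding set_lebesgue_integral_def .
qed

section \<open>The modular and the norm\<close>

text \<open>The convexity of the power function is extended from the positive reals to \<open>0\<close>.\<close>

lemma powr_convex_combination:
  fixes a b s q :: real
  assumes "0 \<le> a" "0 \<le> b" "0 \<le> s" "s \<le> 1" "1 \<le> q"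
  shows "(s * a + (1 - s) * b) powr q \<le> s * a powr q + (1 - s) * b powr q"
proof -
  have shrink: "(t * c) powr q \<le> t * c powr q" if "0 \<le> t" "t \<le> 1" "0 \<le> c" for t c :: real
  proof -
    have "t powr q \<le> t powr 1" using that assms by (intro powr_mono') auto
    then show ?thesis using that by (auto simp: powr_mult intro: mult_right_mono)
  qed
  consider "a = 0" | "b = 0" | "0 < a" "0 < b" using assms by linarith
  then show ?thesis
  proof cases
    case 1 then show ?thesis using shrink[of "1 - s" b] assms by simp
  next
    case 2 then show ?thesis using shrink[of s a] assms by simp
  next
    case 3
    then show ?thesis
      using convex_onD[OF powr_convex[OF \<open>1 \<le> q\<close>], of "1 - s" a b] assms
      by (simp add: algebra_simps)
  qed
qed

locale exponent =
  fixes p :: "real \<Rightarrow> real"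
  assumes measurable_exponent: "p \<in> borel_measurable lebesgue"
    and exponent_ge_1: "\<And>x. 1 \<le> p x"
begin

lemma exponent_pos: "0 < p x"
  using exponent_ge_1[of x] by simp

lemma modular_mono_AE:
  assumes "AE x in lebesgue. \<bar>f x\<bar> \<le> \<bar>g x\<bar>"
  shows "modular p f \<le> modular p g"
  unfolding modular_def
proof (rule nn_integral_mono_AE)
  show "AE x in lebesgue. ennreal (\<bar>f x\<bar> powr p x) \<le> ennreal (\<bar>g x\<bar> powr p x)"
    using assms
    by eventually_elim (auto intro!: ennreal_leI powr_mono2 simp: less_imp_le[OF exponent_pos])
qed

lemma modular_convex:
  assumes [measurable]: "f \<in> borel_measurable lebesgue" "g \<in> borel_measurable lebesgue"
    and s: "0 \<le> s" "s \<le> 1"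
  shows "modular p (\<lambda>x. s * f x + (1 - s) * g x)
    \<le> ennreal s * modular p f + ennreal (1 - s) * modular p g"
proof -
  note [measurable] = measurable_exponent
  have "modular p (\<lambda>x. s * f x + (1 - s) * g x)
      \<le> (\<integral>\<^sup>+x. ennreal s * ennreal (\<bar>f x\<bar> powr p x)
            + ennreal (1 - s) * ennreal (\<bar>g x\<bar> powr p x) \<partial>lebesgue)"
    unfolding modular_def
  proof (rule nn_integral_mono)
    fix x
    have "\<bar>s * f x + (1 - s) * g x\<bar> powr p x \<le> (s * \<bar>f x\<bar> + (1 - s) * \<bar>g x\<bar>) powr p x"
    proof (rule powr_mono2)
      show "\<bar>s * f x + (1 - s) * g x\<bar> \<le> s * \<bar>f x\<bar> + (1 - s) * \<bar>g x\<bar>"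
        using abs_triangle_ineq[of "s * f x" "(1 - s) * g x"] s by (simp add: abs_mult)
    qed (use exponent_pos[of x] in auto)
    also have "\<dots> \<le> s * \<bar>f x\<bar> powr p x + (1 - s) * \<bar>g x\<bar> powr p x"
      using s by (intro powr_convex_combination exponent_ge_1) auto
    finally show "ennreal (\<bar>s * f x + (1 - s) * g x\<bar> powr p x) \<le>
        ennreal s * ennreal (\<bar>f x\<bar> powr p x) + ennreal (1 - s) * ennreal (\<bar>g x\<bar> powr p x)"
      using s by (simp flip: ennreal_mult ennreal_plus)
  qed
  also have "\<dots> = ennreal s * modular p f + ennreal (1 - s) * modular p g"
    unfolding modular_def by (subst nn_integral_add) (auto simp: nn_integral_cmult)
  finally show ?thesis .
qed

lemma modular_shrink:
  assumes [measurable]: "f \<in> borel_measurable lebesgue" and s: "0 \<le> s" "s \<le> 1"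
  shows "modular p (\<lambda>x. s * f x) \<le> ennreal s * modular p f"
proof -
  have "modular p (\<lambda>_. 0) = 0" by (simp add: modular_def)
  then show ?thesis using modular_convex[of f "\<lambda>_. 0" s] s by simp
qed

lemma Lp_space_measurable: "f \<in> Lp_space p \<Longrightarrow> f \<in> borel_measurable lebesgue"
  by (simp add: Lp_space_def)

lemma Lp_spaceI:
  assumes "f \<in> borel_measurable lebesgue" "0 < \<eta>" "modular p (\<lambda>x. f x / \<eta>) < \<infinity>"
  shows "f \<in> Lp_space p"
  using assms by (auto simp: Lp_space_def)

lemma Lp_norm_set_nonempty:
  assumes "f \<in> Lp_space p"
  obtains \<eta> where "0 < \<eta>" "modular p (\<lambda>x. f x / \<eta>) < 1"
proof -
  obtain l where l: "0 < l" "modular p (\<lambda>y. f y / l) < \<infinity>"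
    and m [measurable]: "f \<in> borel_measurable lebesgue" using assms by (auto simp: Lp_space_def)
  obtain M where M: "modular p (\<lambda>y. f y / l) = ennreal M" "0 \<le> M"
    using l(2) by (cases "modular p (\<lambda>y. f y / l)") auto
  have "modular p (\<lambda>y. f y / (l * (M + 1))) = modular p (\<lambda>y. (1 / (M + 1)) * (f y / l))"
    by (simp add: field_simps)
  also have "\<dots> \<le> ennreal (1 / (M + 1)) * modular p (\<lambda>y. f y / l)"
    using M by (intro modular_shrink) auto
  also have "\<dots> < 1" using M by (simp add: ennreal_less_one_iff flip: ennreal_mult)
  finally show thesis using that[of "l * (M + 1)"] l M by simp
qed

lemma Lp_norm_nonneg: "f \<in> Lp_space p \<Longrightarrow> 0 \<le> Lp_norm p f"
  unfolding Lp_norm_def by (rule cInf_greatest) (auto elim: Lp_norm_set_nonempty)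

lemma Lp_norm_attained_above:
  assumes "f \<in> Lp_space p" "Lp_norm p f < \<eta>"
  shows "modular p (\<lambda>x. f x / \<eta>) < 1"
proof -
  have "{\<eta>. 0 < \<eta> \<and> modular p (\<lambda>y. f y / \<eta>) < 1} \<noteq> {}"
    using Lp_norm_set_nonempty[OF assms(1)] by blast
  then obtain \<zeta> where \<zeta>: "0 < \<zeta>" "modular p (\<lambda>y. f y / \<zeta>) < 1" "\<zeta> < \<eta>"
    using assms(2) cInf_lessD[of "{\<eta>. 0 < \<eta> \<and> modular p (\<lambda>y. f y / \<eta>) < 1}" \<eta>]
    unfolding Lp_norm_def by auto
  have "modular p (\<lambda>x. f x / \<eta>) \<le> modular p (\<lambda>x. f x / \<zeta>)"
    using \<zeta> by (intro modular_mono_AE AE_I2) (auto intro!: divide_left_mono)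
  then show ?thesis using \<zeta> by simp
qed

lemma Lp_norm_le:
  assumes "0 < \<eta>" "modular p (\<lambda>x. f x / \<eta>) < 1"
  shows "Lp_norm p f \<le> \<eta>"
  unfolding Lp_norm_def using assms by (intro cInf_lower) (auto intro!: bdd_belowI[of _ 0])

text \<open>The way all norm inequalities are obtained: the infimum defining the norm need not be attained, so
  that bounds are checked on its competitors.\<close>

lemma Lp_norm_le_scaled:
  assumes "f \<in> Lp_space p" "0 \<le> c"
    and *: "\<And>\<eta>. 0 < \<eta> \<Longrightarrow> modular p (\<lambda>x. f x / \<eta>) < 1 \<Longrightarrow> Lp_norm p h \<le> c * \<eta>"
  shows "Lp_norm p h \<le> c * Lp_norm p f"
proof (rule field_le_epsilon)
  fix e :: real assume e: "0 < e"
  define \<eta> where "\<eta> = Lp_norm p f + e / (c + 1)"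
  have \<eta>: "Lp_norm p f < \<eta>" "0 < \<eta>"
    using e assms(2) Lp_norm_nonneg[OF assms(1)] by (auto simp: \<eta>_def add_nonneg_pos)
  have "Lp_norm p h \<le> c * \<eta>" using * \<eta> Lp_norm_attained_above[OF assms(1) \<eta>(1)] by blast
  also have "\<dots> = c * Lp_norm p f + c / (c + 1) * e" by (simp add: \<eta>_def algebra_simps)
  also have "\<dots> \<le> c * Lp_norm p f + e" using assms(2) e by (simp add: field_simps)
  finally show "Lp_norm p h \<le> c * Lp_norm p f + e" .
qed

lemma Lp_mono_AE:
  assumes "g \<in> Lp_space p" "f \<in> borel_measurable lebesgue" "AE x in lebesgue. \<bar>f x\<bar> \<le> \<bar>g x\<bar>"
  shows "f \<in> Lp_space p" and "Lp_norm p f \<le> Lp_norm p g"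
proof -
  have le: "modular p (\<lambda>x. f x / \<eta>) \<le> modular p (\<lambda>x. g x / \<eta>)" if "0 < \<eta>" for \<eta>
  proof (rule modular_mono_AE)
    show "AE x in lebesgue. \<bar>f x / \<eta>\<bar> \<le> \<bar>g x / \<eta>\<bar>"
      using assms(3) by eventually_elim (use that in \<open>auto intro: divide_right_mono\<close>)
  qed
  show "f \<in> Lp_space p"
    using assms(1,2) le unfolding Lp_space_def by (auto intro: order.strict_trans1)
  have "Lp_norm p f \<le> 1 * Lp_norm p g"
    using le by (intro Lp_norm_le_scaled assms(1)) (auto intro!: Lp_norm_le intro: order.strict_trans1)
  then show "Lp_norm p f \<le> Lp_norm p g" by simp
qed

lemma Lp_cong_AE:
  assumes "g \<in> Lp_space p" "f \<in> borel_measurable lebesgue" "AE x in lebesgue. f x = g x"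
  shows "f \<in> Lp_space p" and "Lp_norm p f = Lp_norm p g"
proof -
  have f: "AE x in lebesgue. \<bar>f x\<bar> \<le> \<bar>g x\<bar>" "AE x in lebesgue. \<bar>g x\<bar> \<le> \<bar>f x\<bar>"
    using assms(3) by auto
  show 1: "f \<in> Lp_space p" using Lp_mono_AE(1)[OF assms(1,2) f(1)] .
  show "Lp_norm p f = Lp_norm p g"
    using Lp_mono_AE(2)[OF assms(1,2) f(1)]
      Lp_mono_AE(2)[OF 1 Lp_space_measurable[OF assms(1)] f(2)] by simp
qed

lemma Lp_add:
  assumes f: "f \<in> Lp_space p" and g: "g \<in> Lp_space p"
  shows "(\<lambda>x. f x + g x) \<in> Lp_space p"
    and "Lp_norm p (\<lambda>x. f x + g x) \<le> Lp_norm p f + Lp_norm p g"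
proof -
  note [measurable] = Lp_space_measurable[OF f] Lp_space_measurable[OF g]
  have *: "modular p (\<lambda>x. (f x + g x) / (a + b)) < 1"
    if ab: "Lp_norm p f < a" "Lp_norm p g < b" for a b
  proof -
    have pos: "0 < a" "0 < b" using ab Lp_norm_nonneg[OF f] Lp_norm_nonneg[OF g] by auto
    define s where "s = a / (a + b)"
    have s: "0 < s" "s < 1" "1 - s = b / (a + b)" using pos by (auto simp: s_def field_simps)
    have eq: "(f x + g x) / (a + b) = s * (f x / a) + (1 - s) * (g x / b)" for x
      using pos unfolding s(3) by (simp add: s_def add_divide_distrib)
    have "modular p (\<lambda>x. (f x + g x) / (a + b))
        \<le> ennreal s * modular p (\<lambda>x. f x / a) + ennreal (1 - s) * modular p (\<lambda>x. g x / b)"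
      unfolding eq using s by (intro modular_convex) auto
    also have "\<dots> < ennreal s * 1 + ennreal (1 - s) * 1"
      using s Lp_norm_attained_above[OF f ab(1)] Lp_norm_attained_above[OF g ab(2)]
      by (intro add_strict_mono ennreal_mult_strict_left_mono) (auto simp: ennreal_mult_less_top)
    also have "\<dots> = 1" using s by (simp flip: ennreal_plus)
    finally show ?thesis .
  qed
  have ex: "Lp_norm p f < Lp_norm p f + 1" "Lp_norm p g < Lp_norm p g + 1" by auto
  show "(\<lambda>x. f x + g x) \<in> Lp_space p"
    by (rule Lp_spaceI[OF _ _ order.strict_trans[OF *[OF ex]]])
       (use Lp_norm_nonneg[OF f] Lp_norm_nonneg[OF g] in auto)
  show "Lp_norm p (\<lambda>x. f x + g x) \<le> Lp_norm p f + Lp_norm p g"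
  proof (rule field_le_epsilon)
    fix e :: real assume e: "0 < e"
    show "Lp_norm p (\<lambda>x. f x + g x) \<le> Lp_norm p f + Lp_norm p g + e"
      using Lp_norm_le[OF _ *[of "Lp_norm p f + e/2" "Lp_norm p g + e/2"]] e
        Lp_norm_nonneg[OF f] Lp_norm_nonneg[OF g] by simp
  qed
qed

lemma Lp_cmult:
  assumes f: "f \<in> Lp_space p"
  shows "(\<lambda>x. c * f x) \<in> Lp_space p"
    and "Lp_norm p (\<lambda>x. c * f x) \<le> \<bar>c\<bar> * Lp_norm p f"
proof -
  note [measurable] = Lp_space_measurable[OF f]
  show m: "(\<lambda>x. c * f x) \<in> Lp_space p"
  proof (cases "c = 0")
    case True
    have "modular p (\<lambda>_. 0) = 0" by (simp add: modular_def)
    then show ?thesis using True by (auto simp: Lp_space_def intro!: exI[of _ 1])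
  next
    case False
    obtain l where l: "0 < l" "modular p (\<lambda>y. f y / l) < \<infinity>" using f by (auto simp: Lp_space_def)
    show ?thesis
    proof (rule Lp_spaceI[of _ "\<bar>c\<bar> * l"])
      have "modular p (\<lambda>x. c * f x / (\<bar>c\<bar> * l)) \<le> modular p (\<lambda>y. f y / l)"
        using False by (intro modular_mono_AE AE_I2) (auto simp: abs_mult)
      then show "modular p (\<lambda>x. c * f x / (\<bar>c\<bar> * l)) < \<infinity>" using l by simp
    qed (use False l in auto)
  qed
  show "Lp_norm p (\<lambda>x. c * f x) \<le> \<bar>c\<bar> * Lp_norm p f"
  proof (cases "c = 0")
    case True
    have z: "modular p (\<lambda>_. 0) = 0" by (simp add: modular_def)
    have "Lp_norm p (\<lambda>x. 0) \<le> 0"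
    proof (rule field_le_epsilon)
      fix e :: real assume "0 < e"
      then show "Lp_norm p (\<lambda>x. 0) \<le> 0 + e" using z by (auto intro!: Lp_norm_le)
    qed
    then show ?thesis using True by simp
  next
    case False
    show ?thesis
    proof (rule Lp_norm_le_scaled[OF f])
      fix \<eta> :: real assume \<eta>: "0 < \<eta>" "modular p (\<lambda>x. f x / \<eta>) < 1"
      have "modular p (\<lambda>x. c * f x / (\<bar>c\<bar> * \<eta>)) \<le> modular p (\<lambda>y. f y / \<eta>)"
        using False by (intro modular_mono_AE AE_I2) (auto simp: abs_mult)
      then show "Lp_norm p (\<lambda>x. c * f x) \<le> \<bar>c\<bar> * \<eta>"
        using False \<eta> by (intro Lp_norm_le) auto
    qed simp
  qed
qed

end

section \<open>Averages with exponentially decaying kernels\<close>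

definition decay :: "real \<Rightarrow> real" where
  "decay t = indicator {0..} t * exp (- t / 2)"

text \<open>The functions on which averages with a kernel bounded by \<open>decay\<close> converge at every point; all
  operators below preserve this class.\<close>

definition tame :: "real \<Rightarrow> (real \<Rightarrow> real) set" where
  "tame \<delta> = {f \<in> borel_measurable borel. \<forall>x. integrable lborel (\<lambda>t. decay t * f (x + \<delta> * t))}"

definition decay_mean :: "real \<Rightarrow> (real \<Rightarrow> real) \<Rightarrow> real \<Rightarrow> real" where
  "decay_mean \<delta> f x = (LINT t|lborel. decay t * \<bar>f (x + \<delta> * t)\<bar>)"

definition average :: "real \<Rightarrow> (real \<Rightarrow> real) \<Rightarrow> (real \<Rightarrow> real) \<Rightarrow> real \<Rightarrow> real" where
  "average \<delta> k f x = (LINT t|lborel. k t * f (x + \<delta> * t))"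

text \<open>\<open>m\<close> bounds the exponential moment, which controls \<open>decay_mean\<close> of the average, and \<open>B\<close> compares the kernel
  with \<open>decay\<close>, which controls the average at a point.\<close>

definition kernel :: "real \<Rightarrow> real \<Rightarrow> (real \<Rightarrow> real) \<Rightarrow> bool" where
  "kernel m B k \<longleftrightarrow> 0 \<le> m \<and> 0 \<le> B \<and> k \<in> borel_measurable borel \<and> (\<forall>t. \<bar>k t\<bar> \<le> B * decay t) \<and>
     (\<integral>\<^sup>+t. ennreal (\<bar>k t\<bar> * exp (t / 2)) \<partial>lborel) \<le> ennreal m"

lemma decay_measurable [measurable]: "decay \<in> borel_measurable borel"
  unfolding decay_def by measurable

lemma decay_nonneg [simp]: "0 \<le> decay t"
  by (simp add: decay_def)

lemma tame_measurable: "f \<in> tame \<delta> \<Longrightarrow> f \<in> borel_measurable borel"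
  by (simp add: tame_def)

lemma tame_integrable: "f \<in> tame \<delta> \<Longrightarrow> integrable lborel (\<lambda>t. decay t * f (x + \<delta> * t))"
  by (simp add: tame_def)

lemma tame_integrable_abs:
  assumes "f \<in> tame \<delta>" shows "integrable lborel (\<lambda>t. decay t * \<bar>f (x + \<delta> * t)\<bar>)"
  using integrable_abs[OF tame_integrable[OF assms, of x]] by (simp add: abs_mult)

lemma decay_mean_nonneg [simp]: "0 \<le> decay_mean \<delta> f x"
  unfolding decay_mean_def by (intro integral_nonneg_AE) auto

lemma nn_integral_decay_mean:
  assumes "f \<in> tame \<delta>"
  shows "(\<integral>\<^sup>+t. ennreal (decay t * \<bar>f (x + \<delta> * t)\<bar>) \<partial>lborel) = ennreal (decay_mean \<delta> f x)"
  unfolding decay_mean_def by (intro nn_integral_eq_integral tame_integrable_abs assms) auto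

lemma nn_integral_decay_mean_cmult:
  assumes f: "f \<in> tame \<delta>" and c: "0 \<le> c"
  shows "(\<integral>\<^sup>+t. ennreal c * ennreal (decay t * \<bar>f (x + \<delta> * t)\<bar>) \<partial>lborel)
    = ennreal (c * decay_mean \<delta> f x)"
proof -
  note [measurable] = tame_measurable[OF f]
  have "(\<integral>\<^sup>+t. ennreal c * ennreal (decay t * \<bar>f (x + \<delta> * t)\<bar>) \<partial>lborel)
      = ennreal c * (\<integral>\<^sup>+t. ennreal (decay t * \<bar>f (x + \<delta> * t)\<bar>) \<partial>lborel)"
    by (rule nn_integral_cmult) measurable
  then show ?thesis unfolding nn_integral_decay_mean[OF f] using c by (simp add: ennreal_mult)
qed

lemma tameI:
  assumes [measurable]: "f \<in> borel_measurable borel"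
    and "\<And>x. (\<integral>\<^sup>+t. ennreal (decay t * \<bar>f (x + \<delta> * t)\<bar>) \<partial>lborel) < \<infinity>"
  shows "f \<in> tame \<delta>"
  unfolding tame_def using assms(2) by (auto intro!: integrableI_bounded simp: abs_mult)

lemma decay_mean_measurable [measurable]:
  assumes [measurable]: "f \<in> borel_measurable borel"
  shows "decay_mean \<delta> f \<in> borel_measurable borel"
  unfolding decay_mean_def by measurable

lemma average_measurable:
  assumes [measurable]: "k \<in> borel_measurable borel" "f \<in> borel_measurable borel"
  shows "average \<delta> k f \<in> borel_measurable borel"
  unfolding average_def by measurable

lemma tame_add: "f \<in> tame \<delta> \<Longrightarrow> g \<in> tame \<delta> \<Longrightarrow> (\<lambda>x. f x + g x) \<in> tame \<delta>"
  by (auto simp: tame_def distrib_left)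

lemma tame_diff: "f \<in> tame \<delta> \<Longrightarrow> g \<in> tame \<delta> \<Longrightarrow> (\<lambda>x. f x - g x) \<in> tame \<delta>"
  by (auto simp: tame_def right_diff_distrib)

lemma tame_cmult: "f \<in> tame \<delta> \<Longrightarrow> (\<lambda>x. c * f x) \<in> tame \<delta>"
  by (auto simp: tame_def mult.left_commute)

lemma decay_mean_add:
  assumes "f \<in> tame \<delta>" "g \<in> tame \<delta>"
  shows "decay_mean \<delta> (\<lambda>x. f x + g x) x \<le> decay_mean \<delta> f x + decay_mean \<delta> g x"
proof -
  have "decay_mean \<delta> (\<lambda>x. f x + g x) x
      \<le> (LINT t|lborel. decay t * \<bar>f (x + \<delta> * t)\<bar> + decay t * \<bar>g (x + \<delta> * t)\<bar>)"
    unfolding decay_mean_def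
  proof (rule integral_mono)
    show "decay t * \<bar>f (x + \<delta> * t) + g (x + \<delta> * t)\<bar>
        \<le> decay t * \<bar>f (x + \<delta> * t)\<bar> + decay t * \<bar>g (x + \<delta> * t)\<bar>" for t
      unfolding distrib_left[symmetric] by (intro mult_left_mono abs_triangle_ineq) simp
  qed (use tame_integrable_abs[OF tame_add[OF assms]] assms[THEN tame_integrable_abs] in auto)
  then show ?thesis unfolding decay_mean_def using assms[THEN tame_integrable_abs] by simp
qed

lemma decay_mean_cmult: "decay_mean \<delta> (\<lambda>x. c * f x) x = \<bar>c\<bar> * decay_mean \<delta> f x"
  unfolding decay_mean_def by (simp add: abs_mult mult.left_commute)

text \<open>This is what makes the weight useful: \<open>decay (t - s) \<le> e^(s/2) decay t\<close> for \<open>s \<ge> 0\<close>. As a consequence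
  an average increases \<open>decay_mean\<close> at most by the factor given by its moment.\<close>

lemma decay_mean_shift:
  assumes f: "f \<in> tame \<delta>" and s: "0 \<le> s"
  shows "decay_mean \<delta> f (x + \<delta> * s) \<le> exp (s / 2) * decay_mean \<delta> f x"
proof -
  note [measurable] = tame_measurable[OF f]
  have "ennreal (decay_mean \<delta> f (x + \<delta> * s))
      = (\<integral>\<^sup>+t. ennreal (decay t * \<bar>f (x + \<delta> * s + \<delta> * t)\<bar>) \<partial>lborel)"
    using nn_integral_decay_mean[OF f] by simp
  also have "\<dots> = (\<integral>\<^sup>+t. ennreal (decay (t - s) * \<bar>f (x + \<delta> * t)\<bar>) \<partial>lborel)"
    by (subst nn_integral_real_affine[where c = 1 and t = s and f = "\<lambda>t. ennreal (decay (t - s) * \<bar>f (x + \<delta> * t)\<bar>)"])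
       (auto simp: algebra_simps)
  also have "\<dots> \<le> (\<integral>\<^sup>+t. ennreal (exp (s / 2)) * ennreal (decay t * \<bar>f (x + \<delta> * t)\<bar>) \<partial>lborel)"
  proof (rule nn_integral_mono)
    fix t
    have "decay (t - s) \<le> exp (s / 2) * decay t"
      using s by (auto simp: decay_def indicator_def field_simps simp flip: exp_add)
    then have "decay (t - s) * \<bar>f (x + \<delta> * t)\<bar> \<le> exp (s / 2) * (decay t * \<bar>f (x + \<delta> * t)\<bar>)"
      by (simp add: mult_right_mono mult.assoc[symmetric])
    then show "ennreal (decay (t - s) * \<bar>f (x + \<delta> * t)\<bar>)
        \<le> ennreal (exp (s / 2)) * ennreal (decay t * \<bar>f (x + \<delta> * t)\<bar>)"
      by (simp add: ennreal_leI flip: ennreal_mult)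
  qed
  also have "\<dots> = ennreal (exp (s / 2) * decay_mean \<delta> f x)"
    by (rule nn_integral_decay_mean_cmult[OF f]) simp
  finally show ?thesis by (subst (asm) ennreal_le_iff) auto
qed

lemma kernel_measurable: "kernel m B k \<Longrightarrow> k \<in> borel_measurable borel"
  by (simp add: kernel_def)

lemma kernel_decay_mean:
  assumes k: "kernel m B k" and f: "f \<in> tame \<delta>"
  shows "(\<integral>\<^sup>+s. ennreal (\<bar>k s\<bar> * decay_mean \<delta> f (x + \<delta> * s)) \<partial>lborel) \<le> ennreal (m * decay_mean \<delta> f x)"
proof -
  note [measurable] = tame_measurable[OF f] kernel_measurable[OF k]
  have "(\<integral>\<^sup>+s. ennreal (\<bar>k s\<bar> * decay_mean \<delta> f (x + \<delta> * s)) \<partial>lborel)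
      \<le> (\<integral>\<^sup>+s. ennreal (\<bar>k s\<bar> * exp (s / 2)) * ennreal (decay_mean \<delta> f x) \<partial>lborel)"
  proof (rule nn_integral_mono)
    fix s
    have "\<bar>k s\<bar> * decay_mean \<delta> f (x + \<delta> * s) \<le> \<bar>k s\<bar> * (exp (s / 2) * decay_mean \<delta> f x)"
    proof (cases "0 \<le> s")
      case True
      then show ?thesis by (intro mult_left_mono decay_mean_shift f) auto
    next
      case False
      then have "\<bar>k s\<bar> \<le> B * 0" using k unfolding kernel_def decay_def by (metis atLeast_iff indicator_simps(2) mult_zero_left)
      then show ?thesis by simp
    qed
    then show "ennreal (\<bar>k s\<bar> * decay_mean \<delta> f (x + \<delta> * s))
        \<le> ennreal (\<bar>k s\<bar> * exp (s / 2)) * ennreal (decay_mean \<delta> f x)"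
      by (simp add: ennreal_leI mult.assoc flip: ennreal_mult)
  qed
  also have "\<dots> = (\<integral>\<^sup>+s. ennreal (\<bar>k s\<bar> * exp (s / 2)) \<partial>lborel) * ennreal (decay_mean \<delta> f x)"
    by (rule nn_integral_multc) auto
  also have "\<dots> \<le> ennreal m * ennreal (decay_mean \<delta> f x)"
    using k unfolding kernel_def by (intro mult_right_mono) auto
  finally show ?thesis using k by (simp add: kernel_def ennreal_mult)
qed

lemma kernel_nn_integral:
  assumes k: "kernel m B k" and f: "f \<in> tame \<delta>"
  shows "(\<integral>\<^sup>+t. ennreal \<bar>k t * f (x + \<delta> * t)\<bar> \<partial>lborel) \<le> ennreal (B * decay_mean \<delta> f x)"
proof -
  note [measurable] = tame_measurable[OF f] kernel_measurable[OF k]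
  have B: "0 \<le> B" using k by (simp add: kernel_def)
  have "(\<integral>\<^sup>+t. ennreal \<bar>k t * f (x + \<delta> * t)\<bar> \<partial>lborel)
      \<le> (\<integral>\<^sup>+t. ennreal B * ennreal (decay t * \<bar>f (x + \<delta> * t)\<bar>) \<partial>lborel)"
  proof (rule nn_integral_mono)
    fix t
    have "\<bar>k t\<bar> * \<bar>f (x + \<delta> * t)\<bar> \<le> (B * decay t) * \<bar>f (x + \<delta> * t)\<bar>"
      using k unfolding kernel_def by (intro mult_right_mono) auto
    then show "ennreal \<bar>k t * f (x + \<delta> * t)\<bar> \<le> ennreal B * ennreal (decay t * \<bar>f (x + \<delta> * t)\<bar>)"
      using B by (simp add: abs_mult ennreal_leI mult.assoc flip: ennreal_mult)
  qed
  also have "\<dots> = ennreal (B * decay_mean \<delta> f x)"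
    by (rule nn_integral_decay_mean_cmult[OF f B])
  finally show ?thesis .
qed

lemma kernel_integrable:
  assumes k: "kernel m B k" and f: "f \<in> tame \<delta>"
  shows "integrable lborel (\<lambda>t. k t * f (x + \<delta> * t))"
proof (rule integrableI_bounded)
  note [measurable] = tame_measurable[OF f] kernel_measurable[OF k]
  show "(\<lambda>t. k t * f (x + \<delta> * t)) \<in> borel_measurable lborel" by measurable
  show "(\<integral>\<^sup>+t. ennreal (norm (k t * f (x + \<delta> * t))) \<partial>lborel) < \<infinity>"
    using kernel_nn_integral[OF assms, of x] by (simp add: order.strict_trans1)
qed

lemma average_nn_bound:
  "ennreal \<bar>average \<delta> k f x\<bar> \<le> (\<integral>\<^sup>+t. ennreal \<bar>k t * f (x + \<delta> * t)\<bar> \<partial>lborel)"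
proof (cases "integrable lborel (\<lambda>t. k t * f (x + \<delta> * t))")
  case True
  then show ?thesis unfolding average_def
    using integral_norm_bound_ennreal[OF True] by simp
qed (simp add: average_def not_integrable_integral_eq)

lemma average_bound:
  assumes k: "kernel m B k" and f: "f \<in> tame \<delta>"
  shows "\<bar>average \<delta> k f x\<bar> \<le> B * decay_mean \<delta> f x"
proof -
  have "ennreal \<bar>average \<delta> k f x\<bar> \<le> ennreal (B * decay_mean \<delta> f x)"
    using average_nn_bound kernel_nn_integral[OF assms] by (rule order_trans)
  then show ?thesis using k by (subst (asm) ennreal_le_iff) (auto simp: kernel_def)
qed

lemma decay_mean_average:
  assumes k: "kernel m B k" and f: "f \<in> tame \<delta>"
  shows "average \<delta> k f \<in> tame \<delta>" and "decay_mean \<delta> (average \<delta> k f) x \<le> m * decay_mean \<delta> f x"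
proof -
  note [measurable] = tame_measurable[OF f] kernel_measurable[OF k]
    average_measurable[OF kernel_measurable[OF k] tame_measurable[OF f], of \<delta>]
  have *: "(\<integral>\<^sup>+t. ennreal (decay t * \<bar>average \<delta> k f (x + \<delta> * t)\<bar>) \<partial>lborel)
      \<le> ennreal (m * decay_mean \<delta> f x)" for x
  proof -
    have "(\<integral>\<^sup>+t. ennreal (decay t * \<bar>average \<delta> k f (x + \<delta> * t)\<bar>) \<partial>lborel)
        \<le> (\<integral>\<^sup>+t. \<integral>\<^sup>+s. ennreal (decay t * \<bar>k s * f (x + \<delta> * t + \<delta> * s)\<bar>) \<partial>lborel \<partial>lborel)"
    proof (rule nn_integral_mono)
      fix t
      have "ennreal (decay t * \<bar>average \<delta> k f (x + \<delta> * t)\<bar>)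
          \<le> ennreal (decay t) * (\<integral>\<^sup>+s. ennreal \<bar>k s * f (x + \<delta> * t + \<delta> * s)\<bar> \<partial>lborel)"
        by (simp add: ennreal_mult mult_left_mono average_nn_bound)
      also have "\<dots> = (\<integral>\<^sup>+s. ennreal (decay t * \<bar>k s * f (x + \<delta> * t + \<delta> * s)\<bar>) \<partial>lborel)"
        by (subst nn_integral_cmult[symmetric]) (auto simp: ennreal_mult)
      finally show "ennreal (decay t * \<bar>average \<delta> k f (x + \<delta> * t)\<bar>) \<le> \<dots>" .
    qed
    also have "\<dots> = (\<integral>\<^sup>+s. \<integral>\<^sup>+t. ennreal (decay t * \<bar>k s * f (x + \<delta> * t + \<delta> * s)\<bar>) \<partial>lborel \<partial>lborel)"
      by (rule lborel_pair.Fubini') measurable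
    also have "\<dots> = (\<integral>\<^sup>+s. ennreal (\<bar>k s\<bar> * decay_mean \<delta> f (x + \<delta> * s)) \<partial>lborel)"
    proof (rule nn_integral_cong)
      fix s
      have "(\<integral>\<^sup>+t. ennreal (decay t * \<bar>k s * f (x + \<delta> * t + \<delta> * s)\<bar>) \<partial>lborel)
          = (\<integral>\<^sup>+t. ennreal \<bar>k s\<bar> * ennreal (decay t * \<bar>f (x + \<delta> * s + \<delta> * t)\<bar>) \<partial>lborel)"
        by (intro nn_integral_cong) (simp add: abs_mult ac_simps flip: ennreal_mult)
      also have "\<dots> = ennreal (\<bar>k s\<bar> * decay_mean \<delta> f (x + \<delta> * s))"
        by (rule nn_integral_decay_mean_cmult[OF f]) simp
      finally show "(\<integral>\<^sup>+t. ennreal (decay t * \<bar>k s * f (x + \<delta> * t + \<delta> * s)\<bar>) \<partial>lborel) = \<dots>" .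
    qed
    also have "\<dots> \<le> ennreal (m * decay_mean \<delta> f x)" by (rule kernel_decay_mean[OF k f])
    finally show ?thesis .
  qed
  show t: "average \<delta> k f \<in> tame \<delta>"
    using order.strict_trans1[OF * ennreal_less_top] by (intro tameI) auto
  have "0 \<le> m * decay_mean \<delta> f x" using k by (auto simp: kernel_def)
  then show "decay_mean \<delta> (average \<delta> k f) x \<le> m * decay_mean \<delta> f x"
    using *[of x] unfolding nn_integral_decay_mean[OF t] by (subst (asm) ennreal_le_iff) auto
qed

lemma average_average_eq:
  assumes k: "kernel m B k" and l: "kernel m' B' l" and f: "f \<in> tame \<delta>"
  shows "average \<delta> k (average \<delta> l f) x
    = (LINT t|lborel. (LINT s|lborel. k s * l (t - s)) * f (x + \<delta> * t))"
proof -
  note [measurable] = tame_measurable[OF f] kernel_measurable[OF k] kernel_measurable[OF l]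
  let ?\<psi> = "\<lambda>(s, t). k s * l (t - s) * f (x + \<delta> * t)"
  have shift: "(\<integral>\<^sup>+t. ennreal \<bar>l (t - s) * f (x + \<delta> * t)\<bar> \<partial>lborel)
      = (\<integral>\<^sup>+t. ennreal \<bar>l t * f (x + \<delta> * s + \<delta> * t)\<bar> \<partial>lborel)" for s
    by (subst nn_integral_real_affine[where c = 1 and t = s])
       (auto simp: algebra_simps)
  have "(\<integral>\<^sup>+z. ennreal (norm (?\<psi> z)) \<partial>(lborel \<Otimes>\<^sub>M lborel))
      = (\<integral>\<^sup>+s. \<integral>\<^sup>+t. ennreal (norm (?\<psi> (s, t))) \<partial>lborel \<partial>lborel)"
    by (rule lborel.nn_integral_fst[symmetric]) measurable
  also have "\<dots> = (\<integral>\<^sup>+s. ennreal \<bar>k s\<bar> * (\<integral>\<^sup>+t. ennreal \<bar>l (t - s) * f (x + \<delta> * t)\<bar> \<partial>lborel) \<partial>lborel)"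
    by (intro nn_integral_cong, subst nn_integral_cmult[symmetric])
       (auto simp: abs_mult mult.assoc ennreal_mult)
  also have "\<dots> \<le> (\<integral>\<^sup>+s. ennreal B' * ennreal (\<bar>k s\<bar> * decay_mean \<delta> f (x + \<delta> * s)) \<partial>lborel)"
  proof (rule nn_integral_mono)
    fix s
    have "ennreal \<bar>k s\<bar> * (\<integral>\<^sup>+t. ennreal \<bar>l (t - s) * f (x + \<delta> * t)\<bar> \<partial>lborel)
        \<le> ennreal \<bar>k s\<bar> * ennreal (B' * decay_mean \<delta> f (x + \<delta> * s))"
      unfolding shift by (intro mult_left_mono kernel_nn_integral[OF l f]) auto
    also have "\<dots> = ennreal B' * ennreal (\<bar>k s\<bar> * decay_mean \<delta> f (x + \<delta> * s))"
      using l by (simp add: kernel_def ac_simps flip: ennreal_mult)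
    finally show "ennreal \<bar>k s\<bar> * (\<integral>\<^sup>+t. ennreal \<bar>l (t - s) * f (x + \<delta> * t)\<bar> \<partial>lborel) \<le> \<dots>" .
  qed
  also have "\<dots> \<le> ennreal B' * ennreal (m * decay_mean \<delta> f x)"
    by (subst nn_integral_cmult) (auto intro!: mult_left_mono kernel_decay_mean[OF k f])
  also have "\<dots> < \<infinity>" by (simp add: ennreal_mult_less_top)
  finally have int: "integrable (lborel \<Otimes>\<^sub>M lborel) ?\<psi>"
    by (intro integrableI_bounded) measurable
  have "average \<delta> k (average \<delta> l f) x
      = (LINT s|lborel. LINT t|lborel. k s * l (t - s) * f (x + \<delta> * t))"
    unfolding average_def
  proof (rule Bochner_Integration.integral_cong[OF refl])
    fix s
    have "(LINT t|lborel. l t * f (x + \<delta> * s + \<delta> * t)) = (LINT t|lborel. l (t - s) * f (x + \<delta> * t))"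
      by (subst lborel_integral_real_affine[where c = 1 and t = s and f = "\<lambda>t. l (t - s) * f (x + \<delta> * t)"])
         (auto simp: algebra_simps)
    then show "k s * (LINT t|lborel. l t * f (x + \<delta> * s + \<delta> * t))
        = (LINT t|lborel. k s * l (t - s) * f (x + \<delta> * t))"
      by (simp add: mult.assoc)
  qed
  also have "\<dots> = (LINT t|lborel. LINT s|lborel. k s * l (t - s) * f (x + \<delta> * t))"
    using lborel_pair.Fubini_integral[OF int] by simp
  finally show ?thesis by simp
qed

lemma average_commute:
  assumes k: "kernel m B k" and l: "kernel m' B' l" and f: "f \<in> tame \<delta>"
  shows "average \<delta> k (average \<delta> l f) = average \<delta> l (average \<delta> k f)"
proof
  fix x
  have "(LINT s|lborel. k s * l (t - s)) = (LINT s|lborel. l s * k (t - s))" for t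
    by (subst lborel_integral_real_affine[where c = "-1" and t = t]) (auto simp: mult.commute)
  then show "average \<delta> k (average \<delta> l f) x = average \<delta> l (average \<delta> k f) x"
    by (simp add: average_average_eq[OF k l f] average_average_eq[OF l k f])
qed

lemma average_add:
  assumes k: "kernel m B k" and f: "f \<in> tame \<delta>" "g \<in> tame \<delta>"
  shows "average \<delta> k (\<lambda>x. f x + g x) = (\<lambda>x. average \<delta> k f x + average \<delta> k g x)"
  using kernel_integrable[OF k] f by (simp add: average_def fun_eq_iff distrib_left)

lemma average_diff:
  assumes k: "kernel m B k" and f: "f \<in> tame \<delta>" "g \<in> tame \<delta>"
  shows "average \<delta> k (\<lambda>x. f x - g x) = (\<lambda>x. average \<delta> k f x - average \<delta> k g x)"
  using kernel_integrable[OF k] f by (simp add: average_def fun_eq_iff right_diff_distrib)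

lemma average_cmult: "average \<delta> k (\<lambda>x. c * f x) = (\<lambda>x. c * average \<delta> k f x)"
  by (simp add: average_def fun_eq_iff mult.left_commute)

section \<open>Domination\<close>

text \<open>\<open>h\<close> is thought of as the image of \<open>f\<close> under an operator of moment \<open>m\<close>, made of a multiple of the
  identity of size \<open>a\<close> and of an average, whose moment is at most \<open>m - a\<close>. With the coefficient
  \<open>3 (m - a)\<close> of the average at a point, the relation is closed under composition and the numbers \<open>m\<close>
  multiply without any further loss. The factor \<open>3\<close> is large enough for all kernels below.\<close>

definition dominated :: "real \<Rightarrow> real \<Rightarrow> (real \<Rightarrow> real) \<Rightarrow> (real \<Rightarrow> real) \<Rightarrow> bool" where
  "dominated \<delta> m h f \<longleftrightarrow> h \<in> tame \<delta> \<and>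
     (\<exists>a. 0 \<le> a \<and> a \<le> m \<and> (\<forall>x. \<bar>h x\<bar> \<le> a * \<bar>f x\<bar> + 3 * (m - a) * decay_mean \<delta> f x)) \<and>
     (\<forall>x. decay_mean \<delta> h x \<le> m * decay_mean \<delta> f x)"

lemma dominatedI:
  assumes "h \<in> tame \<delta>" "0 \<le> a" "a \<le> m"
    "\<And>x. \<bar>h x\<bar> \<le> a * \<bar>f x\<bar> + 3 * (m - a) * decay_mean \<delta> f x"
    "\<And>x. decay_mean \<delta> h x \<le> m * decay_mean \<delta> f x"
  shows "dominated \<delta> m h f"
  using assms unfolding dominated_def by blast

lemma dominated_tame: "dominated \<delta> m h f \<Longrightarrow> h \<in> tame \<delta>"
  by (simp add: dominated_def)

lemma dominated_refl: "f \<in> tame \<delta> \<Longrightarrow> dominated \<delta> 1 f f"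
  by (rule dominatedI[of _ _ 1]) auto

lemma dominated_bound:
  assumes "dominated \<delta> m h f"
  shows "\<bar>h x\<bar> \<le> m * (\<bar>f x\<bar> + 3 * decay_mean \<delta> f x)"
proof -
  obtain a where a: "0 \<le> a" "a \<le> m" "\<bar>h x\<bar> \<le> a * \<bar>f x\<bar> + 3 * (m - a) * decay_mean \<delta> f x"
    using assms unfolding dominated_def by blast
  have "a * \<bar>f x\<bar> \<le> m * \<bar>f x\<bar>" using a by (intro mult_right_mono) auto
  moreover have "3 * (m - a) * decay_mean \<delta> f x \<le> 3 * m * decay_mean \<delta> f x"
    using a by (intro mult_right_mono) auto
  ultimately show ?thesis using a(3) by (simp add: algebra_simps)
qed

lemma dominated_mono:
  assumes "dominated \<delta> m h f" "m \<le> m'"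
  shows "dominated \<delta> m' h f"
proof -
  obtain a where a: "0 \<le> a" "a \<le> m" "\<And>x. \<bar>h x\<bar> \<le> a * \<bar>f x\<bar> + 3 * (m - a) * decay_mean \<delta> f x"
    using assms(1) unfolding dominated_def by blast
  show ?thesis
  proof (rule dominatedI[OF dominated_tame[OF assms(1)] a(1)])
    fix x
    show "\<bar>h x\<bar> \<le> a * \<bar>f x\<bar> + 3 * (m' - a) * decay_mean \<delta> f x"
      using assms(2) by (intro order_trans[OF a(3)] add_left_mono mult_right_mono) auto
    show "decay_mean \<delta> h x \<le> m' * decay_mean \<delta> f x"
      using assms mult_right_mono[OF assms(2) decay_mean_nonneg[of \<delta> f x]]
      by (auto simp: dominated_def intro: order_trans)
  qed (use a assms in auto)
qed

text \<open>If \<open>a\<close> and \<open>b\<close> are the sizes of the two identity parts, then \<open>a b\<close> is the size for the composition,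
  since \<open>a (m' - b) + (m - a) m' = m m' - a b\<close>.\<close>

lemma dominated_trans:
  assumes 1: "dominated \<delta> m h g" and 2: "dominated \<delta> m' g f"
  shows "dominated \<delta> (m * m') h f"
proof -
  obtain a where a: "0 \<le> a" "a \<le> m" "\<And>x. \<bar>h x\<bar> \<le> a * \<bar>g x\<bar> + 3 * (m - a) * decay_mean \<delta> g x"
    using 1 unfolding dominated_def by blast
  obtain b where b: "0 \<le> b" "b \<le> m'" "\<And>x. \<bar>g x\<bar> \<le> b * \<bar>f x\<bar> + 3 * (m' - b) * decay_mean \<delta> f x"
    using 2 unfolding dominated_def by blast
  have mean: "decay_mean \<delta> h x \<le> m * decay_mean \<delta> g x" "decay_mean \<delta> g x \<le> m' * decay_mean \<delta> f x" for x
    using 1 2 unfolding dominated_def by auto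
  show ?thesis
  proof (rule dominatedI[OF dominated_tame[OF 1], of "a * b"])
    fix x
    have "\<bar>h x\<bar> \<le> a * (b * \<bar>f x\<bar> + 3 * (m' - b) * decay_mean \<delta> f x)
        + 3 * (m - a) * (m' * decay_mean \<delta> f x)"
      using a b mean by (intro order_trans[OF a(3)] add_mono mult_left_mono) auto
    then show "\<bar>h x\<bar> \<le> a * b * \<bar>f x\<bar> + 3 * (m * m' - a * b) * decay_mean \<delta> f x"
      by (simp add: algebra_simps)
    show "decay_mean \<delta> h x \<le> m * m' * decay_mean \<delta> f x"
      using mean(1)[of x] mult_left_mono[OF mean(2)[of x], of m] a by simp
  qed (use a b in \<open>auto intro: mult_mono\<close>)
qed

lemma dominated_add:
  assumes 1: "dominated \<delta> m g f" and 2: "dominated \<delta> m' h f"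
  shows "dominated \<delta> (m + m') (\<lambda>x. g x + h x) f"
proof -
  obtain a where a: "0 \<le> a" "a \<le> m" "\<And>x. \<bar>g x\<bar> \<le> a * \<bar>f x\<bar> + 3 * (m - a) * decay_mean \<delta> f x"
    using 1 unfolding dominated_def by blast
  obtain b where b: "0 \<le> b" "b \<le> m'" "\<And>x. \<bar>h x\<bar> \<le> b * \<bar>f x\<bar> + 3 * (m' - b) * decay_mean \<delta> f x"
    using 2 unfolding dominated_def by blast
  have t: "g \<in> tame \<delta>" "h \<in> tame \<delta>" using 1 2 by (auto simp: dominated_def)
  show ?thesis
  proof (rule dominatedI[OF tame_add[OF t], of "a + b"])
    fix x
    show "\<bar>g x + h x\<bar> \<le> (a + b) * \<bar>f x\<bar> + 3 * (m + m' - (a + b)) * decay_mean \<delta> f x"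
      using abs_triangle_ineq[of "g x" "h x"] a(3)[of x] b(3)[of x] by (simp add: algebra_simps)
    have "decay_mean \<delta> g x \<le> m * decay_mean \<delta> f x" "decay_mean \<delta> h x \<le> m' * decay_mean \<delta> f x"
      using 1 2 by (auto simp: dominated_def)
    then show "decay_mean \<delta> (\<lambda>x. g x + h x) x \<le> (m + m') * decay_mean \<delta> f x"
      using decay_mean_add[OF t, of x] by (simp add: algebra_simps)
  qed (use a b in auto)
qed

lemma dominated_cmult:
  assumes "dominated \<delta> m h f"
  shows "dominated \<delta> (\<bar>c\<bar> * m) (\<lambda>x. c * h x) f"
proof -
  obtain a where a: "0 \<le> a" "a \<le> m" "\<And>x. \<bar>h x\<bar> \<le> a * \<bar>f x\<bar> + 3 * (m - a) * decay_mean \<delta> f x"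
    using assms(1) unfolding dominated_def by blast
  show ?thesis
  proof (rule dominatedI[OF tame_cmult[OF dominated_tame[OF assms]], of "\<bar>c\<bar> * a"])
    fix x
    show "\<bar>c * h x\<bar> \<le> \<bar>c\<bar> * a * \<bar>f x\<bar> + 3 * (\<bar>c\<bar> * m - \<bar>c\<bar> * a) * decay_mean \<delta> f x"
      using mult_left_mono[OF a(3)[of x], of "\<bar>c\<bar>"] by (simp add: abs_mult algebra_simps)
    show "decay_mean \<delta> (\<lambda>x. c * h x) x \<le> \<bar>c\<bar> * m * decay_mean \<delta> f x"
      using assms unfolding decay_mean_cmult mult.assoc dominated_def by (intro mult_left_mono) auto
  qed (use a in \<open>auto intro: mult_left_mono\<close>)
qed

lemma dominated_diff:
  assumes "dominated \<delta> m g f" "dominated \<delta> m' h f"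
  shows "dominated \<delta> (m + m') (\<lambda>x. g x - h x) f"
  using dominated_add[OF assms(1) dominated_cmult[OF assms(2), of "-1"]] by simp

lemma dominated_average:
  assumes k: "kernel m B k" and f: "f \<in> tame \<delta>" and B: "B \<le> 3 * m"
  shows "dominated \<delta> m (average \<delta> k f) f"
proof (rule dominatedI[of _ _ 0])
  fix x
  show "\<bar>average \<delta> k f x\<bar> \<le> 0 * \<bar>f x\<bar> + 3 * (m - 0) * decay_mean \<delta> f x"
    using average_bound[OF k f, of x] mult_right_mono[OF B decay_mean_nonneg[of \<delta> f x]] by simp
qed (use decay_mean_average[OF k f] k in \<open>auto simp: kernel_def\<close>)

text \<open>The Neumann series without a series: from \<open>h = w + A h\<close> and \<open>N (A h) \<le> 3/4 N h\<close> it follows that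
  \<open>N h \<le> 4 N w\<close>, since \<open>N h\<close> is finite.\<close>

lemma dominated_by_residual:
  assumes k: "kernel (3 / 4) 2 k" and h: "h \<in> tame \<delta>" and w: "w = (\<lambda>x. h x - average \<delta> k h x)"
  shows "dominated \<delta> 4 h w"
proof -
  have wt: "w \<in> tame \<delta>" unfolding w by (rule tame_diff[OF h decay_mean_average(1)[OF k h]])
  have h_eq: "h = (\<lambda>x. w x + average \<delta> k h x)" by (simp add: w)
  have mean: "decay_mean \<delta> h x \<le> 4 * decay_mean \<delta> w x" for x
    using decay_mean_add[OF wt decay_mean_average(1)[OF k h], of x]
      decay_mean_average(2)[OF k h, of x] by (simp flip: h_eq)
  show ?thesis
  proof (rule dominatedI[OF h, of 1])
    fix x
    have "\<bar>h x\<bar> \<le> \<bar>w x\<bar> + 2 * decay_mean \<delta> h x"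
      using average_bound[OF k h, of x] unfolding w by linarith
    then have "\<bar>h x\<bar> \<le> \<bar>w x\<bar> + 9 * decay_mean \<delta> w x"
      using mean[of x] decay_mean_nonneg[of \<delta> w x] by linarith
    then show "\<bar>h x\<bar> \<le> 1 * \<bar>w x\<bar> + 3 * (4 - 1) * decay_mean \<delta> w x" by simp
  qed (use mean in auto)
qed

section \<open>Box, ramp and exponential kernels\<close>

definition box_kernel :: "real \<Rightarrow> real" where "box_kernel t = indicator {0..1} t"
definition ramp_kernel :: "real \<Rightarrow> real" where "ramp_kernel t = t * indicator {0..1} t"
definition coramp_kernel :: "real \<Rightarrow> real" where "coramp_kernel t = (1 - t) * indicator {0..1} t"
definition exp_kernel :: "real \<Rightarrow> real" where "exp_kernel t = exp (- t) * indicator {0..} t"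

lemma measurable_kernels [measurable]:
  "box_kernel \<in> borel_measurable borel" "ramp_kernel \<in> borel_measurable borel"
  "coramp_kernel \<in> borel_measurable borel" "exp_kernel \<in> borel_measurable borel"
  unfolding box_kernel_def ramp_kernel_def coramp_kernel_def exp_kernel_def by measurable

text \<open>The moments of the box and the ramp kernel are \<open>2 e^(1/2) - 2\<close> and \<open>4 - 2 e^(1/2)\<close>.\<close>

lemma exp_half_bounds: "13 / 8 \<le> exp (1 / 2 :: real)" "exp (1 / 2 :: real) \<le> 7 / 4"
proof -
  have sq: "(exp (1 / 2 :: real))\<^sup>2 = exp 1" by (simp flip: exp_double)
  have "(13 / 8)\<^sup>2 \<le> exp (1 :: real)" "exp (1 :: real) \<le> (7 / 4)\<^sup>2"
    using e_approx_32 by (auto simp: power2_eq_square abs_if split: if_splits)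
  then show "13 / 8 \<le> exp (1 / 2 :: real)" "exp (1 / 2 :: real) \<le> 7 / 4"
    unfolding sq[symmetric] by (auto intro: power2_le_imp_le)
qed

lemma one_minus_le_exp: "1 - t \<le> exp (- t :: real)"
  using exp_ge_add_one_self[of "- t"] by simp

lemma kernel_on_interval:
  assumes [measurable]: "k \<in> borel_measurable borel" and c: "0 \<le> c"
    and k: "\<And>t. \<bar>k t\<bar> \<le> g t * indicator {0..c} t"
    and g: "\<And>t. 0 \<le> t \<Longrightarrow> t \<le> c \<Longrightarrow> g t \<le> B * exp (- t / 2)"
      "\<And>t. 0 \<le> t \<Longrightarrow> t \<le> c \<Longrightarrow> 0 \<le> g t" "g \<in> borel_measurable borel"
    and F: "\<And>t. (F has_real_derivative g t * exp (t / 2)) (at t)"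
    and m: "F c - F 0 \<le> m" "0 \<le> m" "0 \<le> B"
  shows "kernel m B k"
  unfolding kernel_def
proof (intro conjI allI m(2,3) assms(1))
  note [measurable] = g(3)
  fix t
  show "\<bar>k t\<bar> \<le> B * decay t"
  proof (cases "0 \<le> t \<and> t \<le> c")
    case True
    then show ?thesis using k[of t] g(1)[of t] by (simp add: decay_def)
  next
    case False
    then have "\<bar>k t\<bar> \<le> 0" using k[of t] by (auto simp: indicator_def)
    then show ?thesis using m(3) by (auto intro: order_trans)
  qed
next
  note [measurable] = g(3)
  have "(\<integral>\<^sup>+t. ennreal (\<bar>k t\<bar> * exp (t / 2)) \<partial>lborel)
      \<le> (\<integral>\<^sup>+t. ennreal (g t * exp (t / 2)) * indicator {0..c} t \<partial>lborel)"
  proof (rule nn_integral_mono)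
    fix t
    show "ennreal (\<bar>k t\<bar> * exp (t / 2)) \<le> ennreal (g t * exp (t / 2)) * indicator {0..c} t"
      using k[of t] by (auto simp: indicator_def intro!: ennreal_leI mult_right_mono split: if_splits)
  qed
  also have "\<dots> = ennreal (F c - F 0)"
    using g(2) F by (intro nn_integral_FTC_Icc c) auto
  also have "\<dots> \<le> ennreal m" using m(1) by (rule ennreal_leI)
  finally show "(\<integral>\<^sup>+t. ennreal (\<bar>k t\<bar> * exp (t / 2)) \<partial>lborel) \<le> ennreal m" .
qed

lemma kernel_box: "kernel (3 / 2) 2 box_kernel"
proof (rule kernel_on_interval[where c = 1 and g = "\<lambda>_. 1" and F = "\<lambda>t. 2 * exp (t / 2)"])
  fix t :: real assume "0 \<le> t" "t \<le> 1"
  then have "exp (t / 2) \<le> exp (1 / 2)" by simp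
  then have "exp (t / 2) \<le> 2" using exp_half_bounds by linarith
  then show "1 \<le> 2 * exp (- t / 2)" by (simp add: exp_minus field_simps)
qed (use exp_half_bounds measurable_kernels in
  \<open>auto simp: box_kernel_def indicator_def intro!: derivative_eq_intros\<close>)

lemma kernel_ramp: "kernel (3 / 4) 2 ramp_kernel"
proof (rule kernel_on_interval[where c = 1 and g = "\<lambda>t. t" and F = "\<lambda>t. (2 * t - 4) * exp (t / 2)"])
  fix t :: real assume t: "0 \<le> t" "t \<le> 1"
  then have "exp (t / 2) \<le> exp (1 / 2)" by simp
  then have "exp (t / 2) \<le> 2" using exp_half_bounds by linarith
  then have "t * exp (t / 2) \<le> 1 * 2" using t by (intro mult_mono) auto
  then show "t \<le> 2 * exp (- t / 2)" by (simp add: exp_minus field_simps)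
qed (use exp_half_bounds measurable_kernels in \<open>auto simp: ramp_kernel_def indicator_def algebra_simps intro!: derivative_eq_intros\<close>)

lemma kernel_coramp: "kernel 1 2 coramp_kernel"
proof (rule kernel_on_interval[where c = 1 and g = "\<lambda>t. 1 - t" and F = "\<lambda>t. (6 - 2 * t) * exp (t / 2)"])
  fix t :: real assume t: "0 \<le> t" "t \<le> 1"
  have "1 - t \<le> exp (- t)" by (rule one_minus_le_exp)
  also have "\<dots> \<le> exp (- t / 2)" using t by simp
  also have "\<dots> \<le> 2 * exp (- t / 2)" by simp
  finally show "1 - t \<le> 2 * exp (- t / 2)" .
qed (use exp_half_bounds measurable_kernels in \<open>auto simp: coramp_kernel_def indicator_def algebra_simps intro!: derivative_eq_intros\<close>)

lemma kernel_exp: "kernel 2 1 exp_kernel"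
  unfolding kernel_def
proof (intro conjI allI)
  show "exp_kernel \<in> borel_measurable borel" unfolding exp_kernel_def by measurable
  fix t show "\<bar>exp_kernel t\<bar> \<le> 1 * decay t"
    by (auto simp: exp_kernel_def decay_def indicator_def)
next
  have "(\<integral>\<^sup>+t. ennreal (\<bar>exp_kernel t\<bar> * exp (t / 2)) \<partial>lborel)
      = (\<integral>\<^sup>+t. ennreal (exp (- t / 2)) * indicator {0..} t \<partial>lborel)"
    by (intro nn_integral_cong) (auto simp: exp_kernel_def indicator_def simp flip: exp_add)
  also have "\<dots> = ennreal (0 - (- 2 * exp (- 0 / 2)))"
  proof (rule nn_integral_FTC_atLeast)
    show "((\<lambda>t. - 2 * exp (- t / 2)) \<longlongrightarrow> (0 :: real)) at_top" by real_asymp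
  qed (auto intro!: derivative_eq_intros)
  finally show "(\<integral>\<^sup>+t. ennreal (\<bar>exp_kernel t\<bar> * exp (t / 2)) \<partial>lborel) \<le> ennreal 2" by simp
qed auto

lemma box_convolution:
  "(LINT s|lborel. box_kernel s * box_kernel (t - s)) = max 0 (min 1 t - max 0 (t - 1))"
proof -
  have "(LINT s|lborel. box_kernel s * box_kernel (t - s))
      = (LINT s|lborel. indicator {max 0 (t - 1)..min 1 t} s)"
    by (intro Bochner_Integration.integral_cong) (auto simp: box_kernel_def indicator_def)
  then show ?thesis by (cases "max 0 (t - 1) \<le> min 1 t") auto
qed

text \<open>The kernel of \<open>2 T - T\<^sup>2 = I - (I - T)\<^sup>2\<close>, where \<open>T\<close> is the average with the box kernel. It equals
  \<open>2 - t\<close> on \<open>[0, 1]\<close> and \<open>t - 2\<close> on \<open>(1, 2]\<close>, and is zero elsewhere. Estimating \<open>2 T\<close> and \<open>T\<^sup>2\<close> separately would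
  miss the cancellation.\<close>

definition square_kernel :: "real \<Rightarrow> real" where
  "square_kernel t = 2 * box_kernel t - max 0 (min 1 t - max 0 (t - 1))"

lemma kernel_square: "kernel 3 2 square_kernel"
proof (rule kernel_on_interval[where c = 2 and g = "\<lambda>t. 2 - t" and F = "\<lambda>t. (8 - 2 * t) * exp (t / 2)"])
  show "square_kernel \<in> borel_measurable borel"
    unfolding square_kernel_def box_kernel_def by measurable
  fix t :: real
  show "\<bar>square_kernel t\<bar> \<le> (2 - t) * indicator {0..2} t"
    by (auto simp: square_kernel_def box_kernel_def indicator_def max_def min_def)
  show "2 - t \<le> 2 * exp (- t / 2)" using one_minus_le_exp[of "t / 2"] by simp
  have "exp (1 :: real) \<le> 11 / 4" using e_approx_32 by (auto simp: abs_if split: if_splits)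
  then show "(8 - 2 * 2) * exp (2 / 2) - (8 - 2 * 0) * exp (0 / 2) \<le> (3 :: real)" by simp
qed (auto simp: algebra_simps intro!: derivative_eq_intros)

text \<open>With \<open>K\<close>, \<open>E\<close> and \<open>T\<close> for the averages with the ramp, exponential and box kernels, this is
  \<open>K E = E + K - T\<close>, which is \<open>I - T = (I - K) (I - E)\<close> expanded.\<close>

lemma ramp_exp_convolution:
  "(LINT s|lborel. ramp_kernel s * exp_kernel (t - s)) = exp_kernel t + ramp_kernel t - box_kernel t"
proof (cases "0 \<le> t")
  case False
  then have "ramp_kernel s * exp_kernel (t - s) = 0" for s
    by (auto simp: ramp_kernel_def exp_kernel_def indicator_def)
  then have "(LINT s|lborel. ramp_kernel s * exp_kernel (t - s)) = 0" by (simp only: integral_zero)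
  then show ?thesis using False by (simp add: exp_kernel_def ramp_kernel_def box_kernel_def)
next
  case True
  have "(LINT s|lborel. ramp_kernel s * exp_kernel (t - s))
      = (LINT s|lborel. s * exp (s - t) * indicator {0..min 1 t} s)"
    by (intro Bochner_Integration.integral_cong)
       (auto simp: ramp_kernel_def exp_kernel_def indicator_def)
  also have "\<dots> = (min 1 t - 1) * exp (min 1 t - t) - (0 - 1) * exp (0 - t)"
    by (rule integral_FTC_Icc_real)
       (use True in \<open>auto simp: algebra_simps intro!: derivative_eq_intros\<close>)
  also have "\<dots> = exp_kernel t + ramp_kernel t - box_kernel t"
    using True by (auto simp: exp_kernel_def ramp_kernel_def box_kernel_def indicator_def min_def)
  finally show ?thesis .
qed

definition residual :: "real \<Rightarrow> (real \<Rightarrow> real) \<Rightarrow> (real \<Rightarrow> real) \<Rightarrow> real \<Rightarrow> real" where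
  "residual \<delta> k f x = f x - average \<delta> k f x"

lemma residual_eq: "residual \<delta> k f = (\<lambda>x. f x - average \<delta> k f x)"
  by (simp add: residual_def fun_eq_iff)

lemma average_residual:
  assumes "kernel m B k" "kernel m' B' l" "f \<in> tame \<delta>"
  shows "average \<delta> l (residual \<delta> k f) = (\<lambda>x. average \<delta> l f x - average \<delta> l (average \<delta> k f) x)"
  unfolding residual_eq by (rule average_diff[OF assms(2,3) decay_mean_average(1)[OF assms(1,3)]])

lemma residual_tame: "kernel m B k \<Longrightarrow> f \<in> tame \<delta> \<Longrightarrow> residual \<delta> k f \<in> tame \<delta>"
  unfolding residual_def by (intro tame_diff decay_mean_average(1))

lemma residual_add:
  assumes "kernel m B k" "f \<in> tame \<delta>" "g \<in> tame \<delta>"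
  shows "residual \<delta> k (\<lambda>x. f x + g x) = (\<lambda>x. residual \<delta> k f x + residual \<delta> k g x)"
  using average_add[OF assms] by (simp add: residual_def fun_eq_iff)

lemma residual_diff:
  assumes "kernel m B k" "f \<in> tame \<delta>" "g \<in> tame \<delta>"
  shows "residual \<delta> k (\<lambda>x. f x - g x) = (\<lambda>x. residual \<delta> k f x - residual \<delta> k g x)"
  using average_diff[OF assms] by (simp add: residual_def fun_eq_iff)

lemma residual_average:
  assumes "kernel m B k" "kernel m' B' l" "f \<in> tame \<delta>"
  shows "residual \<delta> k (average \<delta> l f) = average \<delta> l (residual \<delta> k f)"
proof -
  have "residual \<delta> k (average \<delta> l f)
      = (\<lambda>x. average \<delta> l f x - average \<delta> l (average \<delta> k f) x)"
    unfolding residual_eq average_commute[OF assms] ..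
  then show ?thesis by (simp only: average_residual[OF assms])
qed

lemma residual_commute:
  assumes "kernel m B k" "kernel m' B' l" "f \<in> tame \<delta>"
  shows "residual \<delta> k (residual \<delta> l f) = residual \<delta> l (residual \<delta> k f)"
  unfolding residual_eq[of \<delta> l]
    residual_diff[OF assms(1,3) decay_mean_average(1)[OF assms(2,3)]] residual_average[OF assms] ..

lemma dominated_residual:
  assumes "kernel m B k" "f \<in> tame \<delta>" "B \<le> 3 * m"
  shows "dominated \<delta> (1 + m) (residual \<delta> k f) f"
  unfolding residual_def using assms by (intro dominated_diff dominated_refl dominated_average)

text \<open>The Fourier symbols of \<open>I - T\<close> and \<open>I - E\<close> vanish to the same order at the origin, so their quotient is
  regular there. The rate \<open>1\<close> of the exponential kernel makes this quotient as simple as possible: it is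
  \<open>1\<close> minus the symbol of a kernel of mass \<open>1/2\<close>.\<close>

lemma box_residual_factor:
  assumes f: "f \<in> tame \<delta>"
  shows "residual \<delta> box_kernel f = residual \<delta> ramp_kernel (residual \<delta> exp_kernel f)"
proof
  fix x
  have "average \<delta> ramp_kernel (average \<delta> exp_kernel f) x
      = (LINT t|lborel. exp_kernel t * f (x + \<delta> * t) + ramp_kernel t * f (x + \<delta> * t)
           - box_kernel t * f (x + \<delta> * t))"
    unfolding average_average_eq[OF kernel_ramp kernel_exp f] ramp_exp_convolution
    by (simp add: algebra_simps)
  also have "\<dots> = average \<delta> exp_kernel f x + average \<delta> ramp_kernel f x - average \<delta> box_kernel f x"
    unfolding average_def
    using kernel_integrable[OF kernel_exp f] kernel_integrable[OF kernel_ramp f]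
      kernel_integrable[OF kernel_box f] by simp
  finally show "residual \<delta> box_kernel f x = residual \<delta> ramp_kernel (residual \<delta> exp_kernel f) x"
    unfolding residual_def[of _ _ "residual _ _ _"] average_residual[OF kernel_exp kernel_ramp f]
    by (simp add: residual_def)
qed

lemma dominated_box_residual: "f \<in> tame \<delta> \<Longrightarrow> dominated \<delta> (5 / 2) (residual \<delta> box_kernel f) f"
  using dominated_residual[OF kernel_box] by simp

lemma dominated_box_residual_twice:
  assumes f: "f \<in> tame \<delta>"
  shows "dominated \<delta> 4 (residual \<delta> box_kernel (residual \<delta> box_kernel f)) f"
proof -
  have "residual \<delta> box_kernel (residual \<delta> box_kernel f) = residual \<delta> square_kernel f"
  proof
    fix x
    have "average \<delta> square_kernel f x = (LINT t|lborel. 2 * (box_kernel t * f (x + \<delta> * t))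
        - max 0 (min 1 t - max 0 (t - 1)) * f (x + \<delta> * t))"
      unfolding average_def square_kernel_def by (simp add: algebra_simps)
    also have "\<dots> = 2 * average \<delta> box_kernel f x - average \<delta> box_kernel (average \<delta> box_kernel f) x"
    proof -
      have "integrable lborel (\<lambda>t. 2 * (box_kernel t * f (x + \<delta> * t)) - square_kernel t * f (x + \<delta> * t))"
        using kernel_integrable[OF kernel_box f] kernel_integrable[OF kernel_square f] by auto
      then have "integrable lborel (\<lambda>t. max 0 (min 1 t - max 0 (t - 1)) * f (x + \<delta> * t))"
        by (simp add: square_kernel_def algebra_simps)
      then show ?thesis
        unfolding average_average_eq[OF kernel_box kernel_box f] box_convolution
        using kernel_integrable[OF kernel_box f, of x] by (simp add: average_def)
    qed
    finally show "residual \<delta> box_kernel (residual \<delta> box_kernel f) x = residual \<delta> square_kernel f x"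
      unfolding residual_def[of _ _ "residual _ _ _"] average_residual[OF kernel_box kernel_box f]
      by (simp add: residual_def)
  qed
  then show ?thesis using dominated_residual[OF kernel_square f] by simp
qed

lemma residual_power_tame: "f \<in> tame \<delta> \<Longrightarrow> kernel m B k \<Longrightarrow> (residual \<delta> k ^^ n) f \<in> tame \<delta>"
  by (induction n) (auto intro: residual_tame)

text \<open>Differences are taken two at a time: \<open>(I - T)\<^sup>2\<close> has moment below \<open>4\<close>, while \<open>I - T\<close> alone has moment
  above \<open>2\<close>, and its powers would not give \<open>2^r\<close>.\<close>

lemma dominated_box_residual_power:
  assumes f: "f \<in> tame \<delta>"
  shows "dominated \<delta> (5 / 4 * 2 ^ r) ((residual \<delta> box_kernel ^^ r) f) f"
proof -
  have even: "dominated \<delta> (4 ^ n) ((residual \<delta> box_kernel ^^ (2 * n)) f) f" for n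
  proof (induction n)
    case 0
    then show ?case using dominated_refl[OF f] by simp
  next
    case (Suc n)
    then show ?case
      using dominated_trans[OF dominated_box_residual_twice Suc]
        residual_power_tame[OF f kernel_box, of "2 * n"] by simp
  qed
  show ?thesis
  proof (cases "even r")
    case True
    then obtain n where "r = 2 * n" by blast
    then show ?thesis using dominated_mono[OF even[of n]] by (simp add: power_mult)
  next
    case False
    then obtain n where r: "r = 2 * n + 1" by (rule oddE)
    show ?thesis
      using dominated_trans[OF dominated_box_residual even[of n]]
        residual_power_tame[OF f kernel_box, of "2 * n"] by (simp add: r power_mult)
  qed
qed

lemma dominated_coramp_power:
  assumes f: "f \<in> tame \<delta>"
  shows "dominated \<delta> 1 ((average \<delta> coramp_kernel ^^ r) f) f"
proof (induction r)
  case (Suc r)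
  then show ?case
    using dominated_trans[OF dominated_average[OF kernel_coramp] Suc] dominated_tame[OF Suc] by simp
qed (simp add: dominated_refl[OF f])

text \<open>The average with the ramp kernel commutes with the exponential average, hence \<open>(I - T)^r\<close> is
  \<open>(I - K)^r (I - E)^r\<close>, and each factor \<open>I - K\<close> is inverted at the cost of a factor \<open>4\<close>.\<close>

lemma exp_residual_dominated:
  assumes f: "f \<in> tame \<delta>"
  shows "dominated \<delta> (4 ^ r) ((residual \<delta> exp_kernel ^^ r) f) ((residual \<delta> box_kernel ^^ r) f)"
proof -
  let ?D = "residual \<delta> exp_kernel" and ?R = "residual \<delta> ramp_kernel"
  have Rt: "(?R ^^ n) g \<in> tame \<delta>" if "g \<in> tame \<delta>" for n g
    using that kernel_ramp by (rule residual_power_tame)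
  have Dt: "(?D ^^ n) g \<in> tame \<delta>" if "g \<in> tame \<delta>" for n g
    using that kernel_exp by (rule residual_power_tame)
  have comm: "?D ((?R ^^ n) g) = (?R ^^ n) (?D g)" if "g \<in> tame \<delta>" for n g
    using that
  proof (induction n)
    case (Suc n)
    then show ?case using residual_commute[OF kernel_exp kernel_ramp Rt[OF Suc.prems, of n]] by simp
  qed simp
  have factor: "(residual \<delta> box_kernel ^^ n) f = (?R ^^ n) ((?D ^^ n) f)" for n
  proof (induction n)
    case (Suc n)
    then show ?case using box_residual_factor[OF Rt[OF Dt[OF f]]] comm[OF Dt[OF f]] by simp
  qed simp
  have "dominated \<delta> (4 ^ n) h ((?R ^^ n) h)" if "h \<in> tame \<delta>" for n h
  proof (induction n)
    case 0
    then show ?case using dominated_refl[OF that] by simp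
  next
    case (Suc n)
    have "dominated \<delta> 4 ((?R ^^ n) h) ((?R ^^ Suc n) h)"
      by (rule dominated_by_residual[OF kernel_ramp Rt[OF that]]) (simp add: residual_def fun_eq_iff)
    then show ?case using dominated_trans[OF Suc] by (simp add: mult.commute)
  qed
  then show ?thesis using factor Dt[OF f] by simp
qed

section \<open>Splitting off powers of the exponential average\<close>

text \<open>Only commutation with \<open>E\<close> and \<open>I - E\<close> is recorded: it lets \<open>(I - E)^r\<close> pass to the argument.\<close>

definition multiplier :: "real \<Rightarrow> real \<Rightarrow> ((real \<Rightarrow> real) \<Rightarrow> real \<Rightarrow> real) \<Rightarrow> bool" where
  "multiplier \<delta> m A \<longleftrightarrow> (\<forall>f \<in> tame \<delta>. dominated \<delta> m (A f) f \<and>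
     A (average \<delta> exp_kernel f) = average \<delta> exp_kernel (A f) \<and>
     A (residual \<delta> exp_kernel f) = residual \<delta> exp_kernel (A f))"

lemma multiplier_add:
  assumes "multiplier \<delta> m A" "multiplier \<delta> m' B"
  shows "multiplier \<delta> (m + m') (\<lambda>f x. A f x + B f x)"
  unfolding multiplier_def
proof (intro ballI conjI)
  fix f assume f: "f \<in> tame \<delta>"
  then have d: "dominated \<delta> m (A f) f" "dominated \<delta> m' (B f) f"
    using assms unfolding multiplier_def by auto
  show "dominated \<delta> (m + m') (\<lambda>x. A f x + B f x) f" using d by (rule dominated_add)
  show "(\<lambda>x. A (average \<delta> exp_kernel f) x + B (average \<delta> exp_kernel f) x)
      = average \<delta> exp_kernel (\<lambda>x. A f x + B f x)"
    "(\<lambda>x. A (residual \<delta> exp_kernel f) x + B (residual \<delta> exp_kernel f) x)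
      = residual \<delta> exp_kernel (\<lambda>x. A f x + B f x)"
    unfolding average_add[OF kernel_exp d[THEN dominated_tame]]
      residual_add[OF kernel_exp d[THEN dominated_tame]]
    using assms f unfolding multiplier_def by auto
qed

lemma multiplier_compose:
  assumes A: "multiplier \<delta> m A" and B: "multiplier \<delta> m' B"
  shows "multiplier \<delta> (m * m') (\<lambda>f. A (B f))"
  unfolding multiplier_def
proof (intro ballI conjI)
  fix f assume f: "f \<in> tame \<delta>"
  then have Bf: "B f \<in> tame \<delta>" using B dominated_tame unfolding multiplier_def by blast
  show "dominated \<delta> (m * m') (A (B f)) f"
    using A B f Bf unfolding multiplier_def by (blast intro: dominated_trans)
  show "A (B (average \<delta> exp_kernel f)) = average \<delta> exp_kernel (A (B f))"
    "A (B (residual \<delta> exp_kernel f)) = residual \<delta> exp_kernel (A (B f))"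
    using A B f Bf unfolding multiplier_def by auto
qed

lemma multiplier_exp: "multiplier \<delta> 2 (average \<delta> exp_kernel)"
  using residual_average[OF kernel_exp kernel_exp] dominated_average[OF kernel_exp]
  unfolding multiplier_def by auto

lemma multiplier_exp_residual: "multiplier \<delta> 3 (residual \<delta> exp_kernel)"
  using residual_average[OF kernel_exp kernel_exp] dominated_residual[OF kernel_exp]
  unfolding multiplier_def by auto

lemma multiplier_mono: "multiplier \<delta> m A \<Longrightarrow> m \<le> m' \<Longrightarrow> multiplier \<delta> m' A"
  unfolding multiplier_def by (blast intro: dominated_mono)

lemma multiplier_id: "1 \<le> m \<Longrightarrow> multiplier \<delta> m (\<lambda>f. f)"
  unfolding multiplier_def by (auto intro: dominated_mono dominated_refl)

lemma zero_tame: "(\<lambda>x. 0) \<in> tame \<delta>"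
  by (simp add: tame_def)

lemma multiplier_zero: "0 \<le> m \<Longrightarrow> multiplier \<delta> m (\<lambda>f x. 0)"
  unfolding multiplier_def residual_def average_def
  by (auto intro!: dominatedI[of _ _ 0] zero_tame simp: decay_mean_def[of _ "\<lambda>_. 0"])

lemma multiplier_power_add:
  assumes A: "multiplier \<delta> m A" and f: "f \<in> tame \<delta>" "g \<in> tame \<delta>"
    and add: "\<And>f g. f \<in> tame \<delta> \<Longrightarrow> g \<in> tame \<delta> \<Longrightarrow> A (\<lambda>x. f x + g x) = (\<lambda>x. A f x + A g x)"
  shows "(A ^^ n) f \<in> tame \<delta>"
    and "(A ^^ n) (\<lambda>x. f x + g x) = (\<lambda>x. (A ^^ n) f x + (A ^^ n) g x)"
proof -
  have t: "(A ^^ n) h \<in> tame \<delta>" if "h \<in> tame \<delta>" for h n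
    using that A by (induction n) (auto simp: multiplier_def dest: dominated_tame)
  show "(A ^^ n) f \<in> tame \<delta>" using t f by blast
  show "(A ^^ n) (\<lambda>x. f x + g x) = (\<lambda>x. (A ^^ n) f x + (A ^^ n) g x)"
    by (induction n) (auto simp: add[OF t[OF f(1)] t[OF f(2)]])
qed

lemma multiplier_commute_powers:
  assumes A: "multiplier \<delta> m A" and f: "f \<in> tame \<delta>"
  shows "A ((average \<delta> exp_kernel ^^ n) f) = (average \<delta> exp_kernel ^^ n) (A f)"
    and "A ((residual \<delta> exp_kernel ^^ n) f) = (residual \<delta> exp_kernel ^^ n) (A f)"
proof -
  have t: "(average \<delta> exp_kernel ^^ n) f \<in> tame \<delta>" "(residual \<delta> exp_kernel ^^ n) f \<in> tame \<delta>" for n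
    using decay_mean_average(1)[OF kernel_exp] residual_tame[OF kernel_exp] f
    by (induction n) auto
  show "A ((average \<delta> exp_kernel ^^ n) f) = (average \<delta> exp_kernel ^^ n) (A f)"
    using A t by (induction n) (auto simp: multiplier_def)
  show "A ((residual \<delta> exp_kernel ^^ n) f) = (residual \<delta> exp_kernel ^^ n) (A f)"
    using A t by (induction n) (auto simp: multiplier_def)
qed

text \<open>Apply the splitting for \<open>(a - 1, b)\<close> to \<open>E f\<close> and the one for \<open>(a, b - 1)\<close> to \<open>(I - E) f\<close>, and add. As \<open>E\<close>
  and \<open>I - E\<close> have moments \<open>2\<close> and \<open>3\<close>, both \<open>G\<close> and \<open>H\<close> gain at most a factor \<open>4\<close> in each step.\<close>

lemma exp_splitting:
  obtains G H where "multiplier \<delta> (4 ^ (a + b)) G" "multiplier \<delta> (4 ^ (a + b)) H"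
    "\<And>f. f \<in> tame \<delta> \<Longrightarrow>
      f = (\<lambda>x. (average \<delta> exp_kernel ^^ a) (G f) x + (residual \<delta> exp_kernel ^^ b) (H f) x)"
proof -
  let ?E = "average \<delta> exp_kernel" and ?D = "residual \<delta> exp_kernel"
  note mE = multiplier_exp[of \<delta>] and mD = multiplier_exp_residual[of \<delta>]
  note E_add = average_add[OF kernel_exp] and D_add = residual_add[OF kernel_exp]
  have zero: "(?E ^^ n) (\<lambda>x. 0) = (\<lambda>x. 0)" "(?D ^^ n) (\<lambda>x. 0) = (\<lambda>x. 0)" for n
    by (induction n) (auto simp: residual_def average_def)
  have "\<exists>G H. multiplier \<delta> (4 ^ (a + b)) G \<and> multiplier \<delta> (4 ^ (a + b)) H \<and>
    (\<forall>f\<in>tame \<delta>. f = (\<lambda>x. (?E ^^ a) (G f) x + (?D ^^ b) (H f) x))"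
  proof (induction "a + b" arbitrary: a b)
    case 0
    then show ?case
      by (intro exI[of _ "\<lambda>f. f"] exI[of _ "\<lambda>f x. 0"]) (auto intro: multiplier_id multiplier_zero)
  next
    case (Suc n)
    consider "a = 0" | "b = 0" | a' b' where "a = Suc a'" "b = Suc b'"
      by (metis not0_implies_Suc)
    then show ?case
    proof cases
      case 1
      then show ?thesis
        by (intro exI[of _ "\<lambda>f. f"] exI[of _ "\<lambda>f x. 0"]) (auto intro: multiplier_id multiplier_zero simp: zero)
    next
      case 2
      then show ?thesis
        by (intro exI[of _ "\<lambda>f x. 0"] exI[of _ "\<lambda>f. f"]) (auto intro: multiplier_id multiplier_zero simp: zero)
    next
      case 3
      have n: "n = a' + b" "n = a + b'" using Suc.hyps(2) 3 by auto
      obtain G1 H1 where 1: "multiplier \<delta> (4 ^ n) G1" "multiplier \<delta> (4 ^ n) H1"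
        "\<And>f. f \<in> tame \<delta> \<Longrightarrow> f = (\<lambda>x. (?E ^^ a') (G1 f) x + (?D ^^ b) (H1 f) x)"
        using Suc.hyps(1)[OF n(1)] n(1) by auto
      obtain G2 H2 where 2: "multiplier \<delta> (4 ^ n) G2" "multiplier \<delta> (4 ^ n) H2"
        "\<And>f. f \<in> tame \<delta> \<Longrightarrow> f = (\<lambda>x. (?E ^^ a) (G2 f) x + (?D ^^ b') (H2 f) x)"
        using Suc.hyps(1)[OF n(2)] n(2) by auto
      have G: "multiplier \<delta> (4 ^ (a + b)) (\<lambda>f x. G1 f x + ?D (G2 f) x)"
        by (rule multiplier_mono[OF multiplier_add[OF 1(1) multiplier_compose[OF mD 2(1)]]])
           (simp flip: Suc.hyps(2))
      have H: "multiplier \<delta> (4 ^ (a + b)) (\<lambda>f x. ?E (H1 f) x + H2 f x)"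
        by (rule multiplier_mono[OF multiplier_add[OF multiplier_compose[OF mE 1(2)] 2(2)]])
           (simp flip: Suc.hyps(2))
      have "f = (\<lambda>x. (?E ^^ a) (\<lambda>x. G1 f x + ?D (G2 f) x) x + (?D ^^ b) (\<lambda>x. ?E (H1 f) x + H2 f x) x)"
        if f: "f \<in> tame \<delta>" for f
      proof -
        have t: "G1 f \<in> tame \<delta>" "H1 f \<in> tame \<delta>" "G2 f \<in> tame \<delta>" "H2 f \<in> tame \<delta>"
          using 1 2 f unfolding multiplier_def by (blast dest: dominated_tame)+
        have EP: "(?E ^^ k) g \<in> tame \<delta>" if "g \<in> tame \<delta>" for g k
          using multiplier_power_add(1)[OF mE that that E_add] .
        have DP: "(?D ^^ k) g \<in> tame \<delta>" if "g \<in> tame \<delta>" for g k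
          using multiplier_power_add(1)[OF mD that that D_add] .
        have Et: "?E g \<in> tame \<delta>" "?D g \<in> tame \<delta>" if "g \<in> tame \<delta>" for g
          using EP[OF that, of 1] DP[OF that, of 1] by simp_all
        have "?E f = ?E (\<lambda>x. (?E ^^ a') (G1 f) x + (?D ^^ b) (H1 f) x)"
          using 1(3)[OF f] by simp
        also have "\<dots> = (\<lambda>x. (?E ^^ a) (G1 f) x + (?D ^^ b) (?E (H1 f)) x)"
          unfolding E_add[OF EP[OF t(1)] DP[OF t(2)]]
            multiplier_commute_powers(2)[OF mE t(2)] 3(1) by simp
        finally have Ef: "?E f = (\<lambda>x. (?E ^^ a) (G1 f) x + (?D ^^ b) (?E (H1 f)) x)" .
        have "?D f = ?D (\<lambda>x. (?E ^^ a) (G2 f) x + (?D ^^ b') (H2 f) x)"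
          using 2(3)[OF f] by simp
        also have "\<dots> = (\<lambda>x. (?E ^^ a) (?D (G2 f)) x + (?D ^^ b) (H2 f) x)"
          unfolding D_add[OF EP[OF t(3)] DP[OF t(4)]]
            multiplier_commute_powers(1)[OF mD t(3)] 3(2) by simp
        finally have Df: "?D f = (\<lambda>x. (?E ^^ a) (?D (G2 f)) x + (?D ^^ b) (H2 f) x)" .
        have "f = (\<lambda>x. ?E f x + ?D f x)" by (simp add: residual_def)
        moreover have "(?E ^^ a) (\<lambda>x. G1 f x + ?D (G2 f) x)
            = (\<lambda>x. (?E ^^ a) (G1 f) x + (?E ^^ a) (?D (G2 f)) x)"
          by (rule multiplier_power_add(2)[OF mE t(1) Et(2)[OF t(3)] E_add])
        moreover have "(?D ^^ b) (\<lambda>x. ?E (H1 f) x + H2 f x)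
            = (\<lambda>x. (?D ^^ b) (?E (H1 f)) x + (?D ^^ b) (H2 f) x)"
          by (rule multiplier_power_add(2)[OF mD Et(1)[OF t(2)] t(4) D_add])
        ultimately show ?thesis by (simp add: Ef Df fun_eq_iff)
      qed
      then show ?thesis using G H by blast
    qed
  qed
  then show thesis using that by blast
qed

section \<open>Boundedness on variable exponent spaces\<close>

text \<open>Linearises a power of \<open>u\<close> at the level \<open>U\<close>. In contrast to Jensen's inequality the exponent may
  depend on the point, and only \<open>U\<close> is raised to that exponent, so that a bound for the average of \<open>u\<close> is
  enough to change exponents.\<close>

lemma powr_le_weighted:
  fixes u U a :: real
  assumes "0 \<le> u" "0 < U" "0 < a" "a \<le> 1"
  shows "u powr a \<le> (u / U + 1) * U powr a"
proof (cases "u \<le> U")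
  case True
  then have "u powr a \<le> U powr a" using assms by (intro powr_mono2) auto
  also have "\<dots> \<le> (u / U + 1) * U powr a" using assms by (simp add: distrib_right)
  finally show ?thesis .
next
  case False
  then have u: "0 < u" using assms by simp
  have "u powr a = u * u powr (a - 1)" using u by (simp add: powr_diff)
  also have "\<dots> \<le> u * U powr (a - 1)"
    using assms False u by (intro mult_left_mono powr_mono2') auto
  also have "\<dots> = u / U * U powr a" using assms by (simp add: powr_diff)
  also have "\<dots> \<le> (u / U + 1) * U powr a" using assms by (simp add: distrib_right)
  finally show ?thesis .
qed

text \<open>Jensen's inequality up to a factor \<open>2\<close>, by \<open>powr_le_weighted\<close> at the level of the mean.\<close>

lemma weak_Jensen:
  fixes w v :: "real \<Rightarrow> real"
  assumes [measurable]: "w \<in> borel_measurable borel" "v \<in> borel_measurable borel"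
    and nonneg: "\<And>s. 0 \<le> w s" "\<And>s. 0 \<le> v s" and P: "1 \<le> P"
    and w1: "(\<integral>\<^sup>+s. ennreal (w s) \<partial>lborel) \<le> 1"
    and W: "(\<integral>\<^sup>+s. ennreal (w s * v s) \<partial>lborel) \<le> ennreal W" "0 \<le> W"
  shows "(\<integral>\<^sup>+s. ennreal (w s * v s powr (1 / P)) \<partial>lborel) \<le> ennreal (2 * W powr (1 / P))"
proof (cases "W = 0")
  case True
  then have "(\<integral>\<^sup>+s. ennreal (w s * v s) \<partial>lborel) = 0" using W by simp
  then have "AE s in lborel. ennreal (w s * v s) = 0"
    by (subst (asm) nn_integral_0_iff_AE) auto
  then have "AE s in lborel. ennreal (w s * v s powr (1 / P)) = 0"
    by eventually_elim (use nonneg in \<open>auto simp: ennreal_eq_0_iff mult_le_0_iff order_antisym_conv\<close>)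
  then have "(\<integral>\<^sup>+s. ennreal (w s * v s powr (1 / P)) \<partial>lborel) = 0"
    by (subst nn_integral_0_iff_AE) auto
  then show ?thesis by simp
next
  case False
  then have W0: "0 < W" using W by simp
  have "(\<integral>\<^sup>+s. ennreal (w s * v s powr (1 / P)) \<partial>lborel)
      \<le> (\<integral>\<^sup>+s. ennreal (W powr (1 / P) / W) * ennreal (w s * v s)
            + ennreal (W powr (1 / P)) * ennreal (w s) \<partial>lborel)"
  proof (rule nn_integral_mono)
    fix s
    have "w s * v s powr (1 / P) \<le> w s * ((v s / W + 1) * W powr (1 / P))"
      using nonneg W0 P by (intro mult_left_mono powr_le_weighted) auto
    then show "ennreal (w s * v s powr (1 / P)) \<le> ennreal (W powr (1 / P) / W) * ennreal (w s * v s)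
            + ennreal (W powr (1 / P)) * ennreal (w s)"
      using nonneg W0 by (simp add: algebra_simps flip: ennreal_mult ennreal_plus)
  qed
  also have "\<dots> = ennreal (W powr (1 / P) / W) * (\<integral>\<^sup>+s. ennreal (w s * v s) \<partial>lborel)
      + ennreal (W powr (1 / P)) * (\<integral>\<^sup>+s. ennreal (w s) \<partial>lborel)"
    by (simp add: nn_integral_add nn_integral_cmult)
  also have "\<dots> \<le> ennreal (W powr (1 / P) / W) * ennreal W + ennreal (W powr (1 / P)) * 1"
    using W w1 by (intro add_mono mult_left_mono) auto
  also have "\<dots> = ennreal (2 * W powr (1 / P))"
    using W0 by (simp flip: ennreal_mult ennreal_plus)
  finally show ?thesis .
qed

text \<open>The error term for small values of a function, caused by the decay condition at infinity. It is
  integrable because of the exponent \<open>2\<close>.\<close>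

definition tail :: "real \<Rightarrow> real" where
  "tail x = 1 / (exp 1 + \<bar>x\<bar>)\<^sup>2"

lemma tail_pos: "0 < tail x"
proof -
  have "0 < exp 1 + \<bar>x\<bar>" by (simp add: add_pos_nonneg)
  then show ?thesis by (simp add: tail_def)
qed

lemma tail_simps [simp]: "0 \<le> tail x" "\<bar>tail x\<bar> = tail x"
  using tail_pos[of x] by auto

lemma tail_measurable [measurable]: "tail \<in> borel_measurable borel"
  unfolding tail_def by measurable

lemma tail_le_1: "tail x \<le> 1"
proof -
  have "1 \<le> exp 1 + \<bar>x\<bar>" using exp_ge_add_one_self[of 1] by linarith
  then show ?thesis unfolding tail_def by (simp add: one_le_power)
qed

lemma nn_integral_tail: "(\<integral>\<^sup>+x. ennreal (tail x) \<partial>lborel) \<le> 1"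
proof -
  have half: "(\<integral>\<^sup>+x. ennreal (tail x) * indicator {0..} x \<partial>lborel) = ennreal (1 / exp 1)"
  proof -
    have "(\<integral>\<^sup>+x. ennreal (tail x) * indicator {0..} x \<partial>lborel) = ennreal (0 - (- 1 / (exp 1 + 0)))"
    proof (rule nn_integral_FTC_atLeast)
      fix x :: real assume "0 \<le> x"
      then have "0 < exp 1 + x" by (simp add: add_pos_nonneg)
      then show "((\<lambda>x. - 1 / (exp 1 + x)) has_real_derivative tail x) (at x)"
        using \<open>0 \<le> x\<close> unfolding tail_def
        by (auto intro!: derivative_eq_intros simp: power2_eq_square)
      show "0 \<le> tail x" using tail_pos less_imp_le by blast
    next
      show "((\<lambda>x :: real. - 1 / (exp 1 + x)) \<longlongrightarrow> 0) at_top" by real_asymp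
    qed auto
    then show ?thesis by simp
  qed
  have "(\<integral>\<^sup>+x. ennreal (tail x) * indicator {..0} x \<partial>lborel)
      = (\<integral>\<^sup>+x. ennreal (tail x) * indicator {0..} x \<partial>lborel)"
    by (subst nn_integral_real_affine[where c = "-1" and t = 0])
       (auto simp: tail_def indicator_def intro!: nn_integral_cong)
  moreover have "(\<integral>\<^sup>+x. ennreal (tail x) \<partial>lborel)
      \<le> (\<integral>\<^sup>+x. ennreal (tail x) * indicator {0..} x + ennreal (tail x) * indicator {..0} x \<partial>lborel)"
    by (intro nn_integral_mono) (auto simp: indicator_def)
  ultimately have "(\<integral>\<^sup>+x. ennreal (tail x) \<partial>lborel) \<le> ennreal (1 / exp 1) + ennreal (1 / exp 1)"
    using half by (simp add: nn_integral_add)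
  also have "\<dots> = ennreal (2 / exp 1)" by (simp flip: ennreal_plus)
  also have "\<dots> \<le> 1" using exp_ge_add_one_self[of 1] by (simp add: ennreal_le_1)
  finally show ?thesis .
qed

lemma nn_integral_decay_upper: "0 \<le> t \<Longrightarrow>
  (\<integral>\<^sup>+s. ennreal (exp (- s / 2) / 2) * indicator {t..} s \<partial>lborel) = ennreal (exp (- t / 2))"
proof -
  assume "0 \<le> t"
  have "(\<integral>\<^sup>+s. ennreal (exp (- s / 2) / 2) * indicator {t..} s \<partial>lborel)
      = ennreal (0 - (- exp (- t / 2)))"
  proof (rule nn_integral_FTC_atLeast)
    show "((\<lambda>s. - exp (- s / 2)) \<longlongrightarrow> (0 :: real)) at_top" by real_asymp
  qed (auto intro!: derivative_eq_intros)
  then show ?thesis by simp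
qed

lemma nn_integral_decay: "(\<integral>\<^sup>+t. ennreal (decay t) \<partial>lborel) = 2"
proof -
  have "(\<integral>\<^sup>+t. ennreal (decay t) \<partial>lborel)
      = (\<integral>\<^sup>+s. 2 * (ennreal (exp (- s / 2) / 2) * indicator {0..} s) \<partial>lborel)"
    by (intro nn_integral_cong) (auto simp: decay_def indicator_def ennreal_mult'[symmetric] numeral_mult_ennreal)
  also have "\<dots> = 2 * ennreal (exp (- 0 / 2))"
    using nn_integral_decay_upper[of 0] by (subst nn_integral_cmult) auto
  finally show ?thesis by simp
qed

lemma nn_integral_moment: "(\<integral>\<^sup>+s. ennreal (s * decay s / 4) \<partial>lborel) \<le> 1"
proof -
  have "(\<integral>\<^sup>+s. ennreal (s * decay s / 4) \<partial>lborel)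
      = (\<integral>\<^sup>+s. ennreal (s * exp (- s / 2) / 4) * indicator {0..} s \<partial>lborel)"
    by (intro nn_integral_cong) (auto simp: decay_def indicator_def)
  also have "\<dots> = ennreal (0 - (- (0 + 2) * exp (- 0 / 2) / 2))"
  proof (rule nn_integral_FTC_atLeast)
    show "((\<lambda>s. - (s + 2) * exp (- s / 2) / 2) \<longlongrightarrow> (0 :: real)) at_top" by real_asymp
  qed (auto intro!: derivative_eq_intros simp: algebra_simps)
  finally show ?thesis by simp
qed

text \<open>The decaying weight is a mixture of intervals \<open>[0, s]\<close>. The local log-Hoelder condition controls the
  oscillation of the exponent on an interval of length \<open>s\<close> against the size of averages on it, so large
  values are treated on each interval.\<close>

lemma layer_cake:
  assumes [measurable]: "\<phi> \<in> borel_measurable borel"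
  shows "(\<integral>\<^sup>+t. ennreal (decay t) * \<phi> t \<partial>lborel)
    = (\<integral>\<^sup>+s. ennreal (decay s / 2) * (\<integral>\<^sup>+t. \<phi> t * indicator {0..s} t \<partial>lborel) \<partial>lborel)"
proof -
  have "(\<integral>\<^sup>+t. ennreal (decay t) * \<phi> t \<partial>lborel)
      = (\<integral>\<^sup>+t. \<integral>\<^sup>+s. ennreal (decay s / 2) * (\<phi> t * indicator {0..s} t) \<partial>lborel \<partial>lborel)"
  proof (rule nn_integral_cong)
    fix t :: real
    show "ennreal (decay t) * \<phi> t
        = (\<integral>\<^sup>+s. ennreal (decay s / 2) * (\<phi> t * indicator {0..s} t) \<partial>lborel)"
    proof (cases "0 \<le> t")
      case True
      then have "(\<integral>\<^sup>+s. ennreal (decay s / 2) * (\<phi> t * indicator {0..s} t) \<partial>lborel)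
          = (\<integral>\<^sup>+s. \<phi> t * (ennreal (exp (- s / 2) / 2) * indicator {t..} s) \<partial>lborel)"
        by (intro nn_integral_cong) (auto simp: decay_def indicator_def mult.commute)
      also have "\<dots> = \<phi> t * ennreal (exp (- t / 2))"
        using nn_integral_decay_upper[OF True] by (subst nn_integral_cmult) auto
      finally show ?thesis using True by (simp add: decay_def mult.commute)
    qed (simp add: decay_def)
  qed
  also have "\<dots> = (\<integral>\<^sup>+s. \<integral>\<^sup>+t. ennreal (decay s / 2) * (\<phi> t * indicator {0..s} t) \<partial>lborel \<partial>lborel)"
    unfolding indicator_def atLeastAtMost_iff by (rule lborel_pair.Fubini') measurable
  also have "\<dots> = (\<integral>\<^sup>+s. ennreal (decay s / 2) * (\<integral>\<^sup>+t. \<phi> t * indicator {0..s} t \<partial>lborel) \<partial>lborel)"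
    by (intro nn_integral_cong nn_integral_cmult) auto
  finally show ?thesis .
qed

lemma nn_integral_affine:
  fixes u :: "real \<Rightarrow> ennreal"
  assumes [measurable]: "u \<in> borel_measurable borel" and \<delta>: "0 < \<delta>"
  shows "(\<integral>\<^sup>+t. u (x + \<delta> * t) \<partial>lborel) = ennreal (1 / \<delta>) * (\<integral>\<^sup>+y. u y \<partial>lborel)"
proof -
  have "(\<integral>\<^sup>+y. u y \<partial>lborel) = ennreal \<delta> * (\<integral>\<^sup>+t. u (x + \<delta> * t) \<partial>lborel)"
    using nn_integral_real_affine[of u \<delta> x] \<delta> by simp
  then have "ennreal (1 / \<delta>) * (\<integral>\<^sup>+y. u y \<partial>lborel)
      = (ennreal (1 / \<delta>) * ennreal \<delta>) * (\<integral>\<^sup>+t. u (x + \<delta> * t) \<partial>lborel)"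
    by (simp add: mult.assoc)
  also have "ennreal (1 / \<delta>) * ennreal \<delta> = 1" using \<delta> by (simp flip: ennreal_mult)
  finally show ?thesis by simp
qed

lemma nn_integral_decay_mean_total:
  assumes [measurable]: "\<phi> \<in> borel_measurable borel"
  shows "(\<integral>\<^sup>+x. \<integral>\<^sup>+t. ennreal (decay t * \<bar>\<phi> (x + \<delta> * t)\<bar>) \<partial>lborel \<partial>lborel)
    = 2 * (\<integral>\<^sup>+y. ennreal \<bar>\<phi> y\<bar> \<partial>lborel)"
proof -
  have "(\<integral>\<^sup>+x. \<integral>\<^sup>+t. ennreal (decay t * \<bar>\<phi> (x + \<delta> * t)\<bar>) \<partial>lborel \<partial>lborel)
      = (\<integral>\<^sup>+t. \<integral>\<^sup>+x. ennreal (decay t * \<bar>\<phi> (x + \<delta> * t)\<bar>) \<partial>lborel \<partial>lborel)"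
    by (rule lborel_pair.Fubini') measurable
  also have "\<dots> = (\<integral>\<^sup>+t. ennreal (decay t) * (\<integral>\<^sup>+y. ennreal \<bar>\<phi> y\<bar> \<partial>lborel) \<partial>lborel)"
  proof (rule nn_integral_cong)
    fix t
    have "(\<integral>\<^sup>+x. ennreal \<bar>\<phi> (\<delta> * t + 1 * x)\<bar> \<partial>lborel) = (\<integral>\<^sup>+y. ennreal \<bar>\<phi> y\<bar> \<partial>lborel)"
      by (subst nn_integral_affine[where u = "\<lambda>y. ennreal \<bar>\<phi> y\<bar>"]) auto
    then show "(\<integral>\<^sup>+x. ennreal (decay t * \<bar>\<phi> (x + \<delta> * t)\<bar>) \<partial>lborel)
        = ennreal (decay t) * (\<integral>\<^sup>+y. ennreal \<bar>\<phi> y\<bar> \<partial>lborel)"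
      by (subst nn_integral_cmult[symmetric, where M = lborel and f = "\<lambda>x. ennreal \<bar>\<phi> (x + \<delta> * t)\<bar>", simplified] |
          simp add: ennreal_mult nn_integral_cmult add.commute)+
  qed
  also have "\<dots> = 2 * (\<integral>\<^sup>+y. ennreal \<bar>\<phi> y\<bar> \<partial>lborel)"
    by (subst nn_integral_multc) (auto simp: nn_integral_decay)
  finally show ?thesis .
qed

locale log_Hoelder_exponent =
  fixes p :: "real \<Rightarrow> real" and c\<^sub>1 c\<^sub>2 c\<^sub>3 :: real
  assumes ge_1: "\<And>x. 1 \<le> p x"
    and log_Hoelder: "log_Hoelder_constants p c\<^sub>1 c\<^sub>2"
    and c3: "c\<^sub>3 = max c\<^sub>1 c\<^sub>2"
begin

lemma constants_pos: "0 < c\<^sub>1" "0 < c\<^sub>2" "0 < c\<^sub>3"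
  using log_Hoelder c3 by (auto simp: log_Hoelder_constants_def)

lemma local_oscillation:
  "x \<noteq> y \<Longrightarrow> \<bar>1 / p x - 1 / p y\<bar> * ln (exp 1 + 1 / \<bar>x - y\<bar>) \<le> c\<^sub>1"
  using log_Hoelder by (simp add: log_Hoelder_constants_def)

lemma log_pos:
  assumes "0 \<le> z" shows "1 \<le> ln (exp 1 + z :: real)"
proof -
  have "ln (exp 1) \<le> ln (exp 1 + z)" using assms by (subst ln_le_cancel_iff) (auto simp: add_pos_nonneg)
  then show ?thesis by simp
qed

lemma isCont_exponent: "isCont p x"
proof -
  have "((\<lambda>y. 1 / p y - 1 / p x) \<longlongrightarrow> 0) (at x)"
  proof (rule Lim_null_comparison)
    show "eventually (\<lambda>y. norm (1 / p y - 1 / p x) \<le> c\<^sub>1 / ln (exp 1 + 1 / \<bar>y - x\<bar>)) (at x)"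
    proof (rule eventually_at_topological[THEN iffD2], intro exI[of _ UNIV] conjI ballI impI)
      fix y assume "y \<noteq> x"
      then show "norm (1 / p y - 1 / p x) \<le> c\<^sub>1 / ln (exp 1 + 1 / \<bar>y - x\<bar>)"
        using local_oscillation[of y x] log_pos[of "1 / \<bar>y - x\<bar>"] by (simp add: pos_le_divide_eq)
    qed auto
    have "((\<lambda>y. \<bar>y - x\<bar>) \<longlongrightarrow> 0) (at x)" by (rule tendsto_eq_intros | simp)+
    moreover have "eventually (\<lambda>y. 0 < \<bar>y - x\<bar>) (at x)" by (simp add: eventually_at_topological) blast
    ultimately have "filterlim (\<lambda>y. 1 / \<bar>y - x\<bar>) at_top (at x)"
      using filterlim_inverse_at_top[of "\<lambda>y. \<bar>y - x\<bar>" "at x"] by (simp add: inverse_eq_divide)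
    then have "filterlim (\<lambda>y. ln (exp 1 + 1 / \<bar>y - x\<bar>)) at_top (at x)"
      by (intro filterlim_compose[OF ln_at_top] filterlim_tendsto_add_at_top[OF tendsto_const])
    then show "((\<lambda>y. c\<^sub>1 / ln (exp 1 + 1 / \<bar>y - x\<bar>)) \<longlongrightarrow> 0) (at x)"
      by (intro tendsto_divide_0[OF tendsto_const] filterlim_at_top_imp_at_infinity)
  qed
  then have "((\<lambda>y. 1 / p y) \<longlongrightarrow> 1 / p x) (at x)" by (simp add: LIM_zero_iff)
  then have "((\<lambda>y. inverse (1 / p y)) \<longlongrightarrow> inverse (1 / p x)) (at x)"
    by (rule tendsto_inverse) (use ge_1[of x] in auto)
  then show ?thesis by (simp add: isCont_def)
qed

lemma exponent_measurable [measurable]: "p \<in> borel_measurable borel"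
  using isCont_exponent by (intro borel_measurable_continuous_onI continuous_at_imp_continuous_on) auto

sublocale exponent p
  by standard (auto intro: ge_1 measurable_completion)

text \<open>If \<open>t^(p(y))\<close> is at least of the size of the tail, then changing the exponent costs a constant, since the
  reciprocals of the exponents at \<open>x\<close> and \<open>y\<close> differ by \<open>O(1 / log)\<close> at the smaller of \<open>|x|\<close> and \<open>|y|\<close>. Otherwise \<open>t\<close> may be replaced by
  the value for which \<open>t^(p(y))\<close> has that size; the maximum \<open>z\<close> below covers both cases.\<close>

lemma small_values:
  assumes t: "0 \<le> t" "t \<le> 1"
  shows "t \<le> exp (4 * c\<^sub>2) * (t powr p y + tail x + tail y) powr (1 / p x)"
proof -
  obtain q where q: "\<And>x. \<bar>1 / p x - 1 / q\<bar> * ln (exp 1 + \<bar>x\<bar>) \<le> c\<^sub>2"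
    using log_Hoelder by (auto simp: log_Hoelder_constants_def)
  define m where "m = exp 1 + min \<bar>x\<bar> \<bar>y\<bar>"
  have m: "1 \<le> ln m" "0 < m" "m \<le> exp 1 + \<bar>x\<bar>" "m \<le> exp 1 + \<bar>y\<bar>"
    unfolding m_def by (auto intro!: log_pos add_pos_nonneg)
  have dist: "\<bar>1 / p z - 1 / q\<bar> * ln m \<le> c\<^sub>2" if "m \<le> exp 1 + \<bar>z\<bar>" for z
  proof -
    have "ln m \<le> ln (exp 1 + \<bar>z\<bar>)" using m(2) that by (subst ln_le_cancel_iff) auto
    then have "\<bar>1 / p z - 1 / q\<bar> * ln m \<le> \<bar>1 / p z - 1 / q\<bar> * ln (exp 1 + \<bar>z\<bar>)"
      by (rule mult_left_mono) simp
    then show ?thesis using q[of z] by linarith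
  qed
  define d where "d = 1 / p x - 1 / p y"
  have "\<bar>d\<bar> \<le> \<bar>1 / p x - 1 / q\<bar> + \<bar>1 / p y - 1 / q\<bar>" unfolding d_def by linarith
  then have "\<bar>d\<bar> * ln m \<le> (\<bar>1 / p x - 1 / q\<bar> + \<bar>1 / p y - 1 / q\<bar>) * ln m"
    using \<open>\<bar>d\<bar> \<le> _\<close> m(1) by (intro mult_right_mono) linarith+
  then have d: "\<bar>d\<bar> * ln m \<le> 2 * c\<^sub>2"
    using dist[OF m(3)] dist[OF m(4)] by (simp add: distrib_right)
  \<comment> \<open>At least \<open>1 / m\<^sup>2\<close>, so that changing the exponent of \<open>z\<close> costs a power of \<open>m\<close>, and at most the
      right-hand side.\<close>
  define z where "z = max (t powr p y) (1 / m\<^sup>2)"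
  have tail_m: "1 / m\<^sup>2 \<le> tail x + tail y"
    using tail_pos[of x] tail_pos[of y] by (auto simp: m_def tail_def min_def)
  have z_le: "z \<le> t powr p y + tail x + tail y"
    using tail_m tail_pos[of x] tail_pos[of y] powr_ge_zero[of t "p y"] unfolding z_def by linarith
  have z0: "0 < z" using m(2) by (simp add: z_def less_max_iff_disj)
  have "t \<le> z powr (1 / p y)"
  proof -
    have "t = (t powr p y) powr (1 / p y)" using t exponent_pos[of y] by (simp add: powr_powr)
    also have "\<dots> \<le> z powr (1 / p y)"
      using exponent_pos[of y] by (intro powr_mono2) (auto simp: z_def)
    finally show ?thesis .
  qed
  also have "\<dots> = z powr (1 / p x) * z powr (- d)"
    unfolding d_def by (simp flip: powr_add)
  also have "\<dots> \<le> z powr (1 / p x) * exp (4 * c\<^sub>2)"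
  proof (rule mult_left_mono)
    have z1: "z \<le> 1"
    proof -
      have "t powr p y \<le> 1 powr p y" using t exponent_pos[of y] by (intro powr_mono2) auto
      moreover have "0 \<le> ln m" using m(1) by linarith
      then have "1 \<le> m" using m(2) by simp
      ultimately show ?thesis by (simp add: z_def one_le_power)
    qed
    have "- ln z \<le> 2 * ln m"
    proof -
      have "ln (1 / m\<^sup>2) \<le> ln z" using m(2) z0 by (subst ln_le_cancel_iff) (auto simp: z_def)
      then show ?thesis using m(2) by (simp add: ln_div ln_realpow)
    qed
    moreover have "ln z \<le> 0" using z0 z1 by simp
    ultimately have "- d * ln z \<le> \<bar>d\<bar> * (2 * ln m)"
    proof -
      assume a: "- ln z \<le> 2 * ln m" "ln z \<le> 0"
      have "- d * ln z \<le> \<bar>d\<bar> * (- ln z)"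
        using a by (simp add: abs_if mult_nonneg_nonpos2 mult_nonpos_nonpos)
      also have "\<dots> \<le> \<bar>d\<bar> * (2 * ln m)" using a by (intro mult_left_mono) auto
      finally show ?thesis .
    qed
    also have "\<dots> \<le> 4 * c\<^sub>2" using d by simp
    finally show "z powr (- d) \<le> exp (4 * c\<^sub>2)" using z0 by (simp add: powr_def)
  qed simp
  also have "\<dots> \<le> (t powr p y + tail x + tail y) powr (1 / p x) * exp (4 * c\<^sub>2)"
    using z_le z0 exponent_pos[of x] by (intro mult_right_mono powr_mono2) auto
  finally show ?thesis by (simp add: mult.commute)
qed

text \<open>The local condition in the form in which it is used: a quantity between \<open>1\<close> and \<open>1 / l\<close> feels a change of
  the exponent within distance \<open>l\<close> only by the factor \<open>exp c\<^sub>1\<close>.\<close>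

lemma exponent_change:
  assumes U: "1 \<le> U" "U \<le> 1 / l" and l: "0 < l" "\<bar>x - y\<bar> \<le> l"
  shows "U powr (1 / p y) \<le> exp c\<^sub>1 * U powr (1 / p x)"
proof (cases "x = y")
  case True
  have "1 \<le> exp c\<^sub>1" using constants_pos by simp
  then show ?thesis using True mult_right_mono[of 1 "exp c\<^sub>1" "U powr (1 / p x)"] by simp
next
  case False
  define d where "d = 1 / p x - 1 / p y"
  have "1 / l \<le> 1 / \<bar>x - y\<bar>" using l False by (intro divide_left_mono) auto
  then have "U \<le> exp 1 + 1 / \<bar>x - y\<bar>" using U by (simp add: add_increasing)
  then have "ln U \<le> ln (exp 1 + 1 / \<bar>x - y\<bar>)" using U by (subst ln_le_cancel_iff) auto
  then have "\<bar>d\<bar> * ln U \<le> c\<^sub>1"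
    using local_oscillation[OF False] unfolding d_def
    by (meson abs_ge_zero mult_left_mono order_trans)
  moreover have "- d * ln U \<le> \<bar>d\<bar> * ln U" using U by (intro mult_right_mono) auto
  ultimately have "U powr (- d) \<le> exp c\<^sub>1" using U by (simp add: powr_def)
  moreover have "U powr (1 / p y) = U powr (- d) * U powr (1 / p x)"
    by (simp add: d_def flip: powr_add)
  ultimately show ?thesis by (simp add: mult_right_mono)
qed

text \<open>\<open>U\<close> is the average of \<open>u = F^p\<close> over \<open>[x, x + \<delta> s]\<close>. If \<open>U < 1\<close>, then \<open>F \<le> u\<close> suffices, as \<open>F\<close> has no values in
  \<open>(0, 1]\<close>. If \<open>U \<ge> 1\<close>, linearise \<open>F = u^(1/p)\<close> at the level \<open>U\<close>; as \<open>U \<le> 1 / (\<delta> s)\<close> by the assumption on the total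
  integral, the exponent \<open>1 / p(y)\<close> of \<open>U\<close> can be changed to \<open>1 / p(x)\<close>.\<close>

lemma large_values_interval:
  assumes [measurable]: "f \<in> borel_measurable borel" and \<delta>: "0 < \<delta>" and s: "0 < s" and U: "0 \<le> U"
    and u: "u = (\<lambda>y. if 1 < \<bar>f y\<bar> then \<bar>f y\<bar> powr p y else 0)"
    and F: "F = (\<lambda>y. if 1 < \<bar>f y\<bar> then \<bar>f y\<bar> else 0)"
    and total: "(\<integral>\<^sup>+y. ennreal (u y) \<partial>lborel) \<le> 1"
    and U_eq: "(\<integral>\<^sup>+t. ennreal (u (x + \<delta> * t)) * indicator {0..s} t \<partial>lborel) = ennreal (s * U)"
  shows "(\<integral>\<^sup>+t. ennreal (F (x + \<delta> * t)) * indicator {0..s} t \<partial>lborel)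
    \<le> ennreal (2 * exp c\<^sub>1 * s * U powr (1 / p x))"
proof -
  have [measurable]: "u \<in> borel_measurable borel" "F \<in> borel_measurable borel"
    unfolding u F by measurable
  have u0: "0 \<le> u y" for y by (simp add: u)
  have Fu: "F y = u y powr (1 / p y)" for y
    using exponent_pos[of y] by (auto simp: F u powr_powr)
  have F_le: "F y \<le> u y" for y
    using powr_mono[of 1 "p y" "\<bar>f y\<bar>"] ge_1[of y] by (auto simp: F u)
  have e1: "1 \<le> exp c\<^sub>1" using constants_pos by simp
  consider "U = 0" | "0 < U" "U < 1" | "1 \<le> U" using U by linarith
  then show ?thesis
  proof cases
    case 1
    then have "(\<integral>\<^sup>+t. ennreal (u (x + \<delta> * t)) * indicator {0..s} t \<partial>lborel) = 0"
      using U_eq by simp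
    then have "AE t in lborel. ennreal (u (x + \<delta> * t)) * indicator {0..s} t = 0"
      by (subst (asm) nn_integral_0_iff_AE) auto
    then have "AE t in lborel. ennreal (F (x + \<delta> * t)) * indicator {0..s} t = 0"
    proof eventually_elim
      case (elim t)
      have "ennreal (F (x + \<delta> * t)) \<le> ennreal (u (x + \<delta> * t))" by (rule ennreal_leI[OF F_le])
      then show ?case using elim by (cases "t \<in> {0..s}") auto
    qed
    then have "(\<integral>\<^sup>+t. ennreal (F (x + \<delta> * t)) * indicator {0..s} t \<partial>lborel) = 0"
      by (subst nn_integral_0_iff_AE) auto
    then show ?thesis by simp
  next
    case 2
    have "(\<integral>\<^sup>+t. ennreal (F (x + \<delta> * t)) * indicator {0..s} t \<partial>lborel)
        \<le> (\<integral>\<^sup>+t. ennreal (u (x + \<delta> * t)) * indicator {0..s} t \<partial>lborel)"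
      by (intro nn_integral_mono mult_right_mono ennreal_leI F_le) auto
    also have "\<dots> = ennreal (s * U)" by (rule U_eq)
    also have "\<dots> \<le> ennreal (2 * exp c\<^sub>1 * s * U powr (1 / p x))"
    proof (rule ennreal_leI)
      have "U powr 1 \<le> U powr (1 / p x)" using 2 ge_1[of x] by (intro powr_mono') auto
      then have "s * U \<le> s * U powr (1 / p x)" using 2 s by simp
      also have "\<dots> \<le> (2 * exp c\<^sub>1) * (s * U powr (1 / p x))"
        using mult_right_mono[of 1 "2 * exp c\<^sub>1" "s * U powr (1 / p x)"] e1 s by simp
      finally show "s * U \<le> 2 * exp c\<^sub>1 * s * U powr (1 / p x)" by (simp add: mult.assoc)
    qed
    finally show ?thesis .
  next
    case 3
    have "ennreal (s * U) \<le> (\<integral>\<^sup>+t. ennreal (u (x + \<delta> * t)) \<partial>lborel)"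
      unfolding U_eq[symmetric] by (intro nn_integral_mono) (auto simp: indicator_def)
    also have "\<dots> = ennreal (1 / \<delta>) * (\<integral>\<^sup>+y. ennreal (u y) \<partial>lborel)"
      using \<delta> by (intro nn_integral_affine) auto
    also have "\<dots> \<le> ennreal (1 / \<delta>) * 1" using total by (intro mult_left_mono) auto
    finally have "s * U \<le> 1 / \<delta>" using \<delta> by (simp add: ennreal_le_iff)
    then have U_le: "U \<le> 1 / (\<delta> * s)" using \<delta> s by (simp add: field_simps)
    define c where "c = exp c\<^sub>1 * U powr (1 / p x)"
    have c: "0 \<le> c" by (simp add: c_def)
    have "(\<integral>\<^sup>+t. ennreal (F (x + \<delta> * t)) * indicator {0..s} t \<partial>lborel)
        \<le> (\<integral>\<^sup>+t. ennreal (c / U) * (ennreal (u (x + \<delta> * t)) * indicator {0..s} t)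
             + ennreal c * indicator {0..s} t \<partial>lborel)"
    proof (rule nn_integral_mono)
      fix t
      show "ennreal (F (x + \<delta> * t)) * indicator {0..s} t
        \<le> ennreal (c / U) * (ennreal (u (x + \<delta> * t)) * indicator {0..s} t)
             + ennreal c * indicator {0..s} t"
      proof (cases "t \<in> {0..s}")
        case True
        define y where "y = x + \<delta> * t"
        have "\<bar>x - y\<bar> \<le> \<delta> * s" using True \<delta> by (auto simp: y_def abs_mult)
        then have ch: "U powr (1 / p y) \<le> c"
          using \<delta> s unfolding c_def by (intro exponent_change[OF 3 U_le]) auto
        have "F y \<le> (u y / U + 1) * U powr (1 / p y)"
          unfolding Fu using 3 ge_1[of y] u0[of y] by (intro powr_le_weighted) auto
        also have "\<dots> \<le> (u y / U + 1) * c"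
          using ch u0[of y] 3 by (intro mult_left_mono) auto
        also have "\<dots> = c / U * u y + c" by (simp add: field_simps)
        finally have "ennreal (F y) \<le> ennreal (c / U * u y + c)" by (rule ennreal_leI)
        also have "\<dots> = ennreal (c / U) * ennreal (u y) + ennreal c"
          using c u0[of y] 3 by (simp only: ennreal_plus ennreal_mult divide_nonneg_nonneg mult_nonneg_nonneg U)
        finally show ?thesis using True by (simp add: y_def)
      qed simp
    qed
    also have "\<dots> = ennreal (c / U) * ennreal (s * U) + ennreal c * ennreal s"
      using s by (subst nn_integral_add) (auto simp: nn_integral_cmult U_eq nn_integral_cmult_indicator)
    also have "\<dots> = ennreal (2 * exp c\<^sub>1 * s * U powr (1 / p x))"
    proof -
      have "ennreal (c / U) * ennreal (s * U) + ennreal c * ennreal s = ennreal (c / U * (s * U) + c * s)"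
        using s 3 c by (simp only: ennreal_plus ennreal_mult divide_nonneg_nonneg mult_nonneg_nonneg U less_imp_le)
      then show ?thesis using 3 by (simp add: c_def field_simps)
    qed
    finally show ?thesis .
  qed
qed

text \<open>Mixes the bounds on intervals: \<open>s decay(s) / 4\<close> is a probability density, and \<open>weak_Jensen\<close> takes the
  averages over \<open>[x, x + \<delta> s]\<close> under the power \<open>1 / p(x)\<close>.\<close>

lemma large_values_mean:
  assumes [measurable]: "f \<in> borel_measurable borel" and \<delta>: "0 < \<delta>" and W: "0 \<le> W"
    and u: "u = (\<lambda>y. if 1 < \<bar>f y\<bar> then \<bar>f y\<bar> powr p y else 0)"
    and F: "F = (\<lambda>y. if 1 < \<bar>f y\<bar> then \<bar>f y\<bar> else 0)"
    and total: "(\<integral>\<^sup>+y. ennreal (u y) \<partial>lborel) \<le> 1"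
    and W_le: "(\<integral>\<^sup>+t. ennreal (decay t) * ennreal (u (x + \<delta> * t)) \<partial>lborel) \<le> ennreal (2 * W)"
  shows "(\<integral>\<^sup>+t. ennreal (decay t) * ennreal (F (x + \<delta> * t)) \<partial>lborel)
    \<le> ennreal (8 * exp c\<^sub>1 * W powr (1 / p x))"
proof -
  have [measurable]: "u \<in> borel_measurable borel" "F \<in> borel_measurable borel"
    unfolding u F by measurable
  have u0: "0 \<le> u y" for y by (simp add: u)
  define I where "I s = (\<integral>\<^sup>+t. ennreal (u (x + \<delta> * t)) * indicator {0..s} t \<partial>lborel)" for s
  have [measurable]: "I \<in> borel_measurable borel"
    unfolding I_def indicator_def atLeastAtMost_iff by measurable
  have I_fin: "I s < \<infinity>" for s
  proof -
    have "I s \<le> (\<integral>\<^sup>+t. ennreal (u (x + \<delta> * t)) \<partial>lborel)"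
      unfolding I_def by (intro nn_integral_mono) (auto simp: indicator_def)
    also have "\<dots> = ennreal (1 / \<delta>) * (\<integral>\<^sup>+y. ennreal (u y) \<partial>lborel)"
      using \<delta> by (intro nn_integral_affine) auto
    also have "\<dots> \<le> ennreal (1 / \<delta>) * 1" using total by (intro mult_left_mono) auto
    also have "\<dots> < \<infinity>" by simp
    finally show ?thesis .
  qed
  \<comment> \<open>The average of \<open>u\<close> over the interval from \<open>x\<close> to \<open>x + \<delta> s\<close>; the value \<open>0\<close>
      for \<open>s \<le> 0\<close> keeps \<open>U\<close> nonnegative.\<close>
  define U where "U s = enn2real (I s) / s * indicator {0<..} s" for s
  have U0: "0 \<le> U s" for s by (auto simp: U_def indicator_def)
  have [measurable]: "U \<in> borel_measurable borel" unfolding U_def by measurable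
  have "(\<integral>\<^sup>+t. ennreal (decay t) * ennreal (F (x + \<delta> * t)) \<partial>lborel)
      = (\<integral>\<^sup>+s. ennreal (decay s / 2)
          * (\<integral>\<^sup>+t. ennreal (F (x + \<delta> * t)) * indicator {0..s} t \<partial>lborel) \<partial>lborel)"
    by (rule layer_cake) measurable
  also have "\<dots> \<le> (\<integral>\<^sup>+s. ennreal (4 * exp c\<^sub>1)
      * ennreal (s * decay s / 4 * U s powr (1 / p x)) \<partial>lborel)"
  proof (rule nn_integral_mono_AE)
    show "AE s in lborel. ennreal (decay s / 2)
          * (\<integral>\<^sup>+t. ennreal (F (x + \<delta> * t)) * indicator {0..s} t \<partial>lborel)
        \<le> ennreal (4 * exp c\<^sub>1) * ennreal (s * decay s / 4 * U s powr (1 / p x))"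
      using AE_lborel_singleton[of 0]
    proof eventually_elim
      case (elim s)
      show ?case
      proof (cases "0 < s")
        case True
        have "I s = ennreal (s * U s)"
          using True I_fin[of s] by (simp add: U_def)
        then have "ennreal (decay s / 2)
            * (\<integral>\<^sup>+t. ennreal (F (x + \<delta> * t)) * indicator {0..s} t \<partial>lborel)
          \<le> ennreal (decay s / 2) * ennreal (2 * exp c\<^sub>1 * s * U s powr (1 / p x))"
          unfolding I_def
          by (intro mult_left_mono large_values_interval[OF assms(1) \<delta> True U0 u F total]) auto
        also have "\<dots> = ennreal (4 * exp c\<^sub>1) * ennreal (s * decay s / 4 * U s powr (1 / p x))"
          using True by (simp add: field_simps flip: ennreal_mult)
        finally show ?thesis .
      next
        case False
        then show ?thesis using elim by (simp add: decay_def)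
      qed
    qed
  qed
  also have "\<dots> = ennreal (4 * exp c\<^sub>1)
      * (\<integral>\<^sup>+s. ennreal (s * decay s / 4 * U s powr (1 / p x)) \<partial>lborel)"
    by (rule nn_integral_cmult) measurable
  also have "\<dots> \<le> ennreal (4 * exp c\<^sub>1) * ennreal (2 * W powr (1 / p x))"
  proof (intro mult_left_mono weak_Jensen ge_1 nn_integral_moment W U0)
    show "0 \<le> s * decay s / 4" for s by (auto simp: decay_def indicator_def)
    define c :: real where "c = 1 / 2"
    have c: "0 \<le> c" by (simp add: c_def)
    have "(\<integral>\<^sup>+s. ennreal (s * decay s / 4 * U s) \<partial>lborel)
        \<le> (\<integral>\<^sup>+s. ennreal c * (ennreal (decay s / 2) * I s) \<partial>lborel)"
    proof (rule nn_integral_mono)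
      fix s :: real
      show "ennreal (s * decay s / 4 * U s) \<le> ennreal c * (ennreal (decay s / 2) * I s)"
      proof (cases "0 < s")
        case True
        have "I s = ennreal (s * U s)"
          using True I_fin[of s] by (simp add: U_def)
        then have "ennreal c * (ennreal (decay s / 2) * I s) = ennreal (c * (decay s / 2 * (s * U s)))"
          using True U0[of s] c by (simp flip: ennreal_mult)
        also have "c * (decay s / 2 * (s * U s)) = s * decay s / 4 * U s" by (simp add: c_def)
        finally show ?thesis by simp
      qed (simp add: U_def)
    qed
    also have "\<dots> = ennreal c * (\<integral>\<^sup>+s. ennreal (decay s / 2) * I s \<partial>lborel)"
      by (rule nn_integral_cmult) measurable
    also have "(\<integral>\<^sup>+s. ennreal (decay s / 2) * I s \<partial>lborel)
        = (\<integral>\<^sup>+t. ennreal (decay t) * ennreal (u (x + \<delta> * t)) \<partial>lborel)"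
      unfolding I_def by (rule layer_cake[symmetric]) measurable
    also have "ennreal c * \<dots> \<le> ennreal c * ennreal (2 * W)"
      using W_le by (rule mult_left_mono) simp
    also have "\<dots> = ennreal (c * (2 * W))" using W c by (simp flip: ennreal_mult)
    also have "\<dots> = ennreal W" by (simp add: c_def)
    finally show "(\<integral>\<^sup>+s. ennreal (s * decay s / 4 * U s) \<partial>lborel) \<le> ennreal W" .
  qed auto
  also have "\<dots> = ennreal (8 * exp c\<^sub>1 * W powr (1 / p x))"
    by (simp flip: ennreal_mult)
  finally show ?thesis .
qed

lemma small_values_mean:
  assumes [measurable]: "f \<in> borel_measurable borel" and W: "0 \<le> W"
    and F: "F = (\<lambda>y. if 1 < \<bar>f y\<bar> then 0 else \<bar>f y\<bar>)"
    and v: "v = (\<lambda>y. F y powr p y + tail x + tail y)"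
    and W_le: "(\<integral>\<^sup>+t. ennreal (decay t) * ennreal (v (x + \<delta> * t)) \<partial>lborel) \<le> ennreal (2 * W)"
  shows "(\<integral>\<^sup>+t. ennreal (decay t) * ennreal (F (x + \<delta> * t)) \<partial>lborel)
    \<le> ennreal (4 * exp (4 * c\<^sub>2) * W powr (1 / p x))"
proof -
  have [measurable]: "F \<in> borel_measurable borel" unfolding F by measurable
  have [measurable]: "v \<in> borel_measurable borel" unfolding v by measurable
  have v0: "0 \<le> v y" for y
    using tail_pos[of x] tail_pos[of y] powr_ge_zero[of "F y" "p y"] unfolding v by linarith
  have "(\<integral>\<^sup>+t. ennreal (decay t) * ennreal (F (x + \<delta> * t)) \<partial>lborel)
      \<le> (\<integral>\<^sup>+t. ennreal (2 * exp (4 * c\<^sub>2))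
           * ennreal (decay t / 2 * v (x + \<delta> * t) powr (1 / p x)) \<partial>lborel)"
  proof (rule nn_integral_mono)
    fix t
    have "decay t * F (x + \<delta> * t) \<le> decay t * (exp (4 * c\<^sub>2) * v (x + \<delta> * t) powr (1 / p x))"
      unfolding v by (intro mult_left_mono small_values) (auto simp: F)
    then show "ennreal (decay t) * ennreal (F (x + \<delta> * t)) \<le> ennreal (2 * exp (4 * c\<^sub>2))
           * ennreal (decay t / 2 * v (x + \<delta> * t) powr (1 / p x))"
      by (simp add: F ac_simps ennreal_leI flip: ennreal_mult)
  qed
  also have "\<dots> = ennreal (2 * exp (4 * c\<^sub>2))
      * (\<integral>\<^sup>+t. ennreal (decay t / 2 * v (x + \<delta> * t) powr (1 / p x)) \<partial>lborel)"
    by (rule nn_integral_cmult) measurable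
  also have "\<dots> \<le> ennreal (2 * exp (4 * c\<^sub>2)) * ennreal (2 * W powr (1 / p x))"
  proof (intro mult_left_mono weak_Jensen ge_1 W v0)
    define c :: real where "c = 1 / 2"
    have c: "0 \<le> c" by (simp add: c_def)
    have half: "(\<integral>\<^sup>+t. ennreal (decay t / 2 * g t) \<partial>lborel)
        = ennreal c * (\<integral>\<^sup>+t. ennreal (decay t) * ennreal (g t) \<partial>lborel)"
      if [measurable]: "g \<in> borel_measurable borel" and g: "\<And>t. 0 \<le> g t" for g
    proof -
      have "ennreal (decay t / 2 * g t) = ennreal c * (ennreal (decay t) * ennreal (g t))" for t
      proof -
        have "ennreal c * (ennreal (decay t) * ennreal (g t)) = ennreal (c * (decay t * g t))"
          using c g[of t] by (simp flip: ennreal_mult)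
        then show ?thesis by (simp add: c_def)
      qed
      then show ?thesis by (simp add: nn_integral_cmult)
    qed
    have "(\<integral>\<^sup>+t. ennreal (decay t / 2 * 1) \<partial>lborel) = ennreal c * ennreal 2"
      using half[of "\<lambda>_. 1"] by (simp add: nn_integral_decay)
    also have "\<dots> = ennreal (c * 2)" using c by (subst ennreal_mult) auto
    also have "\<dots> = 1" by (simp add: c_def)
    finally show "(\<integral>\<^sup>+t. ennreal (decay t / 2) \<partial>lborel) \<le> 1" by simp
    have "(\<integral>\<^sup>+t. ennreal (decay t / 2 * v (x + \<delta> * t)) \<partial>lborel) \<le> ennreal c * ennreal (2 * W)"
      using W_le v0 by (subst half) (auto intro!: mult_left_mono)
    also have "\<dots> = ennreal (c * (2 * W))" using W c by (simp flip: ennreal_mult)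
    also have "\<dots> = ennreal W" by (simp add: c_def)
    finally show "(\<integral>\<^sup>+t. ennreal (decay t / 2 * v (x + \<delta> * t)) \<partial>lborel) \<le> ennreal W" .
  qed auto
  also have "\<dots> = ennreal (4 * exp (4 * c\<^sub>2) * W powr (1 / p x))"
    by (simp flip: ennreal_mult)
  finally show ?thesis .
qed

lemma tail_tame: "tail \<in> tame \<delta>"
proof (rule tameI)
  fix x
  have "(\<integral>\<^sup>+t. ennreal (decay t * \<bar>tail (x + \<delta> * t)\<bar>) \<partial>lborel) \<le> (\<integral>\<^sup>+t. ennreal (decay t) \<partial>lborel)"
    using tail_pos tail_le_1
    by (intro nn_integral_mono ennreal_leI mult_left_le) (auto simp: less_imp_le)
  also have "\<dots> < \<infinity>" by (simp add: nn_integral_decay)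
  finally show "(\<integral>\<^sup>+t. ennreal (decay t * \<bar>tail (x + \<delta> * t)\<bar>) \<partial>lborel) < \<infinity>" .
qed simp

lemma integrable_imp_tame:
  assumes [measurable]: "\<phi> \<in> borel_measurable borel" and \<delta>: "0 < \<delta>"
    and fin: "(\<integral>\<^sup>+y. ennreal \<bar>\<phi> y\<bar> \<partial>lborel) < \<infinity>"
  shows "\<phi> \<in> tame \<delta>"
proof (rule tameI)
  fix x
  have "(\<integral>\<^sup>+t. ennreal (decay t * \<bar>\<phi> (x + \<delta> * t)\<bar>) \<partial>lborel)
      \<le> (\<integral>\<^sup>+t. ennreal \<bar>\<phi> (x + \<delta> * t)\<bar> \<partial>lborel)"
    by (intro nn_integral_mono ennreal_leI mult_left_le_one_le) (auto simp: decay_def indicator_def)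
  also have "\<dots> = ennreal (1 / \<delta>) * (\<integral>\<^sup>+y. ennreal \<bar>\<phi> y\<bar> \<partial>lborel)"
    using \<delta> by (intro nn_integral_affine) auto
  also have "\<dots> < \<infinity>" using fin by (simp add: ennreal_mult_less_top)
  finally show "(\<integral>\<^sup>+t. ennreal (decay t * \<bar>\<phi> (x + \<delta> * t)\<bar>) \<partial>lborel) < \<infinity>" .
qed simp

text \<open>Its integral is at most \<open>3\<close> if the modular of \<open>f\<close> is at most \<open>1\<close>: the integral of \<open>decay\<close> is \<open>2\<close>, and that of \<open>tail\<close>
  is at most \<open>1\<close>.\<close>

definition majorant :: "real \<Rightarrow> (real \<Rightarrow> real) \<Rightarrow> real \<Rightarrow> real" where
  "majorant \<delta> f x = decay_mean \<delta> (\<lambda>y. \<bar>f y\<bar> powr p y) x / 2 + tail x + decay_mean \<delta> tail x / 2"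

lemma majorant_nonneg: "0 \<le> majorant \<delta> f x"
  unfolding majorant_def using tail_pos[of x] by (simp add: add_nonneg_nonneg less_imp_le)

lemma decay_mean_pointwise:
  assumes [measurable]: "f \<in> borel_measurable borel" and \<delta>: "0 < \<delta>"
    and total: "(\<integral>\<^sup>+y. ennreal (\<bar>f y\<bar> powr p y) \<partial>lborel) \<le> 1"
  shows "f \<in> tame \<delta>"
    and "decay_mean \<delta> f x \<le> 12 * exp (4 * c\<^sub>3) * majorant \<delta> f x powr (1 / p x)"
proof -
  define \<Phi> where "\<Phi> y = \<bar>f y\<bar> powr p y" for y
  have [measurable]: "\<Phi> \<in> borel_measurable borel" unfolding \<Phi>_def by measurable
  have \<Phi>0: "0 \<le> \<Phi> y" for y by (simp add: \<Phi>_def)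
  have \<Phi>: "\<Phi> \<in> tame \<delta>"
    using total \<delta> by (intro integrable_imp_tame) (auto simp: \<Phi>_def intro: order.strict_trans1)
  define F1 F2 where "F1 = (\<lambda>y. if 1 < \<bar>f y\<bar> then \<bar>f y\<bar> else 0)"
    and "F2 = (\<lambda>y. if 1 < \<bar>f y\<bar> then 0 else \<bar>f y\<bar>)"
  define u where "u = (\<lambda>y. if 1 < \<bar>f y\<bar> then \<bar>f y\<bar> powr p y else 0)"
  have u_le: "u y \<le> \<Phi> y" and F2_le: "F2 y powr p y \<le> \<Phi> y" for y
    by (auto simp: u_def \<Phi>_def F2_def)
  have [measurable]: "F1 \<in> borel_measurable borel" "F2 \<in> borel_measurable borel"
    unfolding F1_def F2_def by measurable
  have *: "(\<integral>\<^sup>+t. ennreal (decay t * \<bar>f (x + \<delta> * t)\<bar>) \<partial>lborel)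
      \<le> ennreal (12 * exp (4 * c\<^sub>3) * majorant \<delta> f x powr (1 / p x))" for x
  proof -
    let ?W = "majorant \<delta> f x"
    have \<Phi>_mean: "(\<integral>\<^sup>+t. ennreal (decay t) * ennreal (\<Phi> (x + \<delta> * t)) \<partial>lborel)
        = ennreal (decay_mean \<delta> \<Phi> x)"
      using nn_integral_decay_mean[OF \<Phi>, of x] \<Phi>0 by (simp add: ennreal_mult)
    have tail_mean: "(\<integral>\<^sup>+t. ennreal (decay t) * ennreal (tail (x + \<delta> * t)) \<partial>lborel)
        = ennreal (decay_mean \<delta> tail x)"
      using nn_integral_decay_mean[OF tail_tame[of \<delta>], of x] tail_pos
      by (simp add: ennreal_mult less_imp_le)
    have large: "(\<integral>\<^sup>+t. ennreal (decay t) * ennreal (F1 (x + \<delta> * t)) \<partial>lborel)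
        \<le> ennreal (8 * exp c\<^sub>1 * ?W powr (1 / p x))"
    proof (rule large_values_mean[OF assms(1) \<delta> majorant_nonneg u_def F1_def])
      have "(\<integral>\<^sup>+y. ennreal (u y) \<partial>lborel) \<le> (\<integral>\<^sup>+y. ennreal (\<Phi> y) \<partial>lborel)"
        by (intro nn_integral_mono ennreal_leI u_le)
      then show "(\<integral>\<^sup>+y. ennreal (u y) \<partial>lborel) \<le> 1" using total by (simp add: \<Phi>_def)
      have "(\<integral>\<^sup>+t. ennreal (decay t) * ennreal (u (x + \<delta> * t)) \<partial>lborel)
          \<le> (\<integral>\<^sup>+t. ennreal (decay t) * ennreal (\<Phi> (x + \<delta> * t)) \<partial>lborel)"
        by (intro nn_integral_mono mult_left_mono ennreal_leI u_le) auto
      also have "\<dots> \<le> ennreal (2 * ?W)"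
        unfolding \<Phi>_mean using tail_pos[of x]
        by (intro ennreal_leI) (simp add: majorant_def \<Phi>_def[abs_def] add_increasing2)
      finally show "(\<integral>\<^sup>+t. ennreal (decay t) * ennreal (u (x + \<delta> * t)) \<partial>lborel) \<le> ennreal (2 * ?W)" .
    qed
    have small: "(\<integral>\<^sup>+t. ennreal (decay t) * ennreal (F2 (x + \<delta> * t)) \<partial>lborel)
        \<le> ennreal (4 * exp (4 * c\<^sub>2) * ?W powr (1 / p x))"
    proof (rule small_values_mean[OF assms(1) majorant_nonneg F2_def refl])
      have "(\<integral>\<^sup>+t. ennreal (decay t) * ennreal (F2 (x + \<delta> * t) powr p (x + \<delta> * t) + tail x + tail (x + \<delta> * t)) \<partial>lborel)
          \<le> (\<integral>\<^sup>+t. ennreal (decay t) * ennreal (\<Phi> (x + \<delta> * t)) + ennreal (decay t) * ennreal (tail x)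
              + ennreal (decay t) * ennreal (tail (x + \<delta> * t)) \<partial>lborel)"
      proof (rule nn_integral_mono)
        fix t
        have "ennreal (F2 (x + \<delta> * t) powr p (x + \<delta> * t) + tail x + tail (x + \<delta> * t))
            \<le> ennreal (\<Phi> (x + \<delta> * t) + tail x + tail (x + \<delta> * t))"
          by (intro ennreal_leI add_right_mono F2_le)
        also have "\<dots> = ennreal (\<Phi> (x + \<delta> * t)) + ennreal (tail x) + ennreal (tail (x + \<delta> * t))"
          using \<Phi>0 tail_pos by (simp add: ennreal_plus less_imp_le)
        finally show "ennreal (decay t) * ennreal (F2 (x + \<delta> * t) powr p (x + \<delta> * t) + tail x + tail (x + \<delta> * t))
          \<le> ennreal (decay t) * ennreal (\<Phi> (x + \<delta> * t)) + ennreal (decay t) * ennreal (tail x)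
              + ennreal (decay t) * ennreal (tail (x + \<delta> * t))"
          by (simp add: mult_left_mono flip: distrib_left)
      qed
      also have "\<dots> = ennreal (decay_mean \<delta> \<Phi> x) + 2 * ennreal (tail x) + ennreal (decay_mean \<delta> tail x)"
        by (simp add: nn_integral_add \<Phi>_mean tail_mean nn_integral_multc nn_integral_decay)
      also have "\<dots> = ennreal (2 * ?W)"
      proof -
        have "2 * ennreal (tail x) = ennreal (2 * tail x)"
          using tail_pos[of x] by (simp add: ennreal_mult)
        then show ?thesis using tail_pos[of x]
          by (simp add: majorant_def \<Phi>_def[abs_def] flip: ennreal_plus)
      qed
      finally show "(\<integral>\<^sup>+t. ennreal (decay t) * ennreal (F2 (x + \<delta> * t) powr p (x + \<delta> * t) + tail x + tail (x + \<delta> * t)) \<partial>lborel) \<le> ennreal (2 * ?W)" .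
    qed
    have "(\<integral>\<^sup>+t. ennreal (decay t * \<bar>f (x + \<delta> * t)\<bar>) \<partial>lborel)
        = (\<integral>\<^sup>+t. ennreal (decay t) * ennreal (F1 (x + \<delta> * t))
             + ennreal (decay t) * ennreal (F2 (x + \<delta> * t)) \<partial>lborel)"
      by (intro nn_integral_cong) (auto simp: F1_def F2_def ennreal_mult)
    also have "\<dots> = (\<integral>\<^sup>+t. ennreal (decay t) * ennreal (F1 (x + \<delta> * t)) \<partial>lborel)
        + (\<integral>\<^sup>+t. ennreal (decay t) * ennreal (F2 (x + \<delta> * t)) \<partial>lborel)"
      by (rule nn_integral_add) measurable
    also have "\<dots> \<le> ennreal (8 * exp c\<^sub>1 * ?W powr (1 / p x))
        + ennreal (4 * exp (4 * c\<^sub>2) * ?W powr (1 / p x))"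
      by (rule add_mono[OF large small])
    also have "\<dots> = ennreal ((8 * exp c\<^sub>1 + 4 * exp (4 * c\<^sub>2)) * ?W powr (1 / p x))"
      by (simp add: distrib_right flip: ennreal_plus)
    also have "\<dots> \<le> ennreal (12 * exp (4 * c\<^sub>3) * ?W powr (1 / p x))"
    proof (intro ennreal_leI mult_right_mono)
      have "exp c\<^sub>1 \<le> exp (4 * c\<^sub>3)" "exp (4 * c\<^sub>2) \<le> exp (4 * c\<^sub>3)"
        using constants_pos c3 by auto
      then show "8 * exp c\<^sub>1 + 4 * exp (4 * c\<^sub>2) \<le> 12 * exp (4 * c\<^sub>3)" by linarith
    qed simp
    finally show ?thesis .
  qed
  show f: "f \<in> tame \<delta>"
    using order.strict_trans1[OF * ennreal_less_top] by (intro tameI) auto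
  show "decay_mean \<delta> f x \<le> 12 * exp (4 * c\<^sub>3) * majorant \<delta> f x powr (1 / p x)"
    using *[of x] unfolding nn_integral_decay_mean[OF f] by (subst (asm) ennreal_le_iff) auto
qed

lemma modular_lborel: "modular p f = (\<integral>\<^sup>+y. ennreal (\<bar>f y\<bar> powr p y) \<partial>lborel)"
  unfolding modular_def by (rule nn_integral_completion)

text \<open>The factor \<open>72\<close> is \<open>12\<close>, from the pointwise bound, times \<open>6\<close>. Since \<open>(1/6)^p \<le> 1/6\<close> and the integral of the
  majorant is at most \<open>3\<close>, the additional factor brings the modular down to at most \<open>1/2\<close>.\<close>

lemma modular_decay_mean:
  assumes f [measurable]: "f \<in> borel_measurable borel" and \<delta>: "0 < \<delta>" and total: "modular p f \<le> 1"
  shows "modular p (\<lambda>x. decay_mean \<delta> f x / (72 * exp (4 * c\<^sub>3))) < 1"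
proof -
  let ?\<Phi> = "\<lambda>y. \<bar>f y\<bar> powr p y"
  have total': "(\<integral>\<^sup>+y. ennreal (?\<Phi> y) \<partial>lborel) \<le> 1" using total by (simp add: modular_lborel)
  have \<Phi>: "?\<Phi> \<in> tame \<delta>"
    using total' \<delta> by (intro integrable_imp_tame) (auto intro: order.strict_trans1)
  have mean: "(\<integral>\<^sup>+x. ennreal (decay_mean \<delta> \<phi> x) \<partial>lborel) \<le> 2"
    if "\<phi> \<in> tame \<delta>" "(\<integral>\<^sup>+y. ennreal \<bar>\<phi> y\<bar> \<partial>lborel) \<le> 1" for \<phi>
  proof -
    have "(\<integral>\<^sup>+x. ennreal (decay_mean \<delta> \<phi> x) \<partial>lborel) = 2 * (\<integral>\<^sup>+y. ennreal \<bar>\<phi> y\<bar> \<partial>lborel)"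
      using nn_integral_decay_mean_total[OF tame_measurable[OF that(1)], of \<delta>]
      by (simp add: nn_integral_decay_mean[OF that(1)])
    also have "\<dots> \<le> 2 * 1" by (intro mult_left_mono that) auto
    finally show ?thesis by simp
  qed
  define a b :: real where "a = 1 / 12" and "b = 1 / 6"
  have ab: "0 \<le> a" "0 \<le> b" by (simp_all add: a_def b_def)
  have "modular p (\<lambda>x. decay_mean \<delta> f x / (72 * exp (4 * c\<^sub>3)))
      \<le> (\<integral>\<^sup>+x. ennreal a * ennreal (decay_mean \<delta> ?\<Phi> x) + ennreal b * ennreal (tail x)
          + ennreal a * ennreal (decay_mean \<delta> tail x) \<partial>lborel)"
    unfolding modular_lborel
  proof (rule nn_integral_mono)
    fix x
    let ?W = "majorant \<delta> f x"
    have "\<bar>decay_mean \<delta> f x / (72 * exp (4 * c\<^sub>3))\<bar> \<le> b * ?W powr (1 / p x)"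
      using decay_mean_pointwise(2)[OF f \<delta> total', of x] by (simp add: b_def field_simps)
    then have "\<bar>decay_mean \<delta> f x / (72 * exp (4 * c\<^sub>3))\<bar> powr p x \<le> (b * ?W powr (1 / p x)) powr p x"
      using exponent_pos[of x] by (intro powr_mono2) auto
    also have "\<dots> = b powr p x * ?W"
      using exponent_pos[of x] majorant_nonneg[of \<delta> f x] ab by (simp add: powr_mult powr_powr)
    also have "\<dots> \<le> b powr 1 * ?W"
      using ge_1[of x] by (intro mult_right_mono powr_mono' majorant_nonneg) (auto simp: b_def)
    also have "\<dots> = a * decay_mean \<delta> ?\<Phi> x + b * tail x + a * decay_mean \<delta> tail x"
      by (simp add: majorant_def a_def b_def)
    finally have "ennreal (\<bar>decay_mean \<delta> f x / (72 * exp (4 * c\<^sub>3))\<bar> powr p x)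
        \<le> ennreal (a * decay_mean \<delta> ?\<Phi> x + b * tail x + a * decay_mean \<delta> tail x)"
      by (rule ennreal_leI)
    then show "ennreal (\<bar>decay_mean \<delta> f x / (72 * exp (4 * c\<^sub>3))\<bar> powr p x)
        \<le> ennreal a * ennreal (decay_mean \<delta> ?\<Phi> x) + ennreal b * ennreal (tail x)
          + ennreal a * ennreal (decay_mean \<delta> tail x)"
      using ab by (simp add: ennreal_plus ennreal_mult)
  qed
  also have "\<dots> = ennreal a * (\<integral>\<^sup>+x. ennreal (decay_mean \<delta> ?\<Phi> x) \<partial>lborel)
      + ennreal b * (\<integral>\<^sup>+x. ennreal (tail x) \<partial>lborel)
      + ennreal a * (\<integral>\<^sup>+x. ennreal (decay_mean \<delta> tail x) \<partial>lborel)"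
    by (simp add: nn_integral_add nn_integral_cmult)
  also have "\<dots> \<le> ennreal a * ennreal 2 + ennreal b * ennreal 1 + ennreal a * ennreal 2"
    using mean[OF \<Phi>] mean[OF tail_tame] total' nn_integral_tail
    by (intro add_mono mult_left_mono) auto
  also have "\<dots> = ennreal (a * 2 + b * 1 + a * 2)"
    using ab by (simp only: ennreal_plus ennreal_mult mult_nonneg_nonneg add_nonneg_nonneg zero_le_numeral zero_le_one)
  also have "\<dots> < ennreal 1" by (rule ennreal_lessI) (auto simp: a_def b_def)
  finally show ?thesis by simp
qed

lemma Lp_tame:
  assumes f: "f \<in> borel_measurable borel" "f \<in> Lp_space p" and \<delta>: "0 < \<delta>"
  shows "f \<in> tame \<delta>"
proof -
  obtain \<eta> where \<eta>: "0 < \<eta>" "modular p (\<lambda>x. f x / \<eta>) < 1" using Lp_norm_set_nonempty[OF f(2)] by blast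
  have "(\<lambda>x. f x / \<eta>) \<in> tame \<delta>"
    using \<eta>(2) f(1) by (intro decay_mean_pointwise(1)[OF _ \<delta>]) (auto simp: modular_lborel less_imp_le)
  then show ?thesis using tame_cmult[of "\<lambda>x. f x / \<eta>" \<delta> \<eta>] \<eta>(1) by simp
qed

lemma Lp_decay_mean:
  assumes f: "f \<in> borel_measurable borel" "f \<in> Lp_space p" and \<delta>: "0 < \<delta>"
  shows "decay_mean \<delta> f \<in> Lp_space p"
    and "Lp_norm p (decay_mean \<delta> f) \<le> 72 * exp (4 * c\<^sub>3) * Lp_norm p f"
proof -
  note [measurable] = f(1)
  have *: "modular p (\<lambda>x. decay_mean \<delta> f x / (72 * exp (4 * c\<^sub>3) * \<eta>)) < 1"
    if \<eta>: "0 < \<eta>" "modular p (\<lambda>x. f x / \<eta>) < 1" for \<eta>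
  proof -
    have "decay_mean \<delta> (\<lambda>x. f x / \<eta>) x = decay_mean \<delta> f x / \<eta>" for x
      using decay_mean_cmult[of \<delta> "1 / \<eta>" f x] \<eta>(1) by simp
    then show ?thesis
      using modular_decay_mean[of "\<lambda>x. f x / \<eta>" \<delta>] \<delta> \<eta> by (simp add: less_imp_le mult.commute)
  qed
  show "decay_mean \<delta> f \<in> Lp_space p"
  proof -
    obtain \<eta> where \<eta>: "0 < \<eta>" "modular p (\<lambda>x. f x / \<eta>) < 1" using Lp_norm_set_nonempty[OF f(2)] by blast
    show ?thesis
      by (rule Lp_spaceI[of _ "72 * exp (4 * c\<^sub>3) * \<eta>"])
         (use \<eta> *[OF \<eta>] in \<open>auto intro: order.strict_trans measurable_completion\<close>)
  qed
  show "Lp_norm p (decay_mean \<delta> f) \<le> 72 * exp (4 * c\<^sub>3) * Lp_norm p f"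
    using * by (intro Lp_norm_le_scaled[OF f(2)] Lp_norm_le) auto
qed

text \<open>Here the bound for \<open>decay_mean\<close> is spent: pointwise domination with moment \<open>m\<close> costs \<open>m\<close> times a constant
  that no longer depends on the operator, and \<open>217 = 1 + 3 \<times> 72\<close>.\<close>

lemma Lp_dominated:
  assumes dom: "dominated \<delta> m h f" and f: "f \<in> borel_measurable borel" "f \<in> Lp_space p" and \<delta>: "0 < \<delta>"
  shows "h \<in> Lp_space p" and "Lp_norm p h \<le> m * (217 * exp (4 * c\<^sub>3)) * Lp_norm p f"
proof -
  have m: "0 \<le> m" using dom unfolding dominated_def by auto
  have h [measurable]: "h \<in> borel_measurable lebesgue"
    using tame_measurable[OF dominated_tame[OF dom]] by (simp add: measurable_completion)
  have [measurable]: "f \<in> borel_measurable lebesgue" using Lp_space_measurable[OF f(2)] .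
  have absf: "(\<lambda>x. \<bar>f x\<bar>) \<in> Lp_space p" "Lp_norm p (\<lambda>x. \<bar>f x\<bar>) \<le> Lp_norm p f"
    using Lp_mono_AE[OF f(2), of "\<lambda>x. \<bar>f x\<bar>"] by auto
  note mean = Lp_decay_mean[OF f \<delta>]
  note mean3 = Lp_cmult[OF mean(1), of 3]
  note sum = Lp_add[OF absf(1) mean3(1)]
  note total = Lp_cmult[OF sum(1), of m]
  have le: "AE x in lebesgue. \<bar>h x\<bar> \<le> \<bar>m * (\<bar>f x\<bar> + 3 * decay_mean \<delta> f x)\<bar>"
    using order_trans[OF dominated_bound[OF dom] abs_ge_self] by (intro AE_I2)
  show "h \<in> Lp_space p" by (rule Lp_mono_AE(1)[OF total(1) h le])
  have "Lp_norm p h \<le> m * Lp_norm p (\<lambda>x. \<bar>f x\<bar> + 3 * decay_mean \<delta> f x)"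
    using Lp_mono_AE(2)[OF total(1) h le] total(2) m by simp
  also have "Lp_norm p (\<lambda>x. \<bar>f x\<bar> + 3 * decay_mean \<delta> f x)
      \<le> Lp_norm p f + 3 * (72 * exp (4 * c\<^sub>3) * Lp_norm p f)"
    using sum(2) absf(2) mean3(2) mean(2) by simp
  also have "\<dots> \<le> 217 * exp (4 * c\<^sub>3) * Lp_norm p f"
    using Lp_norm_nonneg[OF f(2)] constants_pos mult_right_mono[of 1 "exp (4 * c\<^sub>3)" "Lp_norm p f"]
    by (simp add: mult.commute)
  finally show "Lp_norm p h \<le> m * (217 * exp (4 * c\<^sub>3)) * Lp_norm p f"
    using m by (simp add: mult_left_mono mult.assoc)
qed

end

section \<open>Derivatives of exponential averages\<close>

text \<open>The average at a later point is obtained from the average at \<open>x\<close> by removing an integral over a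
  bounded interval, to which the fundamental theorem of calculus applies.\<close>

lemma exp_average_extrapolate:
  assumes f: "f \<in> tame \<delta>" and h: "0 \<le> h"
  shows "average \<delta> exp_kernel f (x + \<delta> * h)
    = exp h * (average \<delta> exp_kernel f x - integral {0..h} (\<lambda>t. exp (- t) * f (x + \<delta> * t)))"
    and "(\<lambda>t. exp (- t) * f (x + \<delta> * t)) integrable_on {0..h}"
proof -
  note [measurable] = tame_measurable[OF f]
  let ?g = "\<lambda>t. exp_kernel t * f (x + \<delta> * t)"
  have int: "integrable lborel ?g" by (rule kernel_integrable[OF kernel_exp f])
  have si: "set_integrable lborel A ?g" if "A \<in> sets borel" for A
    unfolding set_integrable_def using int that by (intro integrable_mult_indicator) auto
  have eq: "set_lebesgue_integral lborel {0..h} ?g = integral {0..h} (\<lambda>t. exp (- t) * f (x + \<delta> * t))"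
  proof -
    have "integral {0..h} ?g = integral {0..h} (\<lambda>t. exp (- t) * f (x + \<delta> * t))"
      by (intro integral_cong) (simp add: exp_kernel_def)
    then show ?thesis using set_borel_integral_eq_integral(2)[OF si, of "{0..h}"] by simp
  qed
  have "?g integrable_on {0..h}" using set_borel_integral_eq_integral(1)[OF si, of "{0..h}"] by simp
  then show "(\<lambda>t. exp (- t) * f (x + \<delta> * t)) integrable_on {0..h}"
    by (rule integrable_eq) (simp add: exp_kernel_def)
  have "average \<delta> exp_kernel f x = (LINT t|lborel. indicator {0..h} t * ?g t + indicator {h<..} t * ?g t)"
    unfolding average_def using h
    by (intro Bochner_Integration.integral_cong) (auto simp: exp_kernel_def indicator_def)
  then have split: "average \<delta> exp_kernel f x
      = set_lebesgue_integral lborel {0..h} ?g + set_lebesgue_integral lborel {h<..} ?g"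
    unfolding set_lebesgue_integral_def using si[of "{0..h}"] si[of "{h<..}"]
    by (simp add: set_integrable_def)
  have "set_lebesgue_integral lborel {h<..} ?g
      = (LINT t|lborel. indicator {h<..} (h + t) * ?g (h + t))"
    unfolding set_lebesgue_integral_def
    by (subst lborel_integral_real_affine[where c = 1 and t = h]) auto
  also have "\<dots> = (LINT t|lborel. exp (- h) * (exp_kernel t * f (x + \<delta> * h + \<delta> * t)))"
  proof (rule integral_cong_AE)
    show "AE t in lborel. indicator {h<..} (h + t) * ?g (h + t)
        = exp (- h) * (exp_kernel t * f (x + \<delta> * h + \<delta> * t))"
      using AE_lborel_singleton[of 0]
    proof eventually_elim
      case (elim t)
      have "x + \<delta> * (h + t) = x + \<delta> * h + \<delta> * t" "exp (- (h + t)) = exp (- h) * exp (- t)"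
        by (simp_all add: distrib_left flip: exp_add)
      then show ?case using elim h by (cases "0 \<le> t") (auto simp: exp_kernel_def add.assoc)
    qed
    have "(\<lambda>t. f (x + \<delta> * (h + t))) \<in> borel_measurable borel"
      "(\<lambda>t. f (x + \<delta> * h + \<delta> * t)) \<in> borel_measurable borel" by measurable
    then show "(\<lambda>t. indicator {h<..} (h + t) * ?g (h + t)) \<in> borel_measurable lborel"
      "(\<lambda>t. exp (- h) * (exp_kernel t * f (x + \<delta> * h + \<delta> * t))) \<in> borel_measurable lborel"
      by (auto intro!: borel_measurable_times)
  qed
  also have "\<dots> = exp (- h) * average \<delta> exp_kernel f (x + \<delta> * h)"
    by (simp add: average_def)
  finally have "average \<delta> exp_kernel f x = integral {0..h} (\<lambda>t. exp (- t) * f (x + \<delta> * t))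
      + exp (- h) * average \<delta> exp_kernel f (x + \<delta> * h)" using split eq by linarith
  then show "average \<delta> exp_kernel f (x + \<delta> * h)
    = exp h * (average \<delta> exp_kernel f x - integral {0..h} (\<lambda>t. exp (- t) * f (x + \<delta> * t)))"
    by (simp add: exp_minus field_simps)
qed

text \<open>The base point \<open>x - \<delta>\<close> lies to the left of \<open>x\<close>, so the formula holds on both sides of \<open>x\<close>.\<close>

lemma exp_average_near:
  assumes f: "f \<in> tame \<delta>" and \<delta>: "0 < \<delta>"
  shows "eventually (\<lambda>y. average \<delta> exp_kernel f y = exp ((y - (x - \<delta>)) / \<delta>)
    * (average \<delta> exp_kernel f (x - \<delta>)
       - integral {0..(y - (x - \<delta>)) / \<delta>} (\<lambda>t. exp (- t) * f (x - \<delta> + \<delta> * t)))) (nhds x)"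
proof -
  have "eventually (\<lambda>y. y \<in> {x - \<delta><..}) (nhds x)"
    using \<delta> by (intro eventually_nhds_in_open) auto
  then show ?thesis
  proof eventually_elim
    case (elim y)
    have "x - \<delta> + \<delta> * ((y - (x - \<delta>)) / \<delta>) = y" using \<delta> by simp
    then show ?case
      using exp_average_extrapolate(1)[OF f, of "(y - (x - \<delta>)) / \<delta>" "x - \<delta>"] elim \<delta> by simp
  qed
qed

lemma isCont_exp_average:
  assumes f: "f \<in> tame \<delta>" and \<delta>: "0 < \<delta>"
  shows "isCont (average \<delta> exp_kernel f) x"
proof -
  let ?H = "\<lambda>h. integral {0..h} (\<lambda>t. exp (- t) * f (x - \<delta> + \<delta> * t))"
  have "continuous_on {0..2} ?H"
    by (intro indefinite_integral_continuous_1 exp_average_extrapolate(2)[OF f]) simp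
  then have H: "isCont ?H 1" by (rule continuous_on_interior) simp
  have inner: "isCont (\<lambda>y. (y - (x - \<delta>)) / \<delta>) x" using \<delta> by (intro continuous_intros) auto
  have "isCont (\<lambda>y. ?H ((y - (x - \<delta>)) / \<delta>)) x"
    by (rule isCont_o2[OF inner]) (use H \<delta> in simp)
  then have "isCont (\<lambda>y. exp ((y - (x - \<delta>)) / \<delta>) * (average \<delta> exp_kernel f (x - \<delta>) - ?H ((y - (x - \<delta>)) / \<delta>))) x"
    by (intro isCont_mult isCont_diff isCont_o2[OF inner isCont_exp] continuous_const)
  then show ?thesis
    using isCont_cong[OF exp_average_near[OF f \<delta>, of x]] by simp
qed

lemma exp_average_has_derivative:
  assumes f: "f \<in> tame \<delta>" and \<delta>: "0 < \<delta>" and cont: "\<And>x. isCont f x"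
  shows "(average \<delta> exp_kernel f has_real_derivative - 1 / \<delta> * residual \<delta> exp_kernel f x) (at x)"
proof -
  let ?g = "\<lambda>t. exp (- t) * f (x - \<delta> + \<delta> * t)"
  let ?H = "\<lambda>h. integral {0..h} ?g" and ?A = "average \<delta> exp_kernel f (x - \<delta>)"
  have "continuous_on {0..2} ?g"
  proof (intro continuous_at_imp_continuous_on ballI isCont_mult)
    show "isCont (\<lambda>t. f (x - \<delta> + \<delta> * t)) t" for t
      by (rule isCont_o2[OF _ cont]) (intro continuous_intros)
    show "isCont (\<lambda>t. exp (- t)) t" for t :: real by (intro continuous_intros)
  qed
  then have "(?H has_real_derivative ?g 1) (at 1 within {0..2})"
    by (rule integral_has_real_derivative) simp
  then have H: "(?H has_real_derivative ?g 1) (at 1)"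
    by (simp add: at_within_Icc_at)
  have inner: "((\<lambda>y. (y - (x - \<delta>)) / \<delta>) has_real_derivative 1 / \<delta>) (at x)"
    using \<delta> by (auto intro!: derivative_eq_intros)
  have "((\<lambda>y. ?H ((y - (x - \<delta>)) / \<delta>)) has_real_derivative ?g 1 * (1 / \<delta>)) (at x)"
    by (rule DERIV_chain2[where g = "\<lambda>y. (y - (x - \<delta>)) / \<delta>", OF _ inner]) (use H \<delta> in simp)
  then have D: "((\<lambda>y. exp ((y - (x - \<delta>)) / \<delta>) * (?A - ?H ((y - (x - \<delta>)) / \<delta>)))
      has_real_derivative exp 1 * (1 / \<delta>) * (?A - ?H 1) + (0 - ?g 1 * (1 / \<delta>)) * exp 1) (at x)"
    using \<delta> by (auto intro!: derivative_eq_intros inner)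
  have val: "exp 1 * (1 / \<delta>) * (?A - ?H 1) + (0 - ?g 1 * (1 / \<delta>)) * exp 1
      = - 1 / \<delta> * residual \<delta> exp_kernel f x"
  proof -
    have "average \<delta> exp_kernel f x = exp 1 * (?A - ?H 1)"
      using exp_average_extrapolate(1)[OF f, of 1 "x - \<delta>"] by simp
    moreover have "exp 1 * ?g 1 = f x" by (simp add: exp_minus)
    moreover have "exp 1 * (1 / \<delta>) * (?A - ?H 1) + (0 - ?g 1 * (1 / \<delta>)) * exp 1
        = 1 / \<delta> * (exp 1 * (?A - ?H 1) - exp 1 * ?g 1)" by (simp only: algebra_simps)
    ultimately show ?thesis by (simp only: residual_def) (simp add: algebra_simps)
  qed
  show ?thesis
    using DERIV_cong_ev[THEN iffD2, OF refl exp_average_near[OF f \<delta>, of x] refl DERIV_cong[OF D val]] .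
qed

lemma isCont_residual_power:
  assumes "f \<in> tame \<delta>" "0 < \<delta>" "\<And>x. isCont f x"
  shows "isCont ((residual \<delta> exp_kernel ^^ n) f) x"
proof (induction n arbitrary: x)
  case (Suc n)
  have "(residual \<delta> exp_kernel ^^ n) f \<in> tame \<delta>"
    by (rule residual_power_tame[OF assms(1) kernel_exp])
  then have "isCont (\<lambda>x. (residual \<delta> exp_kernel ^^ n) f x
      - average \<delta> exp_kernel ((residual \<delta> exp_kernel ^^ n) f) x) x"
    by (intro isCont_diff Suc isCont_exp_average assms(2))
  then show ?case by (simp flip: residual_eq)
qed (use assms in auto)

lemma exp_power_tame: "f \<in> tame \<delta> \<Longrightarrow> (average \<delta> exp_kernel ^^ n) f \<in> tame \<delta>"
  by (induction n) (auto intro: decay_mean_average(1)[OF kernel_exp])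

text \<open>Each derivative turns one factor \<open>E\<close> into \<open>- (I - E) / \<delta>\<close>. One more factor \<open>E\<close> than derivatives is kept, so
  that only continuous functions are differentiated.\<close>

lemma exp_power_derivatives:
  assumes f: "f \<in> tame \<delta>" and \<delta>: "0 < \<delta>" and k: "k \<le> r"
  shows "(deriv ^^ k) ((average \<delta> exp_kernel ^^ Suc r) f)
      = (\<lambda>x. (- 1 / \<delta>) ^ k * (residual \<delta> exp_kernel ^^ k) ((average \<delta> exp_kernel ^^ (Suc r - k)) f) x)"
    and "k < r \<Longrightarrow> ((deriv ^^ k) ((average \<delta> exp_kernel ^^ Suc r) f)
      has_real_derivative (deriv ^^ Suc k) ((average \<delta> exp_kernel ^^ Suc r) f) x) (at x)"
proof -
  let ?E = "average \<delta> exp_kernel" and ?D = "residual \<delta> exp_kernel"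
  have step: "((\<lambda>x. (- 1 / \<delta>) ^ k * (?D ^^ k) ((?E ^^ (Suc r - k)) f) x) has_real_derivative
      (- 1 / \<delta>) ^ Suc k * (?D ^^ Suc k) ((?E ^^ (Suc r - Suc k)) f) x) (at x)" if k: "k < r" for k x
  proof -
    define \<phi> where "\<phi> = (?E ^^ (r - k)) f"
    have t: "\<phi> \<in> tame \<delta>" unfolding \<phi>_def by (rule exp_power_tame[OF f])
    have c: "isCont \<phi> x" for x
    proof -
      have "\<phi> = ?E ((?E ^^ (r - Suc k)) f)" using k unfolding \<phi>_def by (metis Suc_diff_Suc comp_apply funpow.simps(2))
      then show ?thesis using isCont_exp_average[OF exp_power_tame[OF f] \<delta>] by simp
    qed
    have "(?E ^^ (Suc r - k)) f = ?E \<phi>" using k by (simp add: Suc_diff_le \<phi>_def)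
    then have eq: "(?D ^^ k) ((?E ^^ (Suc r - k)) f) = ?E ((?D ^^ k) \<phi>)"
      using multiplier_commute_powers(2)[OF multiplier_exp t] by simp
    have Dt: "(?D ^^ k) \<phi> \<in> tame \<delta>" by (rule residual_power_tame[OF t kernel_exp])
    have "((\<lambda>x. (- 1 / \<delta>) ^ k * ?E ((?D ^^ k) \<phi>) x) has_real_derivative
        (- 1 / \<delta>) ^ k * (- 1 / \<delta> * ?D ((?D ^^ k) \<phi>) x)) (at x)"
      by (intro DERIV_cmult exp_average_has_derivative[OF Dt \<delta>] isCont_residual_power[OF t \<delta> c])
    then show ?thesis unfolding eq by (simp add: \<phi>_def mult.assoc)
  qed
  have main: "(deriv ^^ k) ((?E ^^ Suc r) f)
      = (\<lambda>x. (- 1 / \<delta>) ^ k * (?D ^^ k) ((?E ^^ (Suc r - k)) f) x)" if "k \<le> r" for k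
    using that
  proof (induction k)
    case (Suc k)
    then have "(deriv ^^ Suc k) ((?E ^^ Suc r) f)
        = deriv (\<lambda>x. (- 1 / \<delta>) ^ k * (?D ^^ k) ((?E ^^ (Suc r - k)) f) x)" by simp
    also have "\<dots> = (\<lambda>x. (- 1 / \<delta>) ^ Suc k * (?D ^^ Suc k) ((?E ^^ (Suc r - Suc k)) f) x)"
      using step[of k] Suc.prems by (intro ext DERIV_imp_deriv) auto
    finally show ?case .
  qed simp
  show "(deriv ^^ k) ((?E ^^ Suc r) f)
      = (\<lambda>x. (- 1 / \<delta>) ^ k * (?D ^^ k) ((?E ^^ (Suc r - k)) f) x)" by (rule main[OF k])
  show "((deriv ^^ k) ((?E ^^ Suc r) f) has_real_derivative (deriv ^^ Suc k) ((?E ^^ Suc r) f) x) (at x)"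
    if "k < r" using step[OF that] main[of k] main[of "Suc k"] that by simp
qed

section \<open>Primitives of functions in the space\<close>

context log_Hoelder_exponent
begin

text \<open>A function in the space is integrable where it is large, because there \<open>|g| \<le> |g|^p\<close> up to scaling.\<close>

lemma Lp_excess_small:
  assumes g: "g \<in> borel_measurable borel" "g \<in> Lp_space p" and \<epsilon>: "0 < \<epsilon>"
  obtains M where "0 \<le> M" "(\<integral>\<^sup>+x. ennreal (max 0 (\<bar>g x\<bar> - M)) \<partial>lborel) < ennreal \<epsilon>"
proof -
  note [measurable] = g(1)
  obtain l where l: "0 < l" "modular p (\<lambda>x. g x / l) < 1" using Lp_norm_set_nonempty[OF g(2)] by blast
  define \<psi> where "\<psi> x = l * \<bar>g x / l\<bar> powr p x" for x
  have [measurable]: "\<psi> \<in> borel_measurable borel" unfolding \<psi>_def by measurable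
  have \<psi>0: "0 \<le> \<psi> x" for x using l by (simp add: \<psi>_def)
  have "(\<lambda>x. ennreal (\<bar>g x / l\<bar> powr p x)) \<in> borel_measurable borel" by measurable
  then have m: "(\<lambda>x. ennreal (\<bar>g x / l\<bar> powr p x)) \<in> borel_measurable lborel" by simp
  have "(\<integral>\<^sup>+x. ennreal (\<psi> x) \<partial>lborel) = ennreal l * modular p (\<lambda>x. g x / l)"
    unfolding modular_lborel \<psi>_def nn_integral_cmult[OF m, symmetric] using l by (simp add: ennreal_mult)
  also have "\<dots> < \<infinity>" using l by (simp add: ennreal_mult_less_top order.strict_trans)
  finally have \<psi>fin: "(\<integral>\<^sup>+x. ennreal (\<psi> x) \<partial>lborel) < \<infinity>" .
  define s where "s n x = max 0 (\<bar>g x\<bar> - (l + real n))" for n x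
  have s_le: "s n x \<le> \<psi> x" for n x
  proof (cases "l < \<bar>g x\<bar>")
    case True
    then have "\<bar>g x / l\<bar> powr 1 \<le> \<bar>g x / l\<bar> powr p x"
      using l ge_1[of x] by (intro powr_mono) auto
    then have "\<bar>g x\<bar> \<le> \<psi> x" using l by (simp add: \<psi>_def field_simps)
    then show ?thesis using \<psi>0[of x] l by (auto simp: s_def)
  qed (use \<psi>0[of x] in \<open>auto simp: s_def\<close>)
  have lim: "(\<lambda>n. s n x) \<longlonglongrightarrow> 0" for x
  proof (rule tendsto_eventually)
    obtain N where "\<bar>g x\<bar> < real N" using reals_Archimedean2 by blast
    then show "eventually (\<lambda>n. s n x = 0) sequentially"
      using l unfolding s_def by (intro eventually_sequentiallyI[of N]) auto
  qed
  have "(\<lambda>n. \<integral>\<^sup>+x. ennreal (s n x) \<partial>lborel) \<longlonglongrightarrow> (\<integral>\<^sup>+x. ennreal 0 \<partial>(lborel :: real measure))"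
  proof (rule nn_integral_dominated_convergence[where w = "\<lambda>x. ennreal (\<psi> x)"])
    show "AE x in lborel. ennreal (s j x) \<le> ennreal (\<psi> x)" for j
      using s_le by (intro AE_I2 ennreal_leI)
    show "AE x in lborel. (\<lambda>n. ennreal (s n x)) \<longlonglongrightarrow> ennreal 0"
      using lim by (intro AE_I2 tendsto_ennrealI)
  qed (use \<psi>fin in \<open>auto simp: s_def\<close>)
  then have "eventually (\<lambda>n. (\<integral>\<^sup>+x. ennreal (s n x) \<partial>lborel) < ennreal \<epsilon>) sequentially"
    using \<epsilon> by (intro order_tendstoD(2)) auto
  then obtain n where "(\<integral>\<^sup>+x. ennreal (s n x) \<partial>lborel) < ennreal \<epsilon>"
    by (auto simp: eventually_sequentially)
  then show thesis using that[of "l + real n"] l by (simp add: s_def)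
qed

text \<open>Absolute continuity is required uniformly on the whole line, where \<open>g\<close> need not be integrable: the part
  of \<open>|g|\<close> below a level \<open>M\<close> contributes \<open>M\<close> times the total length, the excess over \<open>M\<close> has a small integral.\<close>

lemma abs_continuous_primitive:
  assumes g: "g \<in> Lp_space p" and cont: "\<And>x. isCont g x"
    and F: "\<And>x. (F has_real_derivative g x) (at x)"
  shows "abs_continuous F"
  unfolding abs_continuous_def
proof (intro allI impI)
  fix \<epsilon> :: real assume \<epsilon>: "0 < \<epsilon>"
  have gm [measurable]: "g \<in> borel_measurable borel"
    using cont by (intro borel_measurable_continuous_onI continuous_at_imp_continuous_on) auto
  obtain M where M: "0 \<le> M" "(\<integral>\<^sup>+x. ennreal (max 0 (\<bar>g x\<bar> - M)) \<partial>lborel) < ennreal (\<epsilon> / 2)"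
    using Lp_excess_small[OF gm g, of "\<epsilon> / 2"] \<epsilon> by auto
  define k where "k x = max 0 (\<bar>g x\<bar> - M)" for x
  have k0: "0 \<le> k x" for x by (simp add: k_def)
  have [measurable]: "k \<in> borel_measurable borel" unfolding k_def by measurable
  have one: "ennreal \<bar>F b - F a\<bar> \<le> ennreal (M * (b - a)) + (\<integral>\<^sup>+x. ennreal (k x) * indicator {a<..<b} x \<partial>lborel)"
    if ab: "a < b" for a b
  proof -
    have int: "integrable lborel (\<lambda>x. g x * indicator {a..b} x)"
      using borel_integrable_atLeastAtMost[of a b g] cont by (simp add: mult.commute)
    have "F b - F a = (LINT x|lborel. g x * indicator {a..b} x)"
      using ab F cont by (intro integral_FTC_Icc_real[symmetric]) auto
    then have "ennreal \<bar>F b - F a\<bar> \<le> (\<integral>\<^sup>+x. ennreal (norm (g x * indicator {a..b} x)) \<partial>lborel)"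
      using integral_norm_bound_ennreal[OF int] by simp
    also have "\<dots> \<le> (\<integral>\<^sup>+x. ennreal M * indicator {a..b} x + ennreal (k x) * indicator {a<..<b} x \<partial>lborel)"
    proof (rule nn_integral_mono_AE)
      show "AE x in lborel. ennreal (norm (g x * indicator {a..b} x))
          \<le> ennreal M * indicator {a..b} x + ennreal (k x) * indicator {a<..<b} x"
        using AE_lborel_singleton[of a] AE_lborel_singleton[of b]
      proof eventually_elim
        case (elim x)
        have "ennreal \<bar>g x\<bar> \<le> ennreal (M + k x)" by (intro ennreal_leI) (auto simp: k_def)
        then show ?case using elim M(1) k0[of x] by (auto simp: indicator_def ennreal_plus)
      qed
    qed
    also have "\<dots> = ennreal (M * (b - a)) + (\<integral>\<^sup>+x. ennreal (k x) * indicator {a<..<b} x \<partial>lborel)"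
      using ab M(1) by (subst nn_integral_add) (auto simp: nn_integral_cmult_indicator ennreal_mult)
    finally show ?thesis .
  qed
  show "\<exists>\<eta>>0. \<forall>D. finite D \<and> (\<forall>(a, b)\<in>D. a < b) \<and>
      pairwise (\<lambda>(a, b) (c, d). disjnt {a<..<b} {c<..<d}) D \<and> (\<Sum>(a, b)\<in>D. b - a) < \<eta>
      \<longrightarrow> (\<Sum>(a, b)\<in>D. \<bar>F b - F a\<bar>) < \<epsilon>"
  proof (intro exI[of _ "\<epsilon> / (2 * (M + 1))"] conjI allI impI)
    show "0 < \<epsilon> / (2 * (M + 1))" using \<epsilon> M(1) by simp
    fix D :: "(real \<times> real) set"
    assume D: "finite D \<and> (\<forall>(a, b)\<in>D. a < b) \<and>
      pairwise (\<lambda>(a, b) (c, d). disjnt {a<..<b} {c<..<d}) D \<and> (\<Sum>(a, b)\<in>D. b - a) < \<epsilon> / (2 * (M + 1))"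
    have disj: "disjoint_family_on (\<lambda>z. {fst z<..<snd z}) D"
      using D unfolding disjoint_family_on_def pairwise_def disjnt_def by (auto simp: case_prod_beta)
    have len0: "0 \<le> (\<Sum>z\<in>D. snd z - fst z)" using D by (intro sum_nonneg) (auto simp: less_imp_le)
    have "ennreal (\<Sum>z\<in>D. \<bar>F (snd z) - F (fst z)\<bar>) = (\<Sum>z\<in>D. ennreal \<bar>F (snd z) - F (fst z)\<bar>)"
      by (rule sum_ennreal[symmetric]) simp
    also have "\<dots> \<le> (\<Sum>z\<in>D. ennreal (M * (snd z - fst z))
        + (\<integral>\<^sup>+x. ennreal (k x) * indicator {fst z<..<snd z} x \<partial>lborel))"
      using D by (intro sum_mono one) auto
    also have "\<dots> = ennreal (M * (\<Sum>z\<in>D. snd z - fst z))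
        + (\<integral>\<^sup>+x. ennreal (k x) * (\<Sum>z\<in>D. indicator {fst z<..<snd z} x) \<partial>lborel)"
    proof -
      have "(\<Sum>z\<in>D. ennreal (M * (snd z - fst z))) = ennreal (M * (\<Sum>z\<in>D. snd z - fst z))"
        unfolding sum_distrib_left using D M(1) by (intro sum_ennreal) (auto simp: less_imp_le)
      moreover have "(\<Sum>z\<in>D. \<integral>\<^sup>+x. ennreal (k x) * indicator {fst z<..<snd z} x \<partial>lborel)
          = (\<integral>\<^sup>+x. ennreal (k x) * (\<Sum>z\<in>D. indicator {fst z<..<snd z} x) \<partial>lborel)"
        unfolding sum_distrib_left by (rule nn_integral_sum[symmetric]) measurable
      ultimately show ?thesis by (simp add: sum.distrib)
    qed
    also have "\<dots> \<le> ennreal (M * (\<Sum>z\<in>D. snd z - fst z)) + (\<integral>\<^sup>+x. ennreal (k x) \<partial>lborel)"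
    proof (intro add_left_mono nn_integral_mono)
      fix x
      have "(\<Sum>z\<in>D. indicator {fst z<..<snd z} x :: ennreal) = indicator (\<Union>z\<in>D. {fst z<..<snd z}) x"
        using D disj by (intro indicator_UN_disjoint[symmetric]) auto
      then show "ennreal (k x) * (\<Sum>z\<in>D. indicator {fst z<..<snd z} x) \<le> ennreal (k x)"
        by (auto simp: indicator_def)
    qed
    also have "\<dots> < ennreal (\<epsilon> / 2 + \<epsilon> / 2)"
    proof (rule add_mono_ennreal)
      have "M * (\<Sum>z\<in>D. snd z - fst z) \<le> M * (\<epsilon> / (2 * (M + 1)))"
        using D M(1) by (intro mult_left_mono) (auto simp: case_prod_beta)
      also have "\<dots> < \<epsilon> / 2" using M(1) \<epsilon> by (simp add: field_simps)
      finally show "ennreal (M * (\<Sum>z\<in>D. snd z - fst z)) < ennreal (\<epsilon> / 2)"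
        using \<epsilon> by (intro ennreal_lessI) auto
    qed (use M(2) in \<open>simp add: k_def\<close>)
    also have "\<dots> = ennreal \<epsilon>" by simp
    finally show "(\<Sum>(a, b)\<in>D. \<bar>F b - F a\<bar>) < \<epsilon>"
      using \<epsilon> by (simp add: ennreal_less_iff sum_nonneg case_prod_beta)
  qed
qed

end

section \<open>Differences of smooth functions\<close>

lemma box_average_eq:
  assumes \<delta>: "0 < \<delta>" and \<Phi>: "\<And>x. (\<Phi> has_real_derivative G x) (at x)" and G: "\<And>x. isCont G x"
  shows "average \<delta> box_kernel G x = (\<Phi> (x + \<delta>) - \<Phi> x) / \<delta>"
proof -
  have "(LINT t|lborel. G (x + \<delta> * t) * indicator {0..1} t) = \<Phi> (x + \<delta> * 1) / \<delta> - \<Phi> (x + \<delta> * 0) / \<delta>"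
  proof (rule integral_FTC_Icc_real)
    fix t
    show "((\<lambda>t. \<Phi> (x + \<delta> * t) / \<delta>) has_real_derivative G (x + \<delta> * t)) (at t)"
      using \<delta> by (auto intro!: derivative_eq_intros DERIV_chain2[OF \<Phi>])
    show "isCont (\<lambda>t. G (x + \<delta> * t)) t" by (rule isCont_o2[OF _ G]) (intro continuous_intros)
  qed simp
  then show ?thesis by (simp add: average_def box_kernel_def mult.commute diff_divide_distrib)
qed

lemma box_residual_has_derivative:
  assumes \<delta>: "0 < \<delta>" and G: "\<And>x. (G has_real_derivative G' x) (at x)" and G': "\<And>x. isCont G' x"
  shows "(residual \<delta> box_kernel G has_real_derivative residual \<delta> box_kernel G' x) (at x)"
    and "isCont (residual \<delta> box_kernel G') x"
proof -
  have cont: "isCont G x" for x using G DERIV_isCont by blast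
  obtain \<Phi> where \<Phi>: "\<And>x. (\<Phi> has_real_derivative G x) (at x)"
  proof -
    have "\<exists>F. \<forall>x. ereal x > - \<infinity> \<longrightarrow> ereal x < \<infinity> \<longrightarrow> (F has_vector_derivative G x) (at x)"
      by (rule einterval_antiderivative) (use cont in auto)
    then show thesis using that by (auto simp: has_real_derivative_iff_has_vector_derivative)
  qed
  have "((\<lambda>x. G x - (\<Phi> (x + \<delta>) - \<Phi> x) / \<delta>) has_real_derivative G' x - (G (x + \<delta>) - G x) / \<delta>) (at x)"
    using \<delta> by (auto intro!: derivative_eq_intros G \<Phi> DERIV_chain2[OF \<Phi>])
  then show "(residual \<delta> box_kernel G has_real_derivative residual \<delta> box_kernel G' x) (at x)"
    unfolding residual_eq using box_average_eq[OF \<delta> \<Phi> cont] box_average_eq[OF \<delta> G G'] by simp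
  have "isCont (\<lambda>x. G (x + \<delta>)) x" by (rule isCont_o2[OF _ cont]) (intro continuous_intros)
  then have "isCont (\<lambda>x. G' x - (G (x + \<delta>) - G x) / \<delta>) x"
    using \<delta> by (intro isCont_diff isCont_divide G' cont continuous_const) auto
  then show "isCont (residual \<delta> box_kernel G') x"
    unfolding residual_eq using box_average_eq[OF \<delta> G G'] by simp
qed

text \<open>Up to the factor \<open>- \<delta>\<close>, both sides are integrals of \<open>h (x + \<delta> s)\<close> over the triangle \<open>0 \<le> s \<le> t \<le> 1\<close>.\<close>

lemma box_residual_primitive:
  assumes \<delta>: "0 < \<delta>" and [measurable]: "h \<in> borel_measurable borel"
    and int: "\<And>x y. x \<le> y \<Longrightarrow> set_integrable lborel {x..y} h"
    and F: "\<And>x y. x \<le> y \<Longrightarrow> F y - F x = (LINT t:{x..y}|lborel. h t)"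
    and cont: "\<And>x. isCont F x"
  shows "residual \<delta> box_kernel F = (\<lambda>x. - \<delta> * average \<delta> coramp_kernel h x)"
proof
  fix x
  let ?h = "\<lambda>s. h (x + \<delta> * s)"
  have hint: "integrable lborel (\<lambda>s. box_kernel s * ?h s)"
  proof -
    have "integrable lborel (\<lambda>y. indicator {x..x+\<delta>} y * h y)"
      using int[of x "x + \<delta>"] \<delta> by (simp add: set_integrable_def)
    then have "integrable lborel (\<lambda>s. indicator {x..x+\<delta>} (x + \<delta> * s) * ?h s)"
      by (rule lborel_integrable_real_affine) (use \<delta> in auto)
    then show ?thesis
      by (rule Bochner_Integration.integrable_cong[THEN iffD1, rotated -1])
         (use \<delta> in \<open>auto simp: box_kernel_def indicator_def mult_le_cancel_left1 zero_le_mult_iff\<close>)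
  qed
  have incr: "F (x + \<delta> * t) - F x = \<delta> * (LINT s|lborel. indicator {0..t} s * ?h s)" if "0 \<le> t" for t
  proof -
    have "F (x + \<delta> * t) - F x = (LINT y|lborel. indicator {x..x + \<delta> * t} y * h y)"
      using F[of x "x + \<delta> * t"] \<delta> that by (simp add: set_lebesgue_integral_def)
    also have "\<dots> = \<delta> * (LINT s|lborel. indicator {x..x + \<delta> * t} (x + \<delta> * s) * ?h s)"
      by (subst lborel_integral_real_affine[where c = \<delta> and t = x]) (use \<delta> in auto)
    also have "(LINT s|lborel. indicator {x..x + \<delta> * t} (x + \<delta> * s) * ?h s)
        = (LINT s|lborel. indicator {0..t} s * ?h s)"
      using \<delta> by (intro Bochner_Integration.integral_cong) (auto simp: indicator_def zero_le_mult_iff)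
    finally show ?thesis .
  qed
  let ?\<phi> = "\<lambda>(t, s). box_kernel t * (indicator {0..t} s * ?h s)"
  have pair: "integrable (lborel \<Otimes>\<^sub>M lborel) ?\<phi>"
  proof (rule Bochner_Integration.integrable_bound)
    have "(\<integral>\<^sup>+z. ennreal (norm (case z of (t, s) \<Rightarrow> box_kernel t * (box_kernel s * ?h s))) \<partial>(lborel \<Otimes>\<^sub>M lborel))
        = (\<integral>\<^sup>+t. \<integral>\<^sup>+s. ennreal (norm (box_kernel t * (box_kernel s * ?h s))) \<partial>lborel \<partial>lborel)"
      by (subst lborel.nn_integral_fst[symmetric]) (auto simp: case_prod_beta)
    also have "\<dots> = (\<integral>\<^sup>+t. indicator {0..1::real} t * (\<integral>\<^sup>+s. ennreal (norm (box_kernel s * ?h s)) \<partial>lborel) \<partial>lborel)"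
      by (intro nn_integral_cong) (auto simp: box_kernel_def indicator_def)
    also have "\<dots> = (\<integral>\<^sup>+s. ennreal (norm (box_kernel s * ?h s)) \<partial>lborel)"
      by (subst nn_integral_multc) auto
    also have "\<dots> < \<infinity>" using hint by (simp add: integrable_iff_bounded)
    finally show "integrable (lborel \<Otimes>\<^sub>M lborel) (\<lambda>(t, s). box_kernel t * (box_kernel s * ?h s))"
      by (intro integrableI_bounded) measurable
    have "(\<lambda>z. box_kernel (fst z) * (indicator {0..} (snd z) * indicator {0..} (fst z - snd z) * ?h (snd z)))
        \<in> borel_measurable (lborel \<Otimes>\<^sub>M lborel)" by measurable
    also have "(\<lambda>z. box_kernel (fst z) * (indicator {0..} (snd z) * indicator {0..} (fst z - snd z) * ?h (snd z))) = ?\<phi>"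
      by (auto simp: fun_eq_iff indicator_def)
    finally show "?\<phi> \<in> borel_measurable (lborel \<Otimes>\<^sub>M lborel)" .
    show "AE z in lborel \<Otimes>\<^sub>M lborel. norm (?\<phi> z)
        \<le> norm (case z of (t, s) \<Rightarrow> box_kernel t * (box_kernel s * ?h s))"
      by (intro AE_I2) (auto simp: box_kernel_def indicator_def)
  qed
  have Fint: "integrable lborel (\<lambda>t. box_kernel t * F (x + \<delta> * t))"
  proof -
    have "isCont (\<lambda>t. F (x + \<delta> * t)) t" for t by (rule isCont_o2[OF _ cont]) (intro continuous_intros)
    then have "integrable lborel (\<lambda>t. F (x + \<delta> * t) * indicator {0..1} t)"
      using borel_integrable_atLeastAtMost[of 0 1 "\<lambda>t. F (x + \<delta> * t)"] by simp
    then show ?thesis by (simp add: box_kernel_def mult.commute)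
  qed
  have Cint: "integrable lborel (\<lambda>t. box_kernel t * F x)" by (simp add: box_kernel_def)
  have one: "(LINT t|lborel. box_kernel t * F x) = F x" by (simp add: box_kernel_def)
  have "average \<delta> box_kernel F x - F x
      = (LINT t|lborel. box_kernel t * F (x + \<delta> * t) - box_kernel t * F x)"
    using Fint Cint one by (simp add: average_def)
  also have "\<dots> = (LINT t|lborel. \<delta> * (LINT s|lborel. ?\<phi> (t, s)))"
  proof (rule Bochner_Integration.integral_cong[OF refl])
    fix t
    show "box_kernel t * F (x + \<delta> * t) - box_kernel t * F x = \<delta> * (LINT s|lborel. ?\<phi> (t, s))"
      using incr[of t] by (auto simp: box_kernel_def indicator_def)
  qed
  also have "\<dots> = \<delta> * (LINT s|lborel. LINT t|lborel. ?\<phi> (t, s))"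
    using lborel_pair.Fubini_integral[OF pair] by simp
  also have "(LINT s|lborel. LINT t|lborel. ?\<phi> (t, s)) = average \<delta> coramp_kernel h x"
    unfolding average_def
  proof (rule Bochner_Integration.integral_cong[OF refl])
    fix s
    have "(LINT t|lborel. ?\<phi> (t, s)) = (LINT t|lborel. indicator {s..1} t * (indicator {0..1} s * ?h s))"
      by (intro Bochner_Integration.integral_cong) (auto simp: box_kernel_def indicator_def)
    also have "\<dots> = coramp_kernel s * ?h s"
    proof (cases "s \<in> {0..1}")
      case False
      then have "indicator {0..1} s = (0 :: real)" by (rule indicator_simps(2))
      then show ?thesis by (simp only: coramp_kernel_def mult_zero_left mult_zero_right integral_zero)
    qed (simp add: coramp_kernel_def)
    finally show "(LINT t|lborel. ?\<phi> (t, s)) = coramp_kernel s * ?h s" .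
  qed
  finally show "residual \<delta> box_kernel F x = - \<delta> * average \<delta> coramp_kernel h x"
    by (simp add: residual_def)
qed

lemma average_power_cmult: "(average \<delta> k ^^ n) (\<lambda>x. c * f x) = (\<lambda>x. c * (average \<delta> k ^^ n) f x)"
  by (induction n) (auto simp: average_cmult)

text \<open>\<open>G j\<close> stands for the \<open>j\<close>-th derivative. The functions \<open>G j\<close> with \<open>0 < j \<le> r\<close> need not belong to the
  variable exponent space nor be tame, which is why the induction applies one difference to the whole
  chain of derivatives instead of exchanging averages.\<close>

lemma box_residual_power_derivative:
  fixes G :: "nat \<Rightarrow> real \<Rightarrow> real"
  assumes \<delta>: "0 < \<delta>"
    and G: "\<And>j x. j < r \<Longrightarrow> (G j has_real_derivative G (Suc j) x) (at x)" and cont: "\<And>x. isCont (G r) x"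
    and h: "h \<in> borel_measurable borel" "\<And>x y. x \<le> y \<Longrightarrow> set_integrable lborel {x..y} h"
      "\<And>x y. x \<le> y \<Longrightarrow> G r y - G r x = (LINT t:{x..y}|lborel. h t)"
  shows "(residual \<delta> box_kernel ^^ Suc r) (G 0)
    = (\<lambda>x. (- \<delta>) ^ Suc r * (average \<delta> coramp_kernel ^^ Suc r) h x)"
  using G cont h
proof (induction r arbitrary: G h)
  case 0
  then show ?case using box_residual_primitive[OF \<delta> 0(3-5)] by simp
next
  case (Suc r)
  define H where "H j = residual \<delta> box_kernel (G j)" for j
  have conts: "isCont (G j) x" if "j \<le> Suc r" for j x
  proof (cases "j = Suc r")
    case False
    then show ?thesis using DERIV_isCont[OF Suc.prems(1)[of j]] that by simp
  qed (use Suc.prems(2) in simp)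
  have dH: "(H j has_real_derivative H (Suc j) x) (at x)" "isCont (H (Suc j)) x" if "j \<le> r" for j x
    unfolding H_def using that by (auto intro!: box_residual_has_derivative[OF \<delta> Suc.prems(1)] conts)
  have Hr: "H (Suc r) = (\<lambda>x. - \<delta> * average \<delta> coramp_kernel h x)"
    unfolding H_def by (rule box_residual_primitive[OF \<delta> Suc.prems(3-5)]) (use Suc.prems(2) in auto)
  have cHr: "continuous_on A (H (Suc r))" for A
    using dH(2)[of r] by (intro continuous_at_imp_continuous_on) auto
  have "(residual \<delta> box_kernel ^^ Suc (Suc r)) (G 0) = (residual \<delta> box_kernel ^^ Suc r) (H 0)"
    by (simp only: funpow_Suc_right comp_apply H_def)
  also have "\<dots> = (\<lambda>x. (- \<delta>) ^ Suc r * (average \<delta> coramp_kernel ^^ Suc r) (H (Suc r)) x)"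
  proof (rule Suc.IH)
    show "H (Suc r) \<in> borel_measurable borel" by (rule borel_measurable_continuous_onI[OF cHr])
    show "isCont (H r) x" for x using dH(1)[of r] DERIV_isCont by blast
    fix x y :: real assume xy: "x \<le> y"
    show "set_integrable lborel {x..y} (H (Suc r))"
      by (rule borel_integrable_atLeastAtMost'[OF cHr])
    have "(LINT t|lborel. H (Suc r) t * indicator {x..y} t) = H r y - H r x"
      using dH[of r] xy by (intro integral_FTC_Icc_real) auto
    then show "H r y - H r x = (LINT t:{x..y}|lborel. H (Suc r) t)"
      by (simp add: set_lebesgue_integral_def mult.commute)
  qed (use dH in auto)
  also have "(average \<delta> coramp_kernel ^^ Suc r) (H (Suc r))
      = (\<lambda>x. - \<delta> * (average \<delta> coramp_kernel ^^ Suc (Suc r)) h x)"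
    unfolding Hr average_power_cmult funpow_Suc_right[of "Suc r"] comp_apply ..
  finally show ?case by (simp add: mult_ac)
qed

section \<open>Steklov averages\<close>

lemma AE_lebesgue_translate:
  assumes "AE y in lebesgue. P (y :: real)"
  shows "AE t in lebesgue. P (x + t)"
proof -
  have "AE y in lborel. P y" using assms by (simp add: AE_completion_iff)
  then obtain N where N: "N \<in> null_sets lborel" "{y. \<not> P y} \<subseteq> N"
    unfolding eventually_ae_filter by auto
  have [measurable]: "N \<in> sets borel" using null_setsD2[OF N(1)] by simp
  have "AE y in lborel. y \<notin> N" using N(1) by (rule AE_not_in)
  then have "AE t in lborel. x + 1 * t \<notin> N"
    by (intro AE_borel_affine[of 1 "\<lambda>y. y \<notin> N" x]) auto
  then have "AE t in lborel. P (x + t)" by eventually_elim (use N(2) in auto)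
  then show ?thesis by (rule AE_completion)
qed

lemma Steklov_eq_average:
  assumes \<delta>: "0 < \<delta>" and [measurable]: "g \<in> borel_measurable borel" and eq: "AE y in lebesgue. f y = g y"
  shows "Steklov \<delta> f x = average \<delta> box_kernel g x"
proof -
  have ae: "AE t in lebesgue. indicator {0..\<delta>} t *\<^sub>R g (x + t) = indicator {0..\<delta>} t *\<^sub>R f (x + t)"
    using AE_lebesgue_translate[OF eq, of x] by eventually_elim simp
  have gm: "(\<lambda>t. indicator {0..\<delta>} t *\<^sub>R g (x + t)) \<in> borel_measurable lborel" by measurable
  then have gm': "(\<lambda>t. indicator {0..\<delta>} t *\<^sub>R g (x + t)) \<in> borel_measurable lebesgue"
    by (rule measurable_completion)
  have "(LINT t:{0..\<delta>}|lebesgue. f (x + t)) = (LINT t|lebesgue. indicator {0..\<delta>} t *\<^sub>R g (x + t))"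
    unfolding set_lebesgue_integral_def
    by (intro integral_cong_AE borel_measurable_AE[OF gm' ae] gm') (use ae in \<open>eventually_elim, auto\<close>)
  also have "\<dots> = (LINT t|lborel. indicator {0..\<delta>} t * g (x + t))"
    by (subst integral_completion[OF gm]) simp
  also have "\<dots> = \<delta> * (LINT s|lborel. indicator {0..\<delta>} (\<delta> * s) * g (x + \<delta> * s))"
    by (subst lborel_integral_real_affine[where c = \<delta> and t = 0]) (use \<delta> in auto)
  also have "(LINT s|lborel. indicator {0..\<delta>} (\<delta> * s) * g (x + \<delta> * s)) = average \<delta> box_kernel g x"
    unfolding average_def using \<delta>
    by (intro Bochner_Integration.integral_cong)
       (auto simp: box_kernel_def indicator_def zero_le_mult_iff mult_le_cancel_left1)
  finally show ?thesis using \<delta> by (simp add: Steklov_def)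
qed

text \<open>Lebesgue measurable functions are replaced by Borel representatives, for which the Tonelli and Fubini
  theorems on the plane apply.\<close>

lemma Steklov_differences:
  assumes \<delta>: "0 < \<delta>" and g: "g \<in> tame \<delta>" and eq: "AE y in lebesgue. f y = g y"
  shows "AE y in lebesgue. ((\<lambda>g x. g x - Steklov \<delta> g x) ^^ r) f y = (residual \<delta> box_kernel ^^ r) g y"
proof (induction r)
  case (Suc r)
  have "(residual \<delta> box_kernel ^^ r) g \<in> borel_measurable borel"
    by (rule tame_measurable[OF residual_power_tame[OF g kernel_box]])
  from Steklov_eq_average[OF \<delta> this Suc] show ?case
    using Suc by (simp add: residual_def)
qed (use eq in simp)

section \<open>Equivalence of the K-functional and the modulus\<close>

lemma residual_power_add:
  assumes k: "kernel m B k" and f: "f \<in> tame \<delta>" and g: "g \<in> tame \<delta>"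
  shows "(residual \<delta> k ^^ n) (\<lambda>x. f x + g x) = (\<lambda>x. (residual \<delta> k ^^ n) f x + (residual \<delta> k ^^ n) g x)"
  by (induction n) (simp_all add: residual_add[OF k residual_power_tame[OF f k] residual_power_tame[OF g k]])

context log_Hoelder_exponent
begin

abbreviation operator_constant :: real where
  "operator_constant \<equiv> 217 * exp (4 * c\<^sub>3)"

lemma borel_representative:
  assumes "f \<in> Lp_space p"
  obtains f' where "f' \<in> borel_measurable borel" "AE x in lebesgue. f x = f' x"
    "f' \<in> Lp_space p" "Lp_norm p f' = Lp_norm p f"
proof -
  obtain f' where f': "f' \<in> borel_measurable lborel" "AE x in lborel. f x = f' x"
    using completion_ex_borel_measurable_real[OF Lp_space_measurable[OF assms]] by blast
  have ae: "AE x in lebesgue. f x = f' x" using f'(2) by (rule AE_completion)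
  have m: "f' \<in> borel_measurable lebesgue" using f'(1) by (rule measurable_completion)
  have ae': "AE x in lebesgue. f' x = f x" using ae by eventually_elim simp
  show thesis
    using that[of f'] f'(1) ae Lp_cong_AE[OF assms m ae'] by simp
qed

lemma modulus_eq:
  assumes \<delta>: "0 < \<delta>" and f: "f' \<in> tame \<delta>" "AE x in lebesgue. f x = f' x"
    and Lp: "(residual \<delta> box_kernel ^^ r) f' \<in> Lp_space p"
  shows "modulus r f \<delta> p = Lp_norm p ((residual \<delta> box_kernel ^^ r) f')"
proof -
  note ae = Steklov_differences[OF \<delta> f, of r]
  have "AE x in lebesgue. (residual \<delta> box_kernel ^^ r) f' x = ((\<lambda>g x. g x - Steklov \<delta> g x) ^^ r) f x"
    using ae by eventually_elim simp
  then have "((\<lambda>g x. g x - Steklov \<delta> g x) ^^ r) f \<in> borel_measurable lebesgue"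
    by (rule borel_measurable_AE[OF Lp_space_measurable[OF Lp]])
  then show ?thesis unfolding modulus_def using Lp_cong_AE(2)[OF Lp _ ae] by simp
qed

lemma Sobolev_derivative_chain:
  assumes g: "g \<in> Sobolev (Suc r) p"
  shows "\<And>j x. j < r \<Longrightarrow> ((deriv ^^ j) g has_real_derivative (deriv ^^ Suc j) g x) (at x)"
    and "\<And>x. isCont ((deriv ^^ r) g) x"
    and "\<And>x. isCont g x"
proof -
  show d: "((deriv ^^ j) g has_real_derivative (deriv ^^ Suc j) g x) (at x)" if "j < r" for j x
    using g that by (simp add: Sobolev_def DERIV_deriv_iff_real_differentiable)
  show c: "isCont ((deriv ^^ r) g) x" for x
    using g by (auto simp: Sobolev_def intro: abs_continuous_isCont)
  show "isCont g x" for x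
  proof (cases r)
    case 0
    then show ?thesis using c[of x] by simp
  next
    case (Suc r')
    then show ?thesis using d[of 0 x] DERIV_isCont by auto
  qed
qed

lemma Sobolev_differences:
  assumes \<delta>: "0 < \<delta>" and r: "1 \<le> r" and g: "g \<in> Sobolev r p"
  shows "(residual \<delta> box_kernel ^^ r) g \<in> Lp_space p"
    and "Lp_norm p ((residual \<delta> box_kernel ^^ r) g) \<le> \<delta> ^ r * (operator_constant * Lp_norm p ((deriv ^^ r) g))"
proof -
  obtain r' where r': "r = Suc r'" using r by (cases r) auto
  note chain = Sobolev_derivative_chain[OF g[unfolded r']]
  have "(deriv ^^ r) g \<in> Lp_space p" using g by (simp add: Sobolev_def)
  then obtain h where h: "h \<in> borel_measurable borel" "AE x in lebesgue. (deriv ^^ r) g x = h x"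
    "h \<in> Lp_space p" "Lp_norm p h = Lp_norm p ((deriv ^^ r) g)" by (rule borel_representative)
  have ac: "abs_continuous ((deriv ^^ r') g)" using g by (simp add: r' Sobolev_def)
  have FTC: "set_integrable lborel {x..y} h \<and>
      (deriv ^^ r') g y - (deriv ^^ r') g x = (LINT t:{x..y}|lborel. h t)" if xy: "x \<le> y" for x y
  proof -
    have ae: "AE t in lebesgue. indicator {x..y} t *\<^sub>R deriv ((deriv ^^ r') g) t = indicator {x..y} t *\<^sub>R h t"
      using h(2) by eventually_elim (simp add: r')
    have m: "(\<lambda>t. indicator {x..y} t *\<^sub>R h t) \<in> borel_measurable lborel" using h(1) by measurable
    have int: "integrable lebesgue (\<lambda>t. indicator {x..y} t *\<^sub>R deriv ((deriv ^^ r') g) t)"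
      using abs_continuous_FTC(2)[OF ac xy] by (simp add: set_integrable_def)
    have "integrable lebesgue (\<lambda>t. indicator {x..y} t *\<^sub>R h t)"
      by (rule integrable_cong_AE_imp[OF int measurable_completion[OF m] ae])
    then have "integrable lborel (\<lambda>t. indicator {x..y} t *\<^sub>R h t)"
      using integrable_completion[OF m] by simp
    moreover have "(LINT t|lebesgue. indicator {x..y} t *\<^sub>R deriv ((deriv ^^ r') g) t)
        = (LINT t|lborel. indicator {x..y} t *\<^sub>R h t)"
      using integral_cong_AE[OF borel_measurable_integrable[OF int] measurable_completion[OF m] ae]
        integral_completion[OF m] by simp
    ultimately show ?thesis
      using abs_continuous_FTC(3)[OF ac xy] by (simp add: set_integrable_def set_lebesgue_integral_def)
  qed
  have eq: "(residual \<delta> box_kernel ^^ r) g = (\<lambda>x. (- \<delta>) ^ r * (average \<delta> coramp_kernel ^^ r) h x)"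
  proof -
    have "(residual \<delta> box_kernel ^^ Suc r') ((deriv ^^ 0) g)
        = (\<lambda>x. (- \<delta>) ^ Suc r' * (average \<delta> coramp_kernel ^^ Suc r') h x)"
    proof (rule box_residual_power_derivative[OF \<delta>, of r' "\<lambda>j. (deriv ^^ j) g" h])
      show "((deriv ^^ j) g has_real_derivative (deriv ^^ Suc j) g x) (at x)" if "j < r'" for j x
        by (rule chain(1)[OF that])
      show "isCont ((deriv ^^ r') g) x" for x by (rule chain(2))
    qed (use h(1) FTC in blast)+
    then show ?thesis by (simp only: r' funpow_0)
  qed
  have dom: "dominated \<delta> 1 ((average \<delta> coramp_kernel ^^ r) h) h"
    by (rule dominated_coramp_power[OF Lp_tame[OF h(1,3) \<delta>]])
  note L = Lp_dominated[OF dom h(1,3) \<delta>]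
  show "(residual \<delta> box_kernel ^^ r) g \<in> Lp_space p" unfolding eq by (rule Lp_cmult(1)[OF L(1)])
  have "Lp_norm p ((residual \<delta> box_kernel ^^ r) g)
      \<le> \<bar>(- \<delta>) ^ r\<bar> * Lp_norm p ((average \<delta> coramp_kernel ^^ r) h)"
    unfolding eq by (rule Lp_cmult(2)[OF L(1)])
  also have "\<dots> \<le> \<delta> ^ r * (operator_constant * Lp_norm p h)"
    using L(2) \<delta> by (simp add: power_abs)
  finally show "Lp_norm p ((residual \<delta> box_kernel ^^ r) g)
      \<le> \<delta> ^ r * (operator_constant * Lp_norm p ((deriv ^^ r) g))" unfolding h(4) .
qed

text \<open>The number \<open>5/4\<close> comes from a single difference when \<open>r\<close> is odd, of moment \<open>5/2\<close> instead of \<open>2\<close>.\<close>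

lemma modulus_le_competitor:
  assumes \<delta>: "0 < \<delta>" and r: "1 \<le> r" and f: "f \<in> Lp_space p" and g: "g \<in> Sobolev r p"
  shows "modulus r f \<delta> p \<le> 5 / 4 * 2 ^ r * operator_constant
    * (Lp_norm p (\<lambda>x. f x - g x) + \<delta> ^ r * Lp_norm p ((deriv ^^ r) g))"
proof -
  let ?R = "residual \<delta> box_kernel ^^ r"
  obtain r' where r': "r = Suc r'" using r by (cases r) auto
  obtain f' where f': "f' \<in> borel_measurable borel" "AE x in lebesgue. f x = f' x"
    "f' \<in> Lp_space p" "Lp_norm p f' = Lp_norm p f" using f by (rule borel_representative)
  have gL: "g \<in> Lp_space p" using g by (simp add: Sobolev_def)
  have gm: "g \<in> borel_measurable borel"
    using Sobolev_derivative_chain(3)[OF g[unfolded r']]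
    by (intro borel_measurable_continuous_onI continuous_at_imp_continuous_on) auto
  have gt: "g \<in> tame \<delta>" by (rule Lp_tame[OF gm gL \<delta>])
  define d where "d x = f' x - g x" for x
  have dm: "d \<in> borel_measurable borel" unfolding d_def using f'(1) gm by measurable
  have dL: "d \<in> Lp_space p"
    using Lp_add(1)[OF f'(3) Lp_cmult(1)[OF gL, of "-1"]] by (simp add: d_def[abs_def])
  have dt: "d \<in> tame \<delta>" by (rule Lp_tame[OF dm dL \<delta>])
  have d_norm: "Lp_norm p (\<lambda>x. f x - g x) = Lp_norm p d"
  proof (rule Lp_cong_AE(2)[OF dL])
    show "(\<lambda>x. f x - g x) \<in> borel_measurable lebesgue"
      using Lp_space_measurable[OF f] Lp_space_measurable[OF gL] by measurable
    show "AE x in lebesgue. f x - g x = d x" using f'(2) by eventually_elim (simp add: d_def)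
  qed
  note Rd = Lp_dominated[OF dominated_box_residual_power[OF dt, of r] dm dL \<delta>]
  note Rg = Sobolev_differences[OF \<delta> r g]
  have split: "?R f' = (\<lambda>x. ?R d x + ?R g x)"
    using residual_power_add[OF kernel_box dt gt, of r] by (simp add: d_def)
  have RL: "?R f' \<in> Lp_space p" unfolding split by (rule Lp_add(1)[OF Rd(1) Rg(1)])
  have "modulus r f \<delta> p = Lp_norm p (?R f')"
    by (rule modulus_eq[OF \<delta> Lp_tame[OF f'(1,3) \<delta>] f'(2) RL])
  also have "\<dots> \<le> Lp_norm p (?R d) + Lp_norm p (?R g)"
    unfolding split by (rule Lp_add(2)[OF Rd(1) Rg(1)])
  also have "\<dots> \<le> 5 / 4 * 2 ^ r * operator_constant * Lp_norm p d
      + 1 * operator_constant * (\<delta> ^ r * Lp_norm p ((deriv ^^ r) g))"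
    using Rd(2) Rg(2) by (simp add: ac_simps)
  also have "\<dots> \<le> 5 / 4 * 2 ^ r * operator_constant * Lp_norm p d
      + 5 / 4 * 2 ^ r * operator_constant * (\<delta> ^ r * Lp_norm p ((deriv ^^ r) g))"
  proof (intro add_left_mono mult_right_mono)
    have "1 \<le> (2 :: real) ^ r" by simp
    then show "1 \<le> 5 / 4 * (2 :: real) ^ r" by linarith
    show "0 \<le> \<delta> ^ r * Lp_norm p ((deriv ^^ r) g)"
      using \<delta> g by (intro mult_nonneg_nonneg Lp_norm_nonneg) (auto simp: Sobolev_def)
  qed simp
  finally show ?thesis unfolding d_norm by (simp add: distrib_left)
qed

text \<open>\<open>64 = 4\<^sup>2 \<times> 4\<close>: the splitting of order \<open>(r + 1, r)\<close> costs \<open>4^(2r+1)\<close>, and passing from \<open>(I - T)^r f\<close> to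
  \<open>(I - E)^r f\<close> costs \<open>4^r\<close>. The derivative has one more factor \<open>E\<close>, of moment \<open>2\<close>, than the error.\<close>

lemma good_competitor:
  assumes \<delta>: "0 < \<delta>" and r: "1 \<le> r" and f: "f \<in> Lp_space p"
  obtains g where "g \<in> Sobolev r p"
    "Lp_norm p (\<lambda>x. f x - g x) + \<delta> ^ r * Lp_norm p ((deriv ^^ r) g)
      \<le> 12 * 64 ^ r * operator_constant * modulus r f \<delta> p"
proof -
  let ?E = "average \<delta> exp_kernel" and ?D = "residual \<delta> exp_kernel" and ?M = "4 ^ (Suc r + r) :: real"
  obtain f' where f': "f' \<in> borel_measurable borel" "AE x in lebesgue. f x = f' x"
    "f' \<in> Lp_space p" "Lp_norm p f' = Lp_norm p f" using f by (rule borel_representative)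
  have ft: "f' \<in> tame \<delta>" by (rule Lp_tame[OF f'(1,3) \<delta>])
  obtain G H where G: "multiplier \<delta> ?M G" and H: "multiplier \<delta> ?M H"
    and split: "\<And>f. f \<in> tame \<delta> \<Longrightarrow> f = (\<lambda>x. (?E ^^ Suc r) (G f) x + (?D ^^ r) (H f) x)"
    using exp_splitting[of \<delta> "Suc r" r] by blast
  define w where "w = (residual \<delta> box_kernel ^^ r) f'"
  have wL: "w \<in> Lp_space p" unfolding w_def
    by (rule Lp_dominated(1)[OF dominated_box_residual_power[OF ft] f'(1,3) \<delta>])
  have wm: "w \<in> borel_measurable borel" unfolding w_def
    by (rule tame_measurable[OF residual_power_tame[OF ft kernel_box]])
  have modulus: "modulus r f \<delta> p = Lp_norm p w"
    unfolding w_def by (rule modulus_eq[OF \<delta> ft f'(2) wL[unfolded w_def]])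
  define e where "e = (?D ^^ r) f'"
  have et: "e \<in> tame \<delta>" unfolding e_def by (rule residual_power_tame[OF ft kernel_exp])
  have ew: "dominated \<delta> (4 ^ r) e w" unfolding e_def w_def by (rule exp_residual_dominated[OF ft])
  have pow: "?M * 4 ^ r = 4 * 64 ^ r"
  proof -
    have "(64 :: real) ^ r = (4 ^ 3) ^ r" by simp
    also have "\<dots> = 4 ^ (3 * r)" by (simp only: power_mult)
    finally show ?thesis by (simp flip: power_add add: algebra_simps) 
  qed
  define g where "g = (?E ^^ Suc r) (G f')"
  have Gt: "G f' \<in> tame \<delta>" using G ft dominated_tame unfolding multiplier_def by blast
  have rest: "f' x - g x = H e x" for x
    using fun_cong[OF split[OF ft], of x] multiplier_commute_powers(2)[OF H ft, of r]
    by (simp add: g_def e_def)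
  have He: "dominated \<delta> (4 * 64 ^ r) (H e) w"
  proof -
    have "dominated \<delta> ?M (H e) e" using H et unfolding multiplier_def by blast
    then show ?thesis using dominated_trans[OF _ ew, of ?M "H e"] unfolding pow by blast
  qed
  note HeL = Lp_dominated[OF He wm wL \<delta>]
  have g_eq: "g = (\<lambda>x. f' x + (- 1) * H e x)" using rest by (simp add: fun_eq_iff algebra_simps)
  have gL: "g \<in> Lp_space p" unfolding g_eq by (intro Lp_add(1) Lp_cmult(1) f' HeL)
  have top: "(deriv ^^ r) g = (\<lambda>x. (- 1 / \<delta>) ^ r * ?E (G e) x)"
  proof -
    have "(?D ^^ r) (?E (G f')) = ?E (G e)"
      using multiplier_commute_powers(2)[OF multiplier_exp Gt, of r]
        multiplier_commute_powers(2)[OF G ft, of r] by (simp add: e_def)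
    then show ?thesis unfolding g_def using exp_power_derivatives(1)[OF Gt \<delta>, of r r] by simp
  qed
  have EGe: "dominated \<delta> (8 * 64 ^ r) (?E (G e)) w"
  proof -
    have "dominated \<delta> (2 * ?M) (?E (G e)) e"
      using multiplier_compose[OF multiplier_exp G] et unfolding multiplier_def by blast
    then have "dominated \<delta> (2 * ?M * 4 ^ r) (?E (G e)) w" by (rule dominated_trans[OF _ ew])
    moreover have eq: "2 * ?M * 4 ^ r = 8 * 64 ^ r" using pow by simp
    ultimately show ?thesis by (simp only: eq)
  qed
  note EGeL = Lp_dominated[OF EGe wm wL \<delta>]
  have topL: "(deriv ^^ r) g \<in> Lp_space p" unfolding top by (rule Lp_cmult(1)[OF EGeL(1)])
  have "g \<in> Sobolev r p"
    unfolding Sobolev_def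
  proof (intro CollectI conjI allI impI gL topL)
    show "(deriv ^^ k) g differentiable at x" if "k < r - 1" for k x
    proof -
      have "k < r" using that by simp
      then show ?thesis
        using exp_power_derivatives(2)[OF Gt \<delta>, of k r x] unfolding g_def real_differentiable_def
        by (meson less_imp_le)
    qed
    show "abs_continuous ((deriv ^^ (r - 1)) g)"
    proof (rule abs_continuous_primitive[OF topL])
      show "((deriv ^^ (r - 1)) g has_real_derivative (deriv ^^ r) g x) (at x)" for x
        using exp_power_derivatives(2)[OF Gt \<delta>, of "r - 1" r x] r unfolding g_def by simp
      have "isCont (?E (G e)) x" for x
        using isCont_exp_average[OF _ \<delta>] G et dominated_tame unfolding multiplier_def by blast
      then show "isCont ((deriv ^^ r) g) x" for x unfolding top by (intro continuous_intros)
    qed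
  qed
  moreover have "Lp_norm p (\<lambda>x. f x - g x) + \<delta> ^ r * Lp_norm p ((deriv ^^ r) g)
      \<le> 12 * 64 ^ r * operator_constant * modulus r f \<delta> p"
  proof -
    have "Lp_norm p (\<lambda>x. f x - g x) = Lp_norm p (H e)"
    proof (rule Lp_cong_AE(2)[OF HeL(1)])
      show "(\<lambda>x. f x - g x) \<in> borel_measurable lebesgue"
        using Lp_space_measurable[OF f] Lp_space_measurable[OF gL] by measurable
      show "AE x in lebesgue. f x - g x = H e x" using f'(2) by eventually_elim (simp add: rest)
    qed
    also have "\<dots> \<le> 4 * 64 ^ r * operator_constant * Lp_norm p w" by (rule HeL(2))
    finally have 1: "Lp_norm p (\<lambda>x. f x - g x) \<le> 4 * 64 ^ r * operator_constant * Lp_norm p w" .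
    have "Lp_norm p ((deriv ^^ r) g) \<le> (1 / \<delta>) ^ r * Lp_norm p (?E (G e))"
      unfolding top using Lp_cmult(2)[OF EGeL(1), of "(- 1 / \<delta>) ^ r"] \<delta> by (simp add: power_abs abs_divide)
    also have "\<dots> \<le> (1 / \<delta>) ^ r * (8 * 64 ^ r * operator_constant * Lp_norm p w)"
      using EGeL(2) \<delta> by (intro mult_left_mono) auto
    finally have "\<delta> ^ r * Lp_norm p ((deriv ^^ r) g)
        \<le> \<delta> ^ r * ((1 / \<delta>) ^ r * (8 * 64 ^ r * operator_constant * Lp_norm p w))"
      using \<delta> by (intro mult_left_mono) auto
    also have "\<dots> = 8 * 64 ^ r * operator_constant * Lp_norm p w"
      using \<delta> by (simp add: power_one_over)
    finally show ?thesis using 1 unfolding modulus by simp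
  qed
  ultimately show thesis by (rule that)
qed

text \<open>A crude bound: \<open>c5\<close> is at least \<open>156 exp (8 c\<^sub>3)\<close>, already if \<open>1\<close> is put for the largest exponent and
  \<open>0\<close> for the series.\<close>

lemma constants_bound:
  assumes "p_plus p < \<infinity>"
  shows "12 * operator_constant \<le> 48 * c7 c\<^sub>3 * c5 p c\<^sub>3"
proof -
  define q where "q = real_of_ereal (p_plus p)"
  have "1 \<le> p_plus p"
  proof -
    have "(1 :: ereal) = esssup lebesgue (\<lambda>x :: real. 1)"
      by (subst esssup_const) auto
    also have "\<dots> \<le> p_plus p"
      unfolding p_plus_def by (rule esssup_mono) (auto simp: one_ereal_def ge_1)
    finally show ?thesis .
  qed
  then have q: "1 \<le> q" unfolding q_def using assms by (cases "p_plus p") (auto simp: one_ereal_def)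
  define S :: real where "S = (\<Sum>k. 1 / 2 ^ (k + 2))"
  have "summable (\<lambda>k. 1 / 2 ^ (k + 2) :: real)"
    using summable_geometric[of "1 / 2 :: real"] summable_mult[of "\<lambda>k. (1 / 2) ^ k" "1 / 4 :: real"]
    by (simp add: power_one_over power_add)
  then have S: "0 \<le> S" unfolding S_def by (intro suminf_nonneg) auto
  have a: "(2 :: real) powr 2 \<le> 2 powr (q + 1)" "(3 :: real) powr 1 \<le> 3 powr q"
    using powr_mono[of 2 "q + 1" "2 :: real"] powr_mono[of 1 q "3 :: real"] q by simp_all
  have b: "13 \<le> 1 + 2 * 3 powr q * (S + 2)"
    using mult_mono[of 3 "3 powr q" 2 "S + 2"] a(2) S by (simp add: mult.commute)
  have "4 * 3 * 13 \<le> 2 powr (q + 1) * 3 powr q * (1 + 2 * 3 powr q * (S + 2))"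
    using a b by (intro mult_mono) auto
  then have c5: "156 * exp (8 * c\<^sub>3) \<le> c5 p c\<^sub>3"
    unfolding c5_def Let_def q_def[symmetric] S_def[symmetric] by (intro mult_right_mono) auto
  have e: "exp (4 * c\<^sub>3) \<le> exp (8 * c\<^sub>3)" "1 \<le> exp (8 * c\<^sub>3)" using constants_pos by auto
  have "12 * operator_constant \<le> 96 * (156 * exp (8 * c\<^sub>3))" using e by linarith
  also have "\<dots> \<le> 96 * c5 p c\<^sub>3" using c5 by simp
  also have "\<dots> \<le> 48 * c7 c\<^sub>3 * c5 p c\<^sub>3"
    using e c5 by (intro mult_right_mono) (auto simp: c7_def intro: order_trans[rotated])
  finally show ?thesis .
qed

end

theorem theorem3p3:
  fixes p f :: "real \<Rightarrow> real" and r :: nat and \<delta> c\<^sub>1 c\<^sub>2 c\<^sub>3 :: real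
  assumes "p \<in> P_Log"
    and "log_Hoelder_constants p c\<^sub>1 c\<^sub>2"
    and "c\<^sub>3 = max c\<^sub>1 c\<^sub>2"
    and "1 \<le> r"
    and "0 < \<delta>"
    and "f \<in> Lp_space p"
  shows "1 / (48 * c7 c\<^sub>3 * 2 ^ r * c5 p c\<^sub>3) * modulus r f \<delta> p \<le> K_functional r f \<delta> p
    \<and> K_functional r f \<delta> p
        \<le> 48 * c7 c\<^sub>3 * ((2 * real r) ^ r + 2 ^ r * 34 ^ r) * c5 p c\<^sub>3 * modulus r f \<delta> p"
proof -
  interpret log_Hoelder_exponent p c\<^sub>1 c\<^sub>2 c\<^sub>3
    by standard (use assms in \<open>auto simp: P_Log_def\<close>)
  let ?C = "48 * c7 c\<^sub>3 * c5 p c\<^sub>3"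
  let ?val = "\<lambda>g. Lp_norm p (\<lambda>x. f x - g x) + \<delta> ^ r * Lp_norm p ((deriv ^^ r) g)"
  have C: "12 * operator_constant \<le> ?C"
    using assms(1) by (intro constants_bound) (simp add: P_Log_def)
  have C0: "0 < ?C" by (rule less_le_trans[OF _ C]) simp
  have val0: "0 \<le> ?val g" if "g \<in> Sobolev r p" for g
  proof -
    have "(\<lambda>x. f x + (- 1) * g x) \<in> Lp_space p"
      using that assms(6) by (intro Lp_add(1) Lp_cmult(1)) (auto simp: Sobolev_def)
    then have "0 \<le> Lp_norm p (\<lambda>x. f x - g x)" using Lp_norm_nonneg by fastforce
    then show ?thesis using that assms(5) by (auto simp: Sobolev_def intro!: add_nonneg_nonneg mult_nonneg_nonneg Lp_norm_nonneg)
  qed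
  obtain g where g: "g \<in> Sobolev r p" "?val g \<le> 12 * 64 ^ r * operator_constant * modulus r f \<delta> p"
    by (rule good_competitor[OF assms(5,4,6)])
  have mod0: "0 \<le> modulus r f \<delta> p"
  proof -
    have "0 \<le> 12 * 64 ^ r * operator_constant * modulus r f \<delta> p" using val0[OF g(1)] g(2) by linarith
    moreover have "0 < 12 * 64 ^ r * operator_constant" by simp
    ultimately show ?thesis by (metis mult_pos_neg not_le)
  qed
  show ?thesis
  proof
    show "1 / (48 * c7 c\<^sub>3 * 2 ^ r * c5 p c\<^sub>3) * modulus r f \<delta> p \<le> K_functional r f \<delta> p"
      unfolding K_functional_def
    proof (rule cINF_greatest)
      fix g assume g: "g \<in> Sobolev r p"
      have "modulus r f \<delta> p \<le> 5 / 4 * 2 ^ r * operator_constant * ?val g"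
        by (rule modulus_le_competitor[OF assms(5,4,6) g])
      also have "\<dots> \<le> (2 ^ r * ?C) * ?val g"
      proof (intro mult_right_mono val0[OF g])
        have "5 / 4 * operator_constant \<le> ?C" using C exp_gt_zero[of "4 * c\<^sub>3"] by linarith
        then show "5 / 4 * 2 ^ r * operator_constant \<le> 2 ^ r * ?C"
          using mult_left_mono[of "5 / 4 * operator_constant" ?C "2 ^ r"] by (simp add: ac_simps)
      qed
      finally have "modulus r f \<delta> p / (2 ^ r * ?C) \<le> ?val g"
        using C0 by (subst pos_divide_le_eq) (auto simp: mult.commute)
      moreover have "48 * c7 c\<^sub>3 * 2 ^ r * c5 p c\<^sub>3 = 2 ^ r * ?C" by simp
      ultimately show "1 / (48 * c7 c\<^sub>3 * 2 ^ r * c5 p c\<^sub>3) * modulus r f \<delta> p \<le> ?val g"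
        by (simp only: times_divide_eq_left mult_1_left)
    qed (use g in auto)
    have "K_functional r f \<delta> p \<le> ?val g"
      unfolding K_functional_def using val0 g(1) by (intro cINF_lower bdd_belowI2[of _ 0]) auto
    also have "\<dots> \<le> (12 * operator_constant) * 64 ^ r * modulus r f \<delta> p"
      using g(2) by (simp add: ac_simps)
    also have "\<dots> \<le> ?C * ((2 * real r) ^ r + 2 ^ r * 34 ^ r) * modulus r f \<delta> p"
    proof (rule mult_right_mono[OF mult_mono[OF C] mod0])
      \<comment> \<open>\<open>68 = 2 \<times> 34\<close>, and the splitting loses only \<open>64\<^sup>r\<close>.\<close>
      have "(64 :: real) ^ r \<le> 68 ^ r" by (intro power_mono) auto
      also have "\<dots> = 2 ^ r * 34 ^ r" by (simp flip: power_mult_distrib)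
      finally show "(64 :: real) ^ r \<le> (2 * real r) ^ r + 2 ^ r * 34 ^ r" by (simp add: add_increasing)
    qed (use C0 in auto)
    finally show "K_functional r f \<delta> p
        \<le> 48 * c7 c\<^sub>3 * ((2 * real r) ^ r + 2 ^ r * 34 ^ r) * c5 p c\<^sub>3 * modulus r f \<delta> p"
      by (simp add: ac_simps)
  qed
qed

end
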